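(* Let $I=(a,b)$ be an open interval, $m$ a fully supported Radon measure on $I$, and $\mathtt{s}$ a scaling function on $I$. Let $\{G_n:n\ge1\}\subset\mathbf{G}_{\mathtt{s}}(I)$ be an increasing sequence of characteristic sets, i.e. $G_n\subset G_{n+1}$ $d\mathtt{s}$-a.e. for every $n$, and let $G=\bigcup_{n\ge1}G_n$ ($d\mathtt{s}$-a.e.), so that $G\in\mathbf{G}_{\mathtt{s}}(I)$. Let $\mathtt{s}_n$ and $\mathtt{s}_\infty$ be the scaling functions associated with $G_n$ and $G$, and let $(\mathcal{E}^n,\mathcal{F}^n)=(\mathcal{E}^{(\mathtt{s}_n,m)},\mathcal{F}^{(\mathtt{s}_n,m)}_0)$ and $(\mathcal{E},\mathcal{F})=(\mathcal{E}^{(\mathtt{s}_\infty,m)},\mathcal{F}^{(\mathtt{s}_\infty,m)}_0)$ be the corresponding regular subspaces of $(\mathcal{E}^{(\mathtt{s},m)},\mathcal{F}^{(\mathtt{s},m)}_0)$. Then $(\mathcal{E}^n,\mathcal{F}^n)$ converges to $(\mathcal{E},\mathcal{F})$ in the sense of Mosco as $n\to\infty$.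
   Context: A scaling function on $I$ is a strictly increasing continuous function $\mathtt{s}:I\to\mathbf{R}$; $d\mathtt{s}$ denotes its Lebesgue–Stieltjes measure. For a function $u$ on $I$, $u\ll\mathtt{s}$ means $u(y)-u(x)=\int_x^y v\,d\mathtt{s}$ for all $x<y$ in $I$ for some locally $d\mathtt{s}$-integrable $v$, and then $\frac{du}{d\mathtt{s}}:=v$. Define $$\mathcal{F}^{(\mathtt{s},m)}:=\{u\in L^2(I,m): u\ll\mathtt{s},\ \tfrac{du}{d\mathtt{s}}\in L^2(I,d\mathtt{s})\},\qquad \mathcal{E}^{(\mathtt{s},m)}(u,v):=\tfrac12\int_I\frac{du}{d\mathtt{s}}\frac{dv}{d\mathtt{s}}\,d\mathtt{s},$$ $$\mathcal{F}^{(\mathtt{s},m)}_0:=\{u\in\mathcal{F}^{(\mathtt{s},m)}: u(a)=0\text{ if } a \text{ is } \mathtt{s}\text{-regular, and } u(b)=0 \text{ if } b\text{ is }\mathtt{s}\text{-regular}\}.$$ Here $a$ is $\mathtt{s}$-regular if $\mathtt{s}(a+)>-\infty$ and $m((a,c))<\infty$ for some (all) $c\in I$, and similarly for $b$ ($\mathtt{s}(b-)<\infty$, $m((c,b))<\infty$); $u(a),u(b)$ are the limits at the endpoints. $(\mathcal{E}^{(\mathtt{s},m)},\mathcal{F}^{(\mathtt{s},m)}_0)$ is a regular Dirichlet form on $L^2(I,m)$. $\mathbf{G}_{\mathtt{s}}(I)$ is the collection of (measurable) sets $G\subset I$, identified up to $d\mathtt{s}$-null sets, such that $\int_{G\cap(c,d)}d\mathtt{s}>0$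 for all $c<d$ in $I$. Fix a point $e\in I$. The scaling function associated with $G\in\mathbf{G}_{\mathtt{s}}(I)$ is $\tilde{\mathtt{s}}(x)=\int_e^x 1_G\,d\mathtt{s}$, i.e. the scaling function with $\tilde{\mathtt{s}}(e)=0$, $\tilde{\mathtt{s}}\ll\mathtt{s}$ and $\frac{d\tilde{\mathtt{s}}}{d\mathtt{s}}=1_G$ $d\mathtt{s}$-a.e. The form $(\mathcal{E}^{(\tilde{\mathtt{s}},m)},\mathcal{F}_0^{(\tilde{\mathtt{s}},m)})$ is then a regular Dirichlet form whose domain is contained in $\mathcal{F}_0^{(\mathtt{s},m)}$ and which coincides there with $\mathcal{E}^{(\mathtt{s},m)}$ (a regular subspace), with characteristic set $G$. Mosco convergence: every form $(\mathcal{E},\mathcal{F})$ on a Hilbert space $L^2(I,m)$ is extended by $\mathcal{E}(u,u)=\infty$ for $u\in L^2(I,m)\setminus\mathcal{F}$. $(\mathcal{E}^n,\mathcal{F}^n)$ converges to $(\mathcal{E},\mathcal{F})$ in the sense of Mosco if (a) whenever $u_n\to u$ weakly in $L^2(I,m)$, $\liminf_{n}\mathcal{E}^n(u_n,u_n)\ge\mathcal{E}(u,u)$; and (b) for every $u\in L^2(I,m)$ there is a sequence $u_n\to u$ strongly in $L^2(I,m)$ with $\limsup_n\mathcal{E}^n(u_n,u_n)\le\mathcal{E}(u,u)$. *)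

theory Defs
  imports "HOL-Analysis.Analysis"
begin

text \<open>
  Throughout, \<open>I = einterval a b\<close> with extended real endpoints \<open>a < b\<close>.  Functions on \<open>I\<close> are total
  functions \<open>real \<Rightarrow> real\<close> whose values off \<open>I\<close> never matter, and measures on \<open>I\<close> have \<open>I\<close> itself as
  their space.
\<close>

section \<open>Measures and scaling functions on an open interval\<close>

definition radon_measure_on :: "ereal \<Rightarrow> ereal \<Rightarrow> real measure \<Rightarrow> bool" where
  "radon_measure_on a b m \<longleftrightarrow>
     sets m = sets (restrict_space borel (einterval a b)) \<and>
     (\<forall>K. compact K \<and> K \<subseteq> einterval a b \<longrightarrow> emeasure m K < \<infinity>)"

definition fully_supported_on :: "ereal \<Rightarrow> ereal \<Rightarrow> real measure \<Rightarrow> bool" where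
  "fully_supported_on a b m \<longleftrightarrow>
     (\<forall>U. open U \<and> U \<noteq> {} \<and> U \<subseteq> einterval a b \<longrightarrow> emeasure m U > 0)"

definition scaling_function :: "ereal \<Rightarrow> ereal \<Rightarrow> (real \<Rightarrow> real) \<Rightarrow> bool" where
  "scaling_function a b s \<longleftrightarrow>
     strict_mono_on (einterval a b) s \<and> continuous_on (einterval a b) s"

text \<open>
  The Lebesgue-Stieltjes measure of \<open>s\<close> on \<open>I\<close>.  The library's \<^const>\<open>interval_measure\<close> does not apply,
  since \<open>s\<close> may be unbounded near the endpoints; this is the same construction relative to \<open>I\<close>.
\<close>

definition stieltjes_measure :: "ereal \<Rightarrow> ereal \<Rightarrow> (real \<Rightarrow> real) \<Rightarrow> real measure" where
  "stieltjes_measure a b s =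
     extend_measure (einterval a b)
       {(c, d). c \<in> einterval a b \<and> d \<in> einterval a b \<and> c \<le> d}
       (\<lambda>(c, d). {c<..d}) (\<lambda>(c, d). ennreal (s d - s c))"

lemma Icc_subset_einterval:
  assumes "c \<in> einterval a b" "d \<in> einterval a b" shows "{c..d} \<subseteq> einterval a b"
proof
  fix x assume x: "x \<in> {c..d}"
  have "a < ereal c" "ereal d < b" "ereal c \<le> ereal x" "ereal x \<le> ereal d"
    using assms x by (auto simp: einterval_def)
  then show "x \<in> einterval a b"
    unfolding einterval_def by (metis (mono_tags, lifting) less_le_trans le_less_trans mem_Collect_eq)
qed

lemma Ioc_subset_einterval:
  "c \<in> einterval a b \<Longrightarrow> d \<in> einterval a b \<Longrightarrow> {c<..d} \<subseteq> einterval a b"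
  using Icc_subset_einterval[of c a b d] by auto

lemma space_stieltjes_measure [simp]: "space (stieltjes_measure a b s) = einterval a b"
  unfolding stieltjes_measure_def
  by (subst space_extend_measure) (use Ioc_subset_einterval in fast, simp)

lemma sets_stieltjes_measure [simp, measurable_cong]:
  "sets (stieltjes_measure a b s) = sets (restrict_space borel (einterval a b))"
proof -
  let ?I = "einterval a b"
  let ?P = "{(c, d). c \<in> ?I \<and> d \<in> ?I \<and> c \<le> d}"
  let ?S = "sigma_sets ?I ((\<lambda>(c, d). {c<..d}) ` ?P)"
  have S: "sets (stieltjes_measure a b s) = ?S"
    unfolding stieltjes_measure_def
    by (subst sets_extend_measure) (use Ioc_subset_einterval in fast, simp)
  have sub: "(\<lambda>(c, d). {c<..d}) ` ?P \<subseteq> Pow ?I"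
    using Ioc_subset_einterval by fast
  interpret S: sigma_algebra ?I ?S by (rule sigma_algebra_sigma_sets[OF sub])
  have op: "?I \<inter> {c<..d} \<in> ?S" for c d
  proof (cases "c < d \<and> ?I \<inter> {c<..d} \<noteq> {}")
    case False
    then have "?I \<inter> {c<..d} = {}" by auto
    then show ?thesis by (simp add: sigma_sets.Empty)
  next
    case True
    define Q where "Q = {(p, q). p \<in> \<rat> \<and> q \<in> ?I \<inter> {c<..d} \<and> (q \<in> \<rat> \<or> q = d) \<and> p \<in> ?I \<and> p \<ge> c \<and> p \<le> q}"
    have cQ: "countable Q"
      by (rule countable_subset[of _ "\<rat> \<times> insert d \<rat>"]) (auto simp: Q_def countable_rat)
    have "?I \<inter> {c<..d} = (\<Union>(p, q)\<in>Q. {p<..q})"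
    proof (intro set_eqI iffI)
      fix x assume "x \<in> (\<Union>(p, q)\<in>Q. {p<..q})"
      then obtain p q where pq: "(p, q) \<in> Q" "x \<in> {p<..q}" by auto
      then show "x \<in> ?I \<inter> {c<..d}"
        using Ioc_subset_einterval[of p a b q] by (auto simp: Q_def)
    next
      fix x assume x: "x \<in> ?I \<inter> {c<..d}"
      have "open ?I" by simp
      then obtain r where r: "r > 0" "ball x r \<subseteq> ?I" using x openE by blast
      obtain p where p: "p \<in> \<rat>" "max c (x - r) < p" "p < x"
        using Rats_dense_in_real[of "max c (x - r)" x] x r by auto
      have pI: "p \<in> ?I" using p r by (auto simp: dist_real_def subset_eq)
      show "x \<in> (\<Union>(p, q)\<in>Q. {p<..q})"
      proof (cases "x = d")
        case True
        then have "(p, d) \<in> Q" using p pI x by (auto simp: Q_def)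
        then show ?thesis using True p by (intro UN_I[of "(p, d)"]) auto
      next
        case False
        obtain q where q: "q \<in> \<rat>" "x < q" "q < min d (x + r)"
          using Rats_dense_in_real[of x "min d (x + r)"] x r False by auto
        have "q \<in> ?I" using q r by (auto simp: dist_real_def subset_eq)
        then have "(p, q) \<in> Q" using p pI q x by (auto simp: Q_def)
        then show ?thesis using q p by (intro UN_I[of "(p, q)"]) auto
      qed
    qed
    also have "\<dots> \<in> ?S"
    proof (rule S.countable_UN'[OF cQ])
      show "(\<lambda>(p, q). {p<..q}) ` Q \<subseteq> ?S"
      proof (rule image_subsetI)
        fix z assume "z \<in> Q"
        then have "z \<in> ?P" by (auto simp: Q_def)
        then show "(case z of (p, q) \<Rightarrow> {p<..q}) \<in> ?S"
          by (intro sigma_sets.Basic imageI)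
      qed
    qed
    finally show ?thesis .
  qed
  have B: "sets (restrict_space borel ?I) = sigma_sets ?I ((\<inter>) ?I ` range (\<lambda>(c, d). {c<..d::real}))"
  proof -
    have "?I \<in> sigma_sets UNIV (range (\<lambda>(c, d). {c<..d::real}))"
      using borel_open[OF open_einterval] unfolding borel_sigma_sets_Ioc by simp
    from sigma_sets_Int[OF this] show ?thesis
      unfolding sets_restrict_space borel_sigma_sets_Ioc by (simp add: image_def)
  qed
  have "sets (restrict_space borel ?I) \<subseteq> ?S"
    unfolding B 
  proof (rule sigma_sets_mono, safe)
    fix c d :: real
    show "?I \<inter> {c<..d} \<in> ?S" by (rule op)
  qed
  moreover have "?S \<subseteq> sets (restrict_space borel ?I)"
  proof -
    have "(\<lambda>(c, d). {c<..d}) ` ?P \<subseteq> sets (restrict_space borel ?I)"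
    proof (rule image_subsetI)
      fix z assume "z \<in> ?P"
      then obtain c d where z: "z = (c, d)" "c \<in> ?I" "d \<in> ?I" by auto
      then have "{c<..d} = ?I \<inter> {c<..d}" using Ioc_subset_einterval by blast
      moreover have "{c<..d} \<in> sets borel" by simp
      ultimately show "(case z of (c, d) \<Rightarrow> {c<..d}) \<in> sets (restrict_space borel ?I)"
        unfolding sets_restrict_space z(1) prod.case by (rule image_eqI)
    qed
    from sets.sigma_sets_subset[OF this] show ?thesis by simp
  qed
  ultimately show ?thesis
    unfolding S by blast
qed

lemma emeasure_stieltjes_measure_Ioc:
  assumes s: "scaling_function a b s"
    and cd: "c \<in> einterval a b" "d \<in> einterval a b" "c \<le> d"
  shows "emeasure (stieltjes_measure a b s) {c<..d} = ennreal (s d - s c)"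
proof -
  let ?I = "einterval a b"
  define g where "g = the_inv_into ?I s"
  have mono: "strict_mono_on ?I s" and cont: "continuous_on ?I s"
    using s by (auto simp: scaling_function_def)
  have inj: "inj_on s ?I" by (rule strict_mono_on_imp_inj_on[OF mono])
  have conn: "is_interval (s ` A)" if "A \<subseteq> ?I" "is_interval A" for A
    using that cont by (meson connected_continuous_image continuous_on_subset is_interval_connected_1)
  have "is_interval ?I"
    unfolding is_interval_1 using Icc_subset_einterval by fastforce
  then have J: "s ` ?I \<in> sets borel"
    using conn by (simp add: real_interval_borel_measurable)
  have gs: "g (s x) = x" if "x \<in> ?I" for x
    using that inj by (simp add: g_def the_inv_into_f_f)
  have gm: "mono_on (s ` ?I) g"
  proof (rule mono_onI)
    fix x y assume "x \<in> s ` ?I" "y \<in> s ` ?I" "x \<le> y"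
    then show "g x \<le> g y"
      using strict_mono_on_less[OF mono] by (fastforce simp: gs not_less[symmetric])
  qed
  have im: "s ` A \<in> sets borel" if A: "A \<in> sets (restrict_space borel ?I)" for A
  proof -
    have AI: "A \<subseteq> ?I" and Ab: "A \<in> sets borel"
      using A by (auto simp: sets_restrict_space)
    have "g -` A \<inter> space (restrict_space borel (s ` ?I)) \<in> sets (restrict_space borel (s ` ?I))"
      using borel_measurable_mono_on_fnc[OF gm] Ab by (rule measurable_sets)
    moreover have "g -` A \<inter> space (restrict_space borel (s ` ?I)) = s ` A"
      using AI by (force simp: gs space_restrict_space)
    ultimately show ?thesis using J by (auto simp: sets_restrict_space)
  qed
  show ?thesis
  proof (rule emeasure_extend_measure_Pair[OF stieltjes_measure_def, where \<mu>' = "\<lambda>A. emeasure lborel (s ` A)"])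
    fix c d assume cd: "c \<in> ?I \<and> d \<in> ?I \<and> c \<le> d"
    have sub: "{c..d} \<subseteq> ?I" using cd Icc_subset_einterval by blast
    have "s ` {c<..d} = {s c<..s d}"
    proof (intro set_eqI iffI)
      fix y assume "y \<in> s ` {c<..d}"
      then obtain x where "y = s x" "c < x" "x \<le> d" by auto
      then show "y \<in> {s c<..s d}"
        using cd sub strict_mono_on_less[OF mono, of c x] strict_mono_on_less[OF mono, of d x]
        by (auto simp: not_less[symmetric] subset_eq)
    next
      fix y assume y: "y \<in> {s c<..s d}"
      then obtain x where "c \<le> x" "x \<le> d" "s x = y"
        using IVT'[of s c y d] cd continuous_on_subset[OF cont sub] by auto
      then show "y \<in> s ` {c<..d}" using y by (cases "x = c") auto
    qed
    moreover have "s c \<le> s d" using cd mono by (simp add: strict_mono_on_leD)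
    ultimately show "emeasure lborel (s ` {c<..d}) = ennreal (s d - s c)" by simp
    show "{c<..d} \<in> Pow ?I" using sub by auto
  next
    show "positive (sets (stieltjes_measure a b s)) (\<lambda>A. emeasure lborel (s ` A))"
      by (simp add: positive_def)
    show "countably_additive (sets (stieltjes_measure a b s)) (\<lambda>A. emeasure lborel (s ` A))"
    proof (rule countably_additiveI)
      fix A :: "nat \<Rightarrow> real set"
      assume A: "range A \<subseteq> sets (stieltjes_measure a b s)" "disjoint_family A"
      have AI: "A i \<subseteq> ?I" for i using A(1) sets.sets_into_space[of "A i" "stieltjes_measure a b s"] by auto
      have "disjoint_family (\<lambda>i. s ` A i)"
      proof (unfold disjoint_family_on_def, intro ballI impI)
        fix i j :: nat assume "i \<noteq> j"
        then have "A i \<inter> A j = {}" using A(2) by (auto simp: disjoint_family_on_def)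
        then show "s ` A i \<inter> s ` A j = {}"
          using inj_on_image_Int[OF inj AI AI, of i j] by simp
      qed
      moreover have "range (\<lambda>i. s ` A i) \<subseteq> sets lborel" using A(1) im by auto
      ultimately have "(\<Sum>i. emeasure lborel (s ` A i)) = emeasure lborel (\<Union>i. s ` A i)"
        by (rule suminf_emeasure[rotated])
      then show "(\<Sum>i. emeasure lborel (s ` A i)) = emeasure lborel (s ` (\<Union>i. A i))"
        by (simp add: image_UN)
    qed
    show "c \<in> ?I \<and> d \<in> ?I \<and> c \<le> d" using cd by simp
  qed
qed


section \<open>The forms associated with a scaling function\<close>

definition L2_on :: "real measure \<Rightarrow> (real \<Rightarrow> real) set" where
  "L2_on M = {u \<in> borel_measurable M. integrable M (\<lambda>x. (u x)\<^sup>2)}"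

definition is_scale_deriv ::
    "ereal \<Rightarrow> ereal \<Rightarrow> (real \<Rightarrow> real) \<Rightarrow> (real \<Rightarrow> real) \<Rightarrow> (real \<Rightarrow> real) \<Rightarrow> bool" where
  "is_scale_deriv a b s u v \<longleftrightarrow>
     (\<forall>x\<in>einterval a b. \<forall>y\<in>einterval a b. x < y \<longrightarrow>
        set_integrable (stieltjes_measure a b s) {x..y} v \<and>
        u y - u x = (LINT t:{x..y}|stieltjes_measure a b s. v t))"

definition scale_ac :: "ereal \<Rightarrow> ereal \<Rightarrow> (real \<Rightarrow> real) \<Rightarrow> (real \<Rightarrow> real) \<Rightarrow> bool" where
  "scale_ac a b s u \<longleftrightarrow> (\<exists>v. is_scale_deriv a b s u v)"

text \<open>The choice is unique up to null sets of \<^term>\<open>stieltjes_measure a b s\<close>.\<close>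

definition scale_deriv :: "ereal \<Rightarrow> ereal \<Rightarrow> (real \<Rightarrow> real) \<Rightarrow> (real \<Rightarrow> real) \<Rightarrow> real \<Rightarrow> real" where
  "scale_deriv a b s u = (SOME v. is_scale_deriv a b s u v)"

text \<open>
  Elements of \<open>L\<^sup>2(I, m)\<close> are handled through representatives.  The relation \<open>u \<lless> s\<close>, the derivative
  \<open>du/ds\<close> and the boundary values of a class refer to its representative that is absolutely continuous
  with respect to \<open>s\<close>; that representative is continuous, hence unique on \<open>I\<close> when \<open>m\<close> is fully
  supported.
\<close>

definition is_ac_version ::
    "ereal \<Rightarrow> ereal \<Rightarrow> (real \<Rightarrow> real) \<Rightarrow> real measure \<Rightarrow> (real \<Rightarrow> real) \<Rightarrow> (real \<Rightarrow> real) \<Rightarrow> bool" where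
  "is_ac_version a b s m u w \<longleftrightarrow> (AE x in m. w x = u x) \<and> scale_ac a b s w"

definition ac_version ::
    "ereal \<Rightarrow> ereal \<Rightarrow> (real \<Rightarrow> real) \<Rightarrow> real measure \<Rightarrow> (real \<Rightarrow> real) \<Rightarrow> real \<Rightarrow> real" where
  "ac_version a b s m u = (SOME w. is_ac_version a b s m u w)"

definition form_dom :: "ereal \<Rightarrow> ereal \<Rightarrow> (real \<Rightarrow> real) \<Rightarrow> real measure \<Rightarrow> (real \<Rightarrow> real) set" where
  "form_dom a b s m =
     {u \<in> L2_on m. (\<exists>w. is_ac_version a b s m u w) \<and>
        scale_deriv a b s (ac_version a b s m u) \<in> L2_on (stieltjes_measure a b s)}"

definition form_energy ::
    "ereal \<Rightarrow> ereal \<Rightarrow> (real \<Rightarrow> real) \<Rightarrow> real measure \<Rightarrow> (real \<Rightarrow> real) \<Rightarrow> (real \<Rightarrow> real) \<Rightarrow> real" where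
  "form_energy a b s m u v =
     (1/2) * (LINT x|stieltjes_measure a b s.
        scale_deriv a b s (ac_version a b s m u) x * scale_deriv a b s (ac_version a b s m v) x)"

definition left_regular :: "ereal \<Rightarrow> ereal \<Rightarrow> (real \<Rightarrow> real) \<Rightarrow> real measure \<Rightarrow> bool" where
  "left_regular a b s m \<longleftrightarrow>
     Lim (at_right a) (\<lambda>x. ereal (s (real_of_ereal x))) > -\<infinity> \<and>
     (\<exists>c\<in>einterval a b. emeasure m (einterval a c) < \<infinity>)"

definition right_regular :: "ereal \<Rightarrow> ereal \<Rightarrow> (real \<Rightarrow> real) \<Rightarrow> real measure \<Rightarrow> bool" where
  "right_regular a b s m \<longleftrightarrow>
     Lim (at_left b) (\<lambda>x. ereal (s (real_of_ereal x))) < \<infinity> \<and>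
     (\<exists>c\<in>einterval a b. emeasure m (einterval c b) < \<infinity>)"

definition form_dom0 :: "ereal \<Rightarrow> ereal \<Rightarrow> (real \<Rightarrow> real) \<Rightarrow> real measure \<Rightarrow> (real \<Rightarrow> real) set" where
  "form_dom0 a b s m =
     {u \<in> form_dom a b s m.
        (left_regular a b s m \<longrightarrow>
           ((\<lambda>x. ac_version a b s m u (real_of_ereal x)) \<longlongrightarrow> 0) (at_right a)) \<and>
        (right_regular a b s m \<longrightarrow>
           ((\<lambda>x. ac_version a b s m u (real_of_ereal x)) \<longlongrightarrow> 0) (at_left b))}"

type_synonym L2_form = "((real \<Rightarrow> real) \<Rightarrow> (real \<Rightarrow> real) \<Rightarrow> real) \<times> (real \<Rightarrow> real) set"

definition scale_form0 :: "ereal \<Rightarrow> ereal \<Rightarrow> (real \<Rightarrow> real) \<Rightarrow> real measure \<Rightarrow> L2_form" where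
  "scale_form0 a b s m = (form_energy a b s m, form_dom0 a b s m)"


section \<open>Characteristic sets\<close>

text \<open>
  The identification of sets up to null sets is expressed by stating all relations between
  characteristic sets almost everywhere.
\<close>

definition char_sets :: "ereal \<Rightarrow> ereal \<Rightarrow> (real \<Rightarrow> real) \<Rightarrow> real set set" where
  "char_sets a b s =
     {G \<in> sets (stieltjes_measure a b s).
        \<forall>c\<in>einterval a b. \<forall>d\<in>einterval a b. c < d \<longrightarrow>
          emeasure (stieltjes_measure a b s) (G \<inter> {c<..<d}) > 0}"

definition assoc_scale ::
    "ereal \<Rightarrow> ereal \<Rightarrow> (real \<Rightarrow> real) \<Rightarrow> real \<Rightarrow> real set \<Rightarrow> real \<Rightarrow> real" where
  "assoc_scale a b s e G x = (LINT t=e..x|stieltjes_measure a b s. indicator G t)"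


section \<open>Mosco convergence\<close>

definition strong_conv_L2 ::
    "real measure \<Rightarrow> (nat \<Rightarrow> real \<Rightarrow> real) \<Rightarrow> (real \<Rightarrow> real) \<Rightarrow> bool" where
  "strong_conv_L2 M f g \<longleftrightarrow> (\<lambda>n. LINT x|M. (f n x - g x)\<^sup>2) \<longlonglongrightarrow> 0"

definition weak_conv_L2 ::
    "real measure \<Rightarrow> (nat \<Rightarrow> real \<Rightarrow> real) \<Rightarrow> (real \<Rightarrow> real) \<Rightarrow> bool" where
  "weak_conv_L2 M f g \<longleftrightarrow>
     (\<forall>h\<in>L2_on M. (\<lambda>n. LINT x|M. f n x * h x) \<longlonglongrightarrow> (LINT x|M. g x * h x))"

definition extended_energy :: "L2_form \<Rightarrow> (real \<Rightarrow> real) \<Rightarrow> ereal" where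
  "extended_energy E u = (if u \<in> snd E then ereal (fst E u u) else \<infinity>)"

definition mosco_converges :: "real measure \<Rightarrow> (nat \<Rightarrow> L2_form) \<Rightarrow> L2_form \<Rightarrow> bool" where
  "mosco_converges M En E \<longleftrightarrow>
     (\<forall>f g. (\<forall>n. f n \<in> L2_on M) \<and> g \<in> L2_on M \<and> weak_conv_L2 M f g \<longrightarrow>
        liminf (\<lambda>n. extended_energy (En n) (f n)) \<ge> extended_energy E g) \<and>
     (\<forall>g\<in>L2_on M. \<exists>f. (\<forall>n. f n \<in> L2_on M) \<and> strong_conv_L2 M f g \<and>
        limsup (\<lambda>n. extended_energy (En n) (f n)) \<le> extended_energy E g)"

end

theory Submission
  imports Defs
begin

text \<open>
  Put \<open>\<nu> = ds\<^sub>\<infinity>\<close>; then \<open>ds\<^sub>n\<close> is the restriction of \<open>\<nu>\<close> to \<open>G\<^sub>n\<close>, so the domains increase inside the limit domain and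
  all the energies are energies of the limit form.

  For the liminf condition, functions of energy at most \<open>K\<close> are equicontinuous by Cauchy-Schwarz, and weak
  convergence in \<open>L\<^sup>2(m)\<close> makes their averages over small intervals converge; hence they converge
  pointwise.  The derivative of the limit comes from near-minimizers of the \<open>L\<^sup>2(\<nu>)\<close> norm over nested
  convex sets of candidate derivatives, which keeps the energy bound.

  For the limsup condition, a function of the limit domain is first replaced by one of compact
  support at an arbitrarily small cost.  If it comes arbitrarily close to \<open>0\<close> at an endpoint, a small value
  is subtracted by a ramp inside the interval; otherwise \<open>m\<close> is finite and \<open>\<nu>\<close> infinite near that endpoint,
  and a long ramp down to \<open>0\<close> is cheap.  Then the derivative is multiplied by the indicator of \<open>G\<^sub>n\<close> and
  corrected by a multiple of this indicator so that its integral over the support still vanishes.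
\<close>


section \<open>Square-integrable functions\<close>

text \<open>The boundary conditions are the main obstacle. Regularity of an endpoint can be lost in
  the limit: \<nu> may have infinite mass near it although all the n-th measures are finite there.
  Functions of the n-th domain must then vanish at the endpoint while functions of the limit domain
  need not, so restricting derivatives to \<open>G n\<close> alone gives no recovery sequence.
  Compact support meets the boundary conditions of all scales at once. Regularity cannot be gained
  in the limit, since the n-th measures are at most \<nu>; hence the boundary conditions of the
  limit form hold on every n-th domain. The domains and energies are defined through chosen versions
  and derivatives. All estimates work with explicit witnesses, packed into \<open>form_rep\<close>;
  full support of \<open>m\<close> makes continuous versions unique and so leads back to the
  definitions. Norms appear only squared. The triangle inequality is used with weights
  \<open>1 + \<theta>\<close> and \<open>1 + 1/\<theta>\<close>, so that a small perturbation
  changes an energy by little.\<close>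

abbreviation sqnorm :: "'a measure \<Rightarrow> ('a \<Rightarrow> real) \<Rightarrow> real" where
  "sqnorm M f \<equiv> LINT x|M. (f x)\<^sup>2"

lemma L2_onD:
  assumes "f \<in> L2_on M" shows "f \<in> borel_measurable M" "integrable M (\<lambda>x. (f x)\<^sup>2)"
  using assms by (auto simp: L2_on_def)

lemma L2_on_bound:
  assumes "f \<in> borel_measurable M" "integrable M h" "AE x in M. (f x)\<^sup>2 \<le> h x"
  shows "f \<in> L2_on M"
proof -
  have "integrable M (\<lambda>x. (f x)\<^sup>2)"
    using assms(2) by (rule Bochner_Integration.integrable_bound) (use assms in auto)
  then show ?thesis using assms by (simp add: L2_on_def)
qed

text \<open>Young's inequality. A small \<theta> keeps the weight of the main term \<open>x\<close>
  near 1 and puts the large weight on the perturbation \<open>y\<close>.\<close>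

lemma square_add_le:
  fixes x y :: real assumes "\<theta> > 0"
  shows "(x + y)\<^sup>2 \<le> (1 + \<theta>) * x\<^sup>2 + (1 + 1/\<theta>) * y\<^sup>2"
proof -
  have "0 \<le> (\<theta> * x - y)\<^sup>2 / \<theta>" using assms by simp
  also have "\<dots> = \<theta> * x\<^sup>2 - 2 * x * y + y\<^sup>2 / \<theta>"
    using assms by (simp add: power2_eq_square field_simps)
  finally show ?thesis by (simp add: power2_eq_square algebra_simps)
qed

lemma L2_on_add: 
  assumes f: "f \<in> L2_on M" and g: "g \<in> L2_on M" shows "(\<lambda>x. f x + g x) \<in> L2_on M"
proof (rule L2_on_bound)
  show "integrable M (\<lambda>x. 2 * (f x)\<^sup>2 + 2 * (g x)\<^sup>2)"
    using L2_onD(2)[OF f] L2_onD(2)[OF g] by simp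
  show "AE x in M. (f x + g x)\<^sup>2 \<le> 2 * (f x)\<^sup>2 + 2 * (g x)\<^sup>2"
    using square_add_le[of 1] by (intro AE_I2) simp
qed (use L2_onD(1)[OF f] L2_onD(1)[OF g] in simp)

lemma L2_on_cmult: "f \<in> L2_on M \<Longrightarrow> (\<lambda>x. c * f x) \<in> L2_on M"
  by (auto simp: L2_on_def power_mult_distrib)

lemma L2_on_diff:
  assumes "f \<in> L2_on M" "g \<in> L2_on M" shows "(\<lambda>x. f x - g x) \<in> L2_on M"
  using L2_on_add[OF assms(1) L2_on_cmult[OF assms(2), of "-1"]] by simp

lemma L2_on_indicator_mult:
  assumes "f \<in> L2_on M" "A \<in> sets M" shows "(\<lambda>x. indicator A x * f x) \<in> L2_on M"
  using L2_onD[OF assms(1)] assms(2)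
  by (intro L2_on_bound[where h="\<lambda>x. (f x)\<^sup>2"]) (auto split: split_indicator)

lemma L2_on_indicator:
  assumes "A \<in> sets M" "emeasure M A < \<infinity>" shows "(indicator A :: real \<Rightarrow> real) \<in> L2_on M"
proof (rule L2_on_bound)
  show "integrable M (indicator A :: real \<Rightarrow> real)" using assms by simp
  show "(indicator A :: real \<Rightarrow> real) \<in> borel_measurable M" using assms(1) by (rule borel_measurable_indicator)
qed (simp add: indicator_def)

lemma L2_on_mult_integrable:
  assumes f: "f \<in> L2_on M" and g: "g \<in> L2_on M" shows "integrable M (\<lambda>x. f x * g x)"
proof (rule Bochner_Integration.integrable_bound)
  show "integrable M (\<lambda>x. (f x)\<^sup>2 + (g x)\<^sup>2)"
    using L2_onD(2)[OF f] L2_onD(2)[OF g] by simp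
  have "\<bar>f x * g x\<bar> \<le> (f x)\<^sup>2 + (g x)\<^sup>2" for x
  proof -
    have "2 * (\<bar>f x\<bar> * \<bar>g x\<bar>) \<le> (f x)\<^sup>2 + (g x)\<^sup>2"
      using sum_squares_bound[of "\<bar>f x\<bar>" "\<bar>g x\<bar>"] by (simp add: mult.assoc)
    moreover have "0 \<le> \<bar>f x\<bar> * \<bar>g x\<bar>" by simp
    ultimately show ?thesis unfolding abs_mult by linarith
  qed
  then show "AE x in M. norm (f x * g x) \<le> norm ((f x)\<^sup>2 + (g x)\<^sup>2)"
    by simp
qed (use L2_onD(1)[OF f] L2_onD(1)[OF g] in simp)

lemma L2_norm_add_le:
  assumes f: "f \<in> L2_on M" and g: "g \<in> L2_on M" and "\<theta> > 0"
  shows "(LINT x|M. (f x + g x)\<^sup>2) \<le> (1 + \<theta>) * sqnorm M f + (1 + 1/\<theta>) * sqnorm M g"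
proof -
  have "(LINT x|M. (f x + g x)\<^sup>2) \<le> (LINT x|M. (1 + \<theta>) * (f x)\<^sup>2 + (1 + 1/\<theta>) * (g x)\<^sup>2)"
    using L2_onD(2)[OF f] L2_onD(2)[OF g] L2_onD(2)[OF L2_on_add[OF f g]] square_add_le[OF \<open>\<theta> > 0\<close>]
    by (intro integral_mono) auto
  also have "\<dots> = (1 + \<theta>) * sqnorm M f + (1 + 1/\<theta>) * sqnorm M g"
    using L2_onD(2)[OF f] L2_onD(2)[OF g] by simp
  finally show ?thesis .
qed

lemma L2_on_set_integrable:
  assumes v: "v \<in> L2_on M" and A: "A \<in> sets M" "emeasure M A < \<infinity>"
  shows "set_integrable M A v"
  using L2_on_mult_integrable[OF L2_on_indicator[OF A] v] by (simp add: set_integrable_def)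

lemma L2_Cauchy_Schwarz_indicator:
  assumes v: "v \<in> L2_on M" and A: "A \<in> sets M" "emeasure M A < \<infinity>"
  shows "(LINT x:A|M. v x)\<^sup>2 \<le> measure M A * sqnorm M v"
proof -
  define P where "P = (LINT x:A|M. v x)"
  define N where "N = measure M A"
  have iA: "integrable M (indicator A :: _ \<Rightarrow> real)" using A by simp
  have iv: "integrable M (\<lambda>x. indicator A x * v x)"
    using L2_on_set_integrable[OF v A] by (simp add: set_integrable_def)
  have i2: "integrable M (\<lambda>x. (v x)\<^sup>2)" using L2_onD(2)[OF v] .
  \<comment> \<open>The integrand is the square of \<open>N\<close> times the component of
    \<open>v\<close> orthogonal to \<open>indicator A\<close>; multiplying by \<open>N\<close>
    instead of dividing leaves \<open>N = 0\<close> to a separate case.\<close>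
  have "0 \<le> (LINT x|M. (N * v x - P * indicator A x)\<^sup>2)" by simp
  also have "(\<lambda>x. (N * v x - P * indicator A x)\<^sup>2)
      = (\<lambda>x. N\<^sup>2 * (v x)\<^sup>2 - 2 * N * P * (indicator A x * v x) + P\<^sup>2 * indicator A x)"
    by (auto simp: fun_eq_iff power2_eq_square algebra_simps split: split_indicator)
  also have "(LINT x|M. N\<^sup>2 * (v x)\<^sup>2 - 2 * N * P * (indicator A x * v x) + P\<^sup>2 * indicator A x)
      = N\<^sup>2 * sqnorm M v - 2 * N * P * P + P\<^sup>2 * N"
    using i2 iv iA A by (simp add: P_def N_def set_lebesgue_integral_def)
  finally have *: "N * P\<^sup>2 \<le> N * (N * sqnorm M v)"
    by (simp add: power2_eq_square algebra_simps)
  show ?thesis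
  proof (cases "N = 0")
    case True
    then have "emeasure M A = 0" using A(2) by (auto simp: N_def measure_def enn2real_eq_0_iff)
    then have "A \<in> null_sets M" using A by auto
    then have "AE x in M. indicator A x * v x = 0"
      by (auto dest: AE_not_in elim!: eventually_mono)
    then have "P = 0" by (simp add: P_def set_lebesgue_integral_def integral_eq_zero_AE)
    then show ?thesis by (simp add: P_def)
  next
    case False
    then have "N > 0" by (simp add: N_def zero_less_measure_iff)
    with * show ?thesis unfolding P_def N_def by simp
  qed
qed

text \<open>Riesz-Fischer with an explicit rate: a fast subsequence converges almost everywhere, and
  Fatou's lemma turns this into convergence of the whole sequence.\<close>

lemma L2_complete:
  assumes z: "\<And>k. z k \<in> L2_on M"
    and cau: "\<And>k l. k \<le> l \<Longrightarrow> (LINT x|M. (z l x - z k x)\<^sup>2) \<le> e k"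
    and e: "e \<longlonglongrightarrow> 0"
  obtains zz where "zz \<in> L2_on M" "(\<lambda>k. LINT x|M. (z k x - zz x)\<^sup>2) \<longlonglongrightarrow> 0"
proof -
  have meas[measurable]: "z k \<in> borel_measurable M" for k using z L2_onD(1) by blast
  have "\<forall>k. \<exists>N. \<forall>n\<ge>N. e n < (1/4)^k"
    using order_tendstoD(2)[OF e] by (auto simp: eventually_sequentially)
  then obtain N where N: "\<And>k n. n \<ge> N k \<Longrightarrow> e n < (1/4)^k" by metis
  define r where "r k = (\<Sum>i\<le>k. Suc (N i))" for k
  have rN: "r k \<ge> N k" for k unfolding r_def by (cases k) auto
  have rmono: "r k \<le> r (Suc k)" for k by (simp add: r_def)
  have rk: "r k \<ge> k" for k by (induction k) (auto simp: r_def)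
  define D where "D k x = 2^k * (z (r (Suc k)) x - z (r k) x)\<^sup>2" for k x
  have D0: "D k x \<ge> 0" for k x by (simp add: D_def)
  have Dm[measurable]: "D k \<in> borel_measurable M" for k unfolding D_def by measurable
  have iD: "integrable M (D k)" for k
    unfolding D_def using L2_onD(2)[OF L2_on_diff[OF z z]] by simp
  have bD: "(LINT x|M. D k x) \<le> (1/2)^k" for k
  proof -
    have "(LINT x|M. D k x) \<le> 2^k * (1/4)^k"
      unfolding D_def using cau[OF rmono[of k]] N[OF rN[of k]] by simp
    also have "(2::real)^k * (1/4)^k = (1/2)^k"
      by (simp add: power_mult_distrib[symmetric])
    finally show ?thesis .
  qed
  have "(\<integral>\<^sup>+x. (\<Sum>k. ennreal (D k x)) \<partial>M) = (\<Sum>k. \<integral>\<^sup>+x. ennreal (D k x) \<partial>M)"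
    by (rule nn_integral_suminf) simp
  also have "\<dots> = (\<Sum>k. ennreal (LINT x|M. D k x))"
    using iD D0 by (simp add: nn_integral_eq_integral)
  also have "\<dots> \<le> (\<Sum>k. ennreal ((1/2)^k))"
    using bD by (intro suminf_le ennreal_leI) auto
  also have "\<dots> = ennreal (\<Sum>k. (1/2)^k)"
    by (rule suminf_ennreal2) (auto intro: summable_geometric)
  finally have "(\<integral>\<^sup>+x. (\<Sum>k. ennreal (D k x)) \<partial>M) \<noteq> \<infinity>"
    by (auto simp: top_unique)
  from nn_integral_noteq_infinite[OF _ this]
  have "AE x in M. (\<Sum>k. ennreal (D k x)) \<noteq> \<infinity>" by measurable
  then have conv: "AE x in M. (\<lambda>k. z (r k) x) \<longlonglongrightarrow> lim (\<lambda>k. z (r k) x)"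
  proof eventually_elim
    fix x assume "(\<Sum>k. ennreal (D k x)) \<noteq> \<infinity>"
    then have "summable (\<lambda>k. D k x)" using D0 by (intro summable_suminf_not_top) auto
    then have "summable (\<lambda>k. (1/2)^k + D k x)"
      by (intro summable_add summable_geometric) auto
    then have "summable (\<lambda>k. z (r (Suc k)) x - z (r k) x)"
    proof (rule summable_comparison_test'[where N=0])
      fix k :: nat
      define d where "d = \<bar>z (r (Suc k)) x - z (r k) x\<bar>"
      have "d \<le> (1/2)^k + 2^k * d\<^sup>2"
      proof -
        have "0 \<le> 2^k * (d - (1/2)^k)\<^sup>2" by simp
        also have "\<dots> = 2^k * d\<^sup>2 - 2 * d * (2^k * (1/2)^k) + (1/2)^k * (2^k * (1/2)^k)"
          by (simp add: power2_eq_square algebra_simps)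
        also have "(2::real)^k * (1/2)^k = 1" by (simp add: power_mult_distrib[symmetric])
        finally have "2 * d \<le> (1/2)^k + 2^k * d\<^sup>2" by simp
        moreover have "0 \<le> d" by (simp add: d_def)
        ultimately show ?thesis by linarith
      qed
      then show "norm (z (r (Suc k)) x - z (r k) x) \<le> (1/2)^k + D k x"
        by (simp add: d_def D_def)
    qed
    then have "convergent (\<lambda>n. \<Sum>k<n. z (r (Suc k)) x - z (r k) x)"
      using summable_LIMSEQ convergentI by blast
    then have "convergent (\<lambda>n. (z (r n) x - z (r 0) x) + z (r 0) x)"
      unfolding sum_lessThan_telescope[of "\<lambda>k. z (r k) x"]
      by (intro convergent_add convergent_const) 
    then show "(\<lambda>k. z (r k) x) \<longlonglongrightarrow> lim (\<lambda>k. z (r k) x)"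
      by (simp add: convergent_LIMSEQ_iff)
  qed
  define zz where "zz x = lim (\<lambda>k. z (r k) x)" for x
  have zzm[measurable]: "zz \<in> borel_measurable M"
    unfolding zz_def by measurable
  \<comment> \<open>Fatou is applied along \<open>r\<close> with \<open>k\<close> fixed, so the rate
    \<open>e k\<close> survives in the limit.\<close>
  have F: "(\<integral>\<^sup>+x. ennreal ((z k x - zz x)\<^sup>2) \<partial>M) \<le> ennreal (e k)" for k
  proof -
    have "(\<integral>\<^sup>+x. ennreal ((z k x - zz x)\<^sup>2) \<partial>M) = (\<integral>\<^sup>+x. liminf (\<lambda>l. ennreal ((z k x - z (r l) x)\<^sup>2)) \<partial>M)"
    proof (rule nn_integral_cong_AE, use conv in eventually_elim)
      fix x assume "(\<lambda>k. z (r k) x) \<longlonglongrightarrow> lim (\<lambda>k. z (r k) x)"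
      then have "(\<lambda>l. ennreal ((z k x - z (r l) x)\<^sup>2)) \<longlonglongrightarrow> ennreal ((z k x - zz x)\<^sup>2)"
        unfolding zz_def by (intro tendsto_intros)
      then show "ennreal ((z k x - zz x)\<^sup>2) = liminf (\<lambda>l. ennreal ((z k x - z (r l) x)\<^sup>2))"
        by (intro lim_imp_Liminf[symmetric]) auto
    qed
    also have "\<dots> \<le> liminf (\<lambda>l. \<integral>\<^sup>+x. ennreal ((z k x - z (r l) x)\<^sup>2) \<partial>M)"
      by (rule nn_integral_liminf) measurable
    also have "\<dots> \<le> ennreal (e k)"
    proof (rule Liminf_le)
      show "\<forall>\<^sub>F l in sequentially. (\<integral>\<^sup>+x. ennreal ((z k x - z (r l) x)\<^sup>2) \<partial>M) \<le> ennreal (e k)"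
      proof (rule eventually_sequentiallyI)
        fix l assume "k \<le> l"
        then have "k \<le> r l" using rk[of l] by simp
        have "(\<integral>\<^sup>+x. ennreal ((z k x - z (r l) x)\<^sup>2) \<partial>M) = ennreal (LINT x|M. (z k x - z (r l) x)\<^sup>2)"
          using L2_onD(2)[OF L2_on_diff[OF z z]] by (intro nn_integral_eq_integral) auto
        also have "\<dots> \<le> ennreal (e k)"
          using cau[OF \<open>k \<le> r l\<close>] by (intro ennreal_leI) (simp add: power2_commute)
        finally show "(\<integral>\<^sup>+x. ennreal ((z k x - z (r l) x)\<^sup>2) \<partial>M) \<le> ennreal (e k)" .
      qed
    qed simp
    finally show ?thesis .
  qed
  have e0: "e k \<ge> 0" for k
    using cau[of k k] by simp
  have d2: "(\<lambda>x. z k x - zz x) \<in> L2_on M" for k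
    unfolding L2_on_def mem_Collect_eq
  proof (intro conjI)
    show "integrable M (\<lambda>x. (z k x - zz x)\<^sup>2)"
      using F[of k] by (intro integrableI_nonneg) (auto simp: less_top[symmetric] top_unique)
  qed measurable
  show thesis
  proof (rule that)
    have "(\<lambda>x. z 0 x - (z 0 x - zz x)) \<in> L2_on M" by (rule L2_on_diff[OF z d2])
    then show "zz \<in> L2_on M" by simp
    have "(LINT x|M. (z k x - zz x)\<^sup>2) \<le> e k" for k
      using F[of k] L2_onD(2)[OF d2[of k]] e0[of k] by (simp add: nn_integral_eq_integral)
    then show "(\<lambda>k. LINT x|M. (z k x - zz x)\<^sup>2) \<longlonglongrightarrow> 0"
      by (intro tendsto_sandwich[OF _ _ tendsto_const e]) auto
  qed
qed

text \<open>Replaces weak compactness: near-minimizers of the norm over nested convex sets form a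
  Cauchy sequence by the parallelogram identity.\<close>

lemma L2_nested_convex_limit:
  fixes Z :: "nat \<Rightarrow> (real \<Rightarrow> real) set"
  assumes sub: "\<And>j. Z j \<subseteq> L2_on M" and dec: "\<And>j k. j \<le> k \<Longrightarrow> Z k \<subseteq> Z j"
    and mid: "\<And>j f g. f \<in> Z j \<Longrightarrow> g \<in> Z j \<Longrightarrow> (\<lambda>x. (f x + g x) / 2) \<in> Z j"
    and ne: "\<And>j. \<exists>f\<in>Z j. sqnorm M f \<le> K"
  obtains z zz where "\<And>j. z j \<in> Z j" "zz \<in> L2_on M" "(\<lambda>j. LINT x|M. (z j x - zz x)\<^sup>2) \<longlonglongrightarrow> 0"
    "sqnorm M zz \<le> K"
proof -
  define \<Phi> where "\<Phi> f = sqnorm M f" for f :: "real \<Rightarrow> real"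
  define I where "I j = Inf (\<Phi> ` Z j)" for j
  have \<Phi>0: "\<Phi> f \<ge> 0" for f by (simp add: \<Phi>_def)
  have bb: "bdd_below (\<Phi> ` Z j)" for j using \<Phi>0 by (intro bdd_belowI2)
  have nem: "\<Phi> ` Z j \<noteq> {}" for j using ne by blast
  have Ile: "I j \<le> \<Phi> f" if "f \<in> Z j" for f j
    unfolding I_def using bb that by (intro cINF_lower)
  have Imono: "incseq I"
    unfolding I_def incseq_def    by (intro allI impI cInf_superset_mono nem bb image_mono dec)
  have IK: "I j \<le> K" for j using ne[of j] Ile[of _ j] order_trans unfolding \<Phi>_def by blast
  obtain L where L: "I \<longlonglongrightarrow> L" using incseq_convergent[OF Imono] IK by blast
  have IL: "I j \<le> L" for j by (rule incseq_le[OF Imono L])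
  have "\<exists>f\<in>Z j. \<Phi> f < I j + 1 / Suc j" for j
    using cInf_lessD[OF nem, of j "I j + 1 / Suc j"] by (auto simp: I_def)
  then obtain z where z: "\<And>j. z j \<in> Z j" "\<And>j. \<Phi> (z j) < I j + 1 / Suc j" by metis
  have zL: "z j \<in> L2_on M" for j using z(1) sub by blast
  \<comment> \<open>The midpoint of \<open>z k\<close> and \<open>z l\<close> lies in
    \<open>Z k\<close>, so its squared norm is at least \<open>I k\<close>. The parallelogram
    identity then leaves twice the gap \<open>L - I k\<close> plus the slack of the two
    near-minimizers.\<close>
  define e where "e j = 2 * (L - I j) + 4 / Suc j" for j
  have cau: "(LINT x|M. (z l x - z k x)\<^sup>2) \<le> e k" if "k \<le> l" for k l
  proof -
    have "(\<lambda>x. (z k x + z l x) / 2) \<in> Z k" using z(1) dec[OF that] by (intro mid) auto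
    from Ile[OF this] have "I k \<le> (LINT x|M. ((z k x + z l x)/2)\<^sup>2)" by (simp add: \<Phi>_def)
    also have "\<dots> = (LINT x|M. (1/2) * (z k x)\<^sup>2 + (1/2) * (z l x)\<^sup>2 - (1/4) * (z l x - z k x)\<^sup>2)"
      by (intro Bochner_Integration.integral_cong) (auto simp: power2_eq_square field_simps)
    also have "\<dots> = 1/2 * \<Phi> (z k) + 1/2 * \<Phi> (z l) - 1/4 * (LINT x|M. (z l x - z k x)\<^sup>2)"
      using L2_onD(2)[OF zL] L2_onD(2)[OF L2_on_diff[OF zL zL]] by (simp add: \<Phi>_def)
    finally have "(LINT x|M. (z l x - z k x)\<^sup>2) \<le> 2 * \<Phi> (z k) + 2 * \<Phi> (z l) - 4 * I k" by simp
    also have "\<dots> \<le> 2 * (I k + 1 / Suc k) + 2 * (L + 1 / Suc k) - 4 * I k"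
    proof -
      have "1 / real (Suc l) \<le> 1 / real (Suc k)" using that by (simp add: frac_le)
      then show ?thesis using z(2)[of k] z(2)[of l] IL[of l] by simp
    qed
    finally show ?thesis by (simp add: e_def)
  qed
  have "e \<longlonglongrightarrow> 2 * (L - L) + 0"
    unfolding e_def by (intro tendsto_intros L LIMSEQ_Suc[OF lim_const_over_n])
  then have e: "e \<longlonglongrightarrow> 0" by simp
  from L2_complete[OF zL cau e] obtain zz where zz: "zz \<in> L2_on M"
    "(\<lambda>k. LINT x|M. (z k x - zz x)\<^sup>2) \<longlonglongrightarrow> 0" by blast
  \<comment> \<open>The factor \<open>1 + \<theta>\<close> is the price for avoiding square roots;
    it is removed below with \<open>\<theta> = \<epsilon> / (K + 1)\<close>.\<close>
  have bound: "\<Phi> zz \<le> (1 + \<theta>) * K" if "\<theta> > 0" for \<theta>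
  proof (rule LIMSEQ_le_const)
    have "(\<lambda>j. (1 + \<theta>) * (K + 1 / Suc j) + (1 + 1/\<theta>) * (LINT x|M. (z j x - zz x)\<^sup>2)) \<longlonglongrightarrow>
      (1 + \<theta>) * (K + 0) + (1 + 1/\<theta>) * 0"
      by (intro tendsto_intros zz LIMSEQ_Suc[OF lim_const_over_n])
    then show "(\<lambda>j. (1 + \<theta>) * (K + 1 / Suc j) + (1 + 1/\<theta>) * (LINT x|M. (z j x - zz x)\<^sup>2))
      \<longlonglongrightarrow> (1 + \<theta>) * K"
      by simp
    have "\<Phi> zz \<le> (1 + \<theta>) * (K + 1 / Suc j) + (1 + 1/\<theta>) * (LINT x|M. (z j x - zz x)\<^sup>2)" for j
    proof -
      have "\<Phi> zz \<le> (1 + \<theta>) * \<Phi> (z j) + (1 + 1/\<theta>) * (LINT x|M. (zz x - z j x)\<^sup>2)"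
        using L2_norm_add_le[OF zL[of j] L2_on_diff[OF zz(1) zL[of j]] that] by (simp add: \<Phi>_def)
      moreover have "(1 + \<theta>) * \<Phi> (z j) \<le> (1 + \<theta>) * (K + 1 / Suc j)"
        using that z(2)[of j] IK[of j] by (intro mult_left_mono) auto
      ultimately show ?thesis by (simp add: power2_commute)
    qed
    then show "\<exists>N. \<forall>j\<ge>N. \<Phi> zz \<le> (1 + \<theta>) * (K + 1 / Suc j) + (1 + 1/\<theta>) * (LINT x|M. (z j x - zz x)\<^sup>2)"
      by blast
  qed
  have "\<Phi> zz \<le> K + \<epsilon>" if "\<epsilon> > 0" for \<epsilon>
  proof -
    have K0: "K \<ge> 0" using ne[of 0] \<Phi>0 order_trans unfolding \<Phi>_def by blast
    have "\<Phi> zz \<le> (1 + \<epsilon> / (K + 1)) * K" using K0 that by (intro bound) simp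
    also have "\<dots> \<le> K + \<epsilon>" using K0 that by (simp add: field_simps)
    finally show ?thesis .
  qed
  then have "\<Phi> zz \<le> K" by (rule field_le_epsilon)
  then show thesis using that[OF z(1) zz] by (simp add: \<Phi>_def)
qed


section \<open>Measures on an open interval\<close>

lemma sets_einterval_eq:
  "sets (restrict_space borel (einterval a b)) = {A \<in> sets borel. A \<subseteq> einterval a b}"
  by (simp add: sets_restrict_space_iff[symmetric] set_eq_iff) (auto simp: sets_restrict_space)

text \<open>Used in two ways: for tails near an endpoint, and for punctured neighbourhoods shrinking
  to a point, which gives continuity of primitives.\<close>

lemma integral_decreasing_sets_tendsto_0:
  fixes h :: "'a \<Rightarrow> real"
  assumes h: "integrable M h" and A: "\<And>k. A k \<in> sets M" "decseq A" "(\<Inter>k. A k) = {}"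
  shows "(\<lambda>k. LINT x|M. indicator (A k) x * h x) \<longlonglongrightarrow> 0"
proof -
  have "(\<lambda>k. LINT x|M. indicator (A k) x * h x) \<longlonglongrightarrow> (LINT x|M. 0)"
  proof (rule integral_dominated_convergence[where w="\<lambda>x. \<bar>h x\<bar>"])
    show "AE x in M. (\<lambda>k. indicator (A k) x * h x) \<longlonglongrightarrow> 0"
    proof (rule AE_I2)
      fix x
      obtain k where k: "x \<notin> A k" using A(3) by blast
      have "\<forall>j\<ge>k. indicator (A j) x * h x = 0"
        using k A(2) by (auto simp: decseq_def indicator_def)
      then show "(\<lambda>k. indicator (A k) x * h x) \<longlonglongrightarrow> 0"
        by (intro tendsto_eventually) (auto simp: eventually_sequentially)
    qed
  qed (use h A in \<open>auto simp: indicator_def\<close>)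
  then show ?thesis by simp
qed

text \<open>Shared by the energy measure and the reference measure \<open>m\<close>; the latter may
  have atoms, so diffuseness is added only in an extension.\<close>

locale einterval_measure =
  fixes a b :: ereal and \<nu> :: "real measure"
  assumes ab: "a < b"
    and sets_nu [measurable_cong]: "sets \<nu> = sets (restrict_space borel (einterval a b))"
    and finite_Icc: "\<And>c d. c \<in> einterval a b \<Longrightarrow> d \<in> einterval a b \<Longrightarrow> emeasure \<nu> {c..d} < \<infinity>"
begin

abbreviation "I \<equiv> einterval a b"

lemma space_nu [simp]: "space \<nu> = I"
  using sets_eq_imp_space_eq[OF sets_nu] by (simp add: space_restrict_space)

lemma sets_iff: "A \<in> sets \<nu> \<longleftrightarrow> A \<in> sets borel \<and> A \<subseteq> I"
  unfolding sets_nu sets_einterval_eq by simp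

lemma Icc_sub: "c \<in> I \<Longrightarrow> d \<in> I \<Longrightarrow> {c..d} \<subseteq> I"
  by (rule Icc_subset_einterval)

lemma mem_between: "c \<in> I \<Longrightarrow> d \<in> I \<Longrightarrow> c \<le> x \<Longrightarrow> x \<le> d \<Longrightarrow> x \<in> I"
  using Icc_sub[of c d] by auto

lemma Icc_sets [simp]: "c \<in> I \<Longrightarrow> d \<in> I \<Longrightarrow> {c..d} \<in> sets \<nu>"
  using Icc_sub sets_iff by simp

lemma ex_greater: assumes "c \<in> I" obtains d where "d \<in> I" "c < d"
proof -
  obtain r where "ereal c < ereal r" "ereal r < b"
    using ereal_dense2[of "ereal c" b] assms by (auto simp: einterval_def)
  then show thesis using assms by (intro that[of r]) (auto simp: einterval_def intro: less_trans)
qed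

lemma ex_less: assumes "c \<in> I" obtains d where "d \<in> I" "d < c"
proof -
  obtain r where "ereal r < ereal c" "a < ereal r"
    using ereal_dense2[of a "ereal c"] assms by (auto simp: einterval_def)
  then show thesis using assms by (intro that[of r]) (auto simp: einterval_def intro: less_trans[of _ "ereal c"])
qed

text \<open>The strict eventual inequalities put every point of \<open>I\<close> into the interior
  of the approximating intervals from some index on, which is what makes the open tails shrink to
  the empty set.\<close>

definition exhausts :: "(nat \<Rightarrow> real) \<Rightarrow> (nat \<Rightarrow> real) \<Rightarrow> bool" where
  "exhausts l u \<longleftrightarrow> (\<forall>i. l i \<in> I \<and> u i \<in> I \<and> l i < u i) \<and> decseq l \<and> incseq u \<and> I = (\<Union>i. {l i..u i}) \<and>
    (\<forall>c\<in>I. (\<forall>\<^sub>F i in sequentially. l i < c) \<and> (\<forall>\<^sub>F i in sequentially. c < u i))"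

lemma exhaustsD:
  assumes "exhausts l u"
  shows "l i \<in> I" "u i \<in> I" "l i < u i" "decseq l" "incseq u" "I = (\<Union>i. {l i..u i})"
    "c \<in> I \<Longrightarrow> \<forall>\<^sub>F i in sequentially. l i < c" "c \<in> I \<Longrightarrow> \<forall>\<^sub>F i in sequentially. c < u i"
  using assms unfolding exhausts_def by auto

lemma ex_exhausts: "\<exists>l u. exhausts l u"
proof (rule einterval_Icc_approximation[OF ab])
  fix u l :: "nat \<Rightarrow> real"
  assume lu: "I = (\<Union>i. {l i..u i})" "incseq u" "decseq l"
      "\<And>i. l i < u i" "\<And>i. a < ereal (l i)" "\<And>i. ereal (u i) < b"
      "(\<lambda>x. ereal (l x)) \<longlonglongrightarrow> a" "(\<lambda>x. ereal (u x)) \<longlonglongrightarrow> b"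
  have "l i \<in> I \<and> u i \<in> I \<and> l i < u i" for i
    unfolding einterval_iff using lu(4-6)[of i] less_trans[of a "ereal (l i)" "ereal (u i)"]
      less_trans[of "ereal (l i)" "ereal (u i)" b] by simp
  moreover have "\<forall>\<^sub>F i in sequentially. l i < c" if "c \<in> I" for c
    using order_tendstoD(2)[OF lu(7), of "ereal c"] that by (simp add: einterval_def)
  moreover have "\<forall>\<^sub>F i in sequentially. c < u i" if "c \<in> I" for c
    using order_tendstoD(1)[OF lu(8), of "ereal c"] that by (simp add: einterval_def)
  ultimately have "exhausts l u" unfolding exhausts_def using lu(1-3) by blast
  then show ?thesis by blast
qed

lemma sigma_finite: "sigma_finite_measure \<nu>"
proof -
  obtain l u :: "nat \<Rightarrow> real"
    where "exhausts l u" using ex_exhausts by blast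
  note lu = exhaustsD[OF this]
  show ?thesis
  proof
    show "\<exists>A. countable A \<and> A \<subseteq> sets \<nu> \<and> \<Union> A = space \<nu> \<and> (\<forall>a\<in>A. emeasure \<nu> a \<noteq> \<infinity>)"
      using lu finite_Icc
      by (intro exI[of _ "range (\<lambda>i. {l i..u i})"]) (auto simp: less_top[symmetric])
  qed
qed

lemma AE_from_Icc:
  assumes "\<And>c d. c \<in> I \<Longrightarrow> d \<in> I \<Longrightarrow> c < d \<Longrightarrow> AE x in \<nu>. x \<in> {c..d} \<longrightarrow> P x"
  shows "AE x in \<nu>. P x"
proof -
  obtain l u :: "nat \<Rightarrow> real"
    where "exhausts l u" using ex_exhausts by blast
  note lu = exhaustsD[OF this]
  have "AE x in \<nu>. \<forall>i. x \<in> {l i..u i} \<longrightarrow> P x"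
    unfolding AE_all_countable using assms lu(1-3) by blast
  then show ?thesis
    using AE_space by eventually_elim (use lu(6) in auto)
qed

section \<open>Small tails and infinite mass near an endpoint\<close>

lemma right_tail_small:
  fixes h :: "real \<Rightarrow> real"
  assumes h: "integrable \<nu> h" and "\<epsilon> > 0" "c0 \<in> I"
  obtains c where "c \<in> I" "c0 \<le> c" "(LINT x|\<nu>. indicator (I \<inter> {c<..}) x * h x) < \<epsilon>"
proof -
  obtain l u :: "nat \<Rightarrow> real"
    where "exhausts l u" using ex_exhausts by blast
  note lu = exhaustsD[OF this]
  have "(\<lambda>k. LINT x|\<nu>. indicator (I \<inter> {u k<..}) x * h x) \<longlonglongrightarrow> 0"
  proof (rule integral_decreasing_sets_tendsto_0[OF h])
    show "decseq (\<lambda>k. I \<inter> {u k<..})" using lu(5) by (fastforce simp: incseq_def decseq_def)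
    show "(\<Inter>k. I \<inter> {u k<..}) = {}"
    proof safe
      fix x assume x: "x \<in> (\<Inter>k. I \<inter> {u k<..})"
      then have "x \<in> I" by auto
      then obtain k where "x < u k" using lu(8)[of x] by (auto simp: eventually_sequentially)
      moreover have "x \<in> {u k<..}" using x by auto
      ultimately show "x \<in> {}" by simp
    qed
  qed (simp add: sets_iff)
  from eventually_conj[OF order_tendstoD(2)[OF this \<open>\<epsilon> > 0\<close>] lu(8)[OF \<open>c0 \<in> I\<close>]]
  obtain k where "(LINT x|\<nu>. indicator (I \<inter> {u k<..}) x * h x) < \<epsilon>" "c0 < u k"
    by (auto simp: eventually_sequentially)
  then show thesis using that lu(2) by (metis less_imp_le)
qed

lemma left_tail_small:
  fixes h :: "real \<Rightarrow> real"
  assumes h: "integrable \<nu> h" and "\<epsilon> > 0" "c0 \<in> I"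
  obtains c where "c \<in> I" "c \<le> c0" "(LINT x|\<nu>. indicator (I \<inter> {..<c}) x * h x) < \<epsilon>"
proof -
  obtain l u :: "nat \<Rightarrow> real"
    where "exhausts l u" using ex_exhausts by blast
  note lu = exhaustsD[OF this]
  have "(\<lambda>k. LINT x|\<nu>. indicator (I \<inter> {..<l k}) x * h x) \<longlonglongrightarrow> 0"
  proof (rule integral_decreasing_sets_tendsto_0[OF h])
    show "decseq (\<lambda>k. I \<inter> {..<l k})" using lu(4) by (fastforce simp: decseq_def)
    show "(\<Inter>k. I \<inter> {..<l k}) = {}"
    proof safe
      fix x assume x: "x \<in> (\<Inter>k. I \<inter> {..<l k})"
      then have "x \<in> I" by auto
      then obtain k where "l k < x" using lu(7)[of x] by (auto simp: eventually_sequentially)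
      moreover have "x \<in> {..<l k}" using x by auto
      ultimately show "x \<in> {}" by simp
    qed
  qed (simp add: sets_iff)
  from eventually_conj[OF order_tendstoD(2)[OF this \<open>\<epsilon> > 0\<close>] lu(7)[OF \<open>c0 \<in> I\<close>]]
  obtain k where "(LINT x|\<nu>. indicator (I \<inter> {..<l k}) x * h x) < \<epsilon>" "l k < c0"
    by (auto simp: eventually_sequentially)
  then show thesis using that lu(1) by (metis less_imp_le)
qed

lemma right_emeasure_approx:
  assumes "c \<in> I" "emeasure \<nu> (I \<inter> {c..}) = \<infinity>"
  obtains d where "d \<in> I" "c < d" "measure \<nu> {c..d} > C"
proof -
  obtain l u :: "nat \<Rightarrow> real"
    where "exhausts l u" using ex_exhausts by blast
  note lu = exhaustsD[OF this]
  have un: "(\<Union>i. {c..u i}) = I \<inter> {c..}"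
  proof (intro set_eqI iffI)
    fix x assume "x \<in> I \<inter> {c..}"
    then show "x \<in> (\<Union>i. {c..u i})" using lu(8)[of x] by (fastforce simp: eventually_sequentially intro: less_imp_le)
  qed (use mem_between[OF assms(1) lu(2)] in auto)
  have "(\<lambda>i. emeasure \<nu> {c..u i}) \<longlonglongrightarrow> emeasure \<nu> (\<Union>i. {c..u i})"
  proof (rule Lim_emeasure_incseq)
    show "range (\<lambda>i. {c..u i}) \<subseteq> sets \<nu>" using Icc_sets[OF assms(1) lu(2)] by blast
    show "incseq (\<lambda>i. {c..u i})"
      unfolding incseq_def
    proof (intro allI impI)
      fix i j :: nat assume "i \<le> j"
      from incseqD[OF lu(5) this] show "{c..u i} \<subseteq> {c..u j}" by auto
    qed
  qed
  then have "(\<lambda>i. emeasure \<nu> {c..u i}) \<longlonglongrightarrow> \<infinity>" unfolding un assms(2) .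
  from order_tendstoD(1)[OF this, of "ennreal C"]
  have "\<forall>\<^sub>F i in sequentially. ennreal C < emeasure \<nu> {c..u i}" by simp
  from eventually_conj[OF this lu(8)[OF assms(1)]]
  obtain i where i: "ennreal C < emeasure \<nu> {c..u i}" "c < u i" by (auto simp: eventually_sequentially)
  have "emeasure \<nu> {c..u i} = ennreal (measure \<nu> {c..u i})"
    using finite_Icc[OF assms(1) lu(2)] by (intro emeasure_eq_ennreal_measure) (auto simp: less_top)
  then have "C < measure \<nu> {c..u i}" using i(1) by (metis ennreal_leI not_le)
  then show thesis using that lu(2) i(2) by blast
qed

lemma left_emeasure_approx:
  assumes "c \<in> I" "emeasure \<nu> (I \<inter> {..c}) = \<infinity>"
  obtains d where "d \<in> I" "d < c" "measure \<nu> {d..c} > C"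
proof -
  obtain l u :: "nat \<Rightarrow> real"
    where "exhausts l u" using ex_exhausts by blast
  note lu = exhaustsD[OF this]
  have un: "(\<Union>i. {l i..c}) = I \<inter> {..c}"
  proof (intro set_eqI iffI)
    fix x assume "x \<in> I \<inter> {..c}"
    then show "x \<in> (\<Union>i. {l i..c})" using lu(7)[of x] by (fastforce simp: eventually_sequentially intro: less_imp_le)
  qed (use mem_between[OF lu(1) assms(1)] in auto)
  have "(\<lambda>i. emeasure \<nu> {l i..c}) \<longlonglongrightarrow> emeasure \<nu> (\<Union>i. {l i..c})"
  proof (rule Lim_emeasure_incseq)
    show "range (\<lambda>i. {l i..c}) \<subseteq> sets \<nu>" using Icc_sets[OF lu(1) assms(1)] by blast
    show "incseq (\<lambda>i. {l i..c})"
      unfolding incseq_def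
    proof (intro allI impI)
      fix i j :: nat assume "i \<le> j"
      from decseqD[OF lu(4) this] show "{l i..c} \<subseteq> {l j..c}" by auto
    qed
  qed
  then have "(\<lambda>i. emeasure \<nu> {l i..c}) \<longlonglongrightarrow> \<infinity>" unfolding un assms(2) .
  from order_tendstoD(1)[OF this, of "ennreal C"]
  have "\<forall>\<^sub>F i in sequentially. ennreal C < emeasure \<nu> {l i..c}" by simp
  from eventually_conj[OF this lu(7)[OF assms(1)]]
  obtain i where i: "ennreal C < emeasure \<nu> {l i..c}" "l i < c" by (auto simp: eventually_sequentially)
  have "emeasure \<nu> {l i..c} = ennreal (measure \<nu> {l i..c})"
    using finite_Icc[OF lu(1) assms(1)] by (intro emeasure_eq_ennreal_measure) (auto simp: less_top)
  then have "C < measure \<nu> {l i..c}" using i(1) by (metis ennreal_leI not_le)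
  then show thesis using that lu(1) i(2) by blast
qed

end


section \<open>Primitives with respect to a diffuse measure\<close>

text \<open>This is \<open>is_scale_deriv\<close> with an arbitrary measure in place of the
  Stieltjes measure, so that it also applies to a density.\<close>

definition primitive_on :: "ereal \<Rightarrow> ereal \<Rightarrow> real measure \<Rightarrow> (real \<Rightarrow> real) \<Rightarrow> (real \<Rightarrow> real) \<Rightarrow> bool" where
  "primitive_on a b \<nu> u v \<longleftrightarrow>
     (\<forall>x\<in>einterval a b. \<forall>y\<in>einterval a b. x < y \<longrightarrow>
        set_integrable \<nu> {x..y} v \<and> u y - u x = (LINT t:{x..y}|\<nu>. v t))"

text \<open>Only the envelope is recorded, for all reals and without reference to a measure. This
  class is invariant under replacing \<open>\<phi> t\<close> by \<open>1 - \<phi> (-t)\<close>, as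
  the reflection argument for the left endpoint requires.\<close>

definition ramp :: "real \<Rightarrow> real \<Rightarrow> (real \<Rightarrow> real) \<Rightarrow> bool" where
  "ramp p q \<phi> \<longleftrightarrow> (\<forall>t\<le>p. \<phi> t = 0) \<and> (\<forall>t\<ge>q. \<phi> t = 1) \<and> (\<forall>t. 0 \<le> \<phi> t \<and> \<phi> t \<le> 1)"

lemma rampD:
  assumes "ramp p q \<phi>"
  shows "t \<le> p \<Longrightarrow> \<phi> t = 0" "q \<le> t \<Longrightarrow> \<phi> t = 1" "0 \<le> \<phi> t" "\<phi> t \<le> 1"
  using assms by (auto simp: ramp_def)

locale diffuse_interval_measure = einterval_measure +
  assumes atomless: "\<And>c. c \<in> einterval a b \<Longrightarrow> emeasure \<nu> {c} = 0"
    and positive_Icc: "\<And>c d. c \<in> einterval a b \<Longrightarrow> d \<in> einterval a b \<Longrightarrow> c < d \<Longrightarrow> 0 < emeasure \<nu> {c..d}"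
begin

abbreviation "prim \<equiv> primitive_on a b \<nu>"

lemma measure_Icc_pos: "c \<in> I \<Longrightarrow> d \<in> I \<Longrightarrow> c < d \<Longrightarrow> 0 < measure \<nu> {c..d}"
  using positive_Icc[of c d] finite_Icc[of c d]
  by (simp add: measure_def enn2real_positive_iff)

lemma AE_not_point: "c \<in> I \<Longrightarrow> AE x in \<nu>. x \<noteq> c"
  using AE_not_in[of "{c}" \<nu>] atomless[of c] by (auto simp: sets_iff null_setsI)

lemma L2_set_integrable: "v \<in> L2_on \<nu> \<Longrightarrow> x \<in> I \<Longrightarrow> y \<in> I \<Longrightarrow> set_integrable \<nu> {x..y} v"
  using finite_Icc by (intro L2_on_set_integrable) auto

abbreviation "integ x y v \<equiv> LINT t:{x..y}|\<nu>. v t"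

lemma set_integral_Icc_combine:
  fixes v :: "real \<Rightarrow> real"
  assumes v: "\<And>x y. x \<in> I \<Longrightarrow> y \<in> I \<Longrightarrow> set_integrable \<nu> {x..y} v"
    and xyz: "x \<in> I" "z \<in> I" "x \<le> y" "y \<le> z"
  shows "integ x z v = integ x y v + integ y z v"
proof -
  have y: "y \<in> I" using mem_between xyz by blast
  have "(LINT t:{x..y} \<union> {y..z}|\<nu>. v t) = integ x y v + integ y z v"
    using v xyz y AE_not_point[OF y]
    by (intro set_integral_Un_AE) (auto elim: eventually_mono)
  moreover have "{x..y} \<union> {y..z} = {x..z}" using xyz by auto
  ultimately show ?thesis by simp
qed

lemma set_integral_point:
  fixes v :: "real \<Rightarrow> real"
  assumes "x \<in> I" shows "integ x x v = 0"
  unfolding set_lebesgue_integral_def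
proof (rule integral_eq_zero_AE)
  show "AE t in \<nu>. indicator {x..x} t *\<^sub>R v t = 0"
    using AE_not_point[OF assms] by eventually_elim (auto simp: indicator_def)
qed

lemma set_integrable_point:
  fixes v :: "real \<Rightarrow> real"
  assumes "x \<in> I" shows "set_integrable \<nu> {x..x} v"
proof -
  have "integrable \<nu> (\<lambda>t. indicator {x} t *\<^sub>R v x)"
    using atomless[OF assms] assms by (auto simp: sets_iff)
  moreover have "(\<lambda>t. indicator {x} t *\<^sub>R v x) = (\<lambda>t. indicator {x..x} t *\<^sub>R v t)" 
    by (auto simp: fun_eq_iff indicator_def)
  ultimately show ?thesis unfolding set_integrable_def by metis
qed

lemma primD_integrable:
  assumes "prim u v" "x \<in> I" "y \<in> I" shows "set_integrable \<nu> {x..y} v"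
proof -
  consider "x < y" | "x = y" | "x > y" by linarith
  then show ?thesis
    by cases (use assms set_integrable_point in \<open>auto simp: primitive_on_def set_integrable_def\<close>)
qed

lemma primD:
  assumes "prim u v" "x \<in> I" "y \<in> I" "x \<le> y"
  shows "u y - u x = integ x y v"
  using assms set_integral_point[of x v] by (cases "x = y") (auto simp: primitive_on_def)

lemma primI_base:
  assumes v: "\<And>x y. x \<in> I \<Longrightarrow> y \<in> I \<Longrightarrow> set_integrable \<nu> {x..y} v" and p: "p \<in> I"
    and u1: "\<And>t. t \<in> I \<Longrightarrow> p \<le> t \<Longrightarrow> u t = c + integ p t v"
    and u2: "\<And>t. t \<in> I \<Longrightarrow> t < p \<Longrightarrow> u t = c - integ t p v"
  shows "prim u v"
  unfolding primitive_on_def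
proof (intro ballI impI conjI)
  fix x y assume xy: "x \<in> I" "y \<in> I" "x < y"
  show "set_integrable \<nu> {x..y} v" using v xy by blast
  consider "p \<le> x" | "x < p" "p \<le> y" | "y < p" by linarith
  then show "u y - u x = integ x y v"
  proof cases
    case 1 then show ?thesis using xy set_integral_Icc_combine[OF v p xy(2), of x] by (simp add: u1)
  next
    case 2 then show ?thesis using xy set_integral_Icc_combine[OF v xy(1,2), of p] by (simp add: u1 u2)
  next
    case 3 then show ?thesis using xy set_integral_Icc_combine[OF v xy(1) p, of y] by (simp add: u2)
  qed
qed

lemma ex_prim:
  assumes v: "\<And>x y. x \<in> I \<Longrightarrow> y \<in> I \<Longrightarrow> set_integrable \<nu> {x..y} v" and p: "p \<in> I"
  obtains u where "prim u v" "u p = c"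
proof -
  let ?u = "\<lambda>t. if p \<le> t then c + integ p t v else c - integ t p v"
  have "prim ?u v" by (rule primI_base[OF v p]) auto
  moreover have "?u p = c" using set_integral_point[OF p, of v] by simp
  ultimately show thesis by (rule that)
qed

text \<open>Integrability over compact intervals makes each truncation measurable, and at every
  point the truncations eventually equal \<open>v\<close>.\<close>

lemma prim_measurable:
  assumes "prim u v" shows "v \<in> borel_measurable \<nu>"
proof -
  obtain l r :: "nat \<Rightarrow> real" where "exhausts l r" using ex_exhausts by blast
  note lr = exhaustsD[OF this]
  show ?thesis
  proof (rule borel_measurable_LIMSEQ_real)
    show "(\<lambda>t. indicator {l i..r i} t * v t) \<in> borel_measurable \<nu>" for i
      using primD_integrable[OF assms lr(1,2), of i i] by (auto simp: set_integrable_def)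
    fix x assume "x \<in> space \<nu>"
    then have "x \<in> I" by simp
    from lr(7,8)[OF this] have "\<forall>\<^sub>F i in sequentially. indicator {l i..r i} x * v x = v x"
      by eventually_elim simp
    then show "(\<lambda>i. indicator {l i..r i} x * v x) \<longlonglongrightarrow> v x"
      by (rule tendsto_eventually)
  qed
qed

text \<open>Absolute continuity of the integral at a point without mass.\<close>

lemma prim_continuous:
  assumes "prim u v" shows "continuous_on I u"
proof -
  have "isCont u x" if x: "x \<in> I" for x
  proof -
    obtain c d where cd: "c \<in> I" "c < x" "d \<in> I" "x < d" using ex_less[OF x] ex_greater[OF x] by metis
    define h where "h t = indicator {c..d} t * \<bar>v t\<bar>" for t
    have h: "integrable \<nu> h"
    proof -
      have "integrable \<nu> (\<lambda>t. \<bar>indicator {c..d} t *\<^sub>R v t\<bar>)"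
        using primD_integrable[OF assms cd(1,3)] unfolding set_integrable_def by (rule integrable_abs)
      then show ?thesis by (simp add: h_def[abs_def] abs_mult)
    qed
    \<comment> \<open>Removing \<open>x\<close>, which is a null set, makes the neighbourhoods
      decrease to the empty set.\<close>
    define A where "A k = {max c (x - 1 / Suc k)..min d (x + 1 / Suc k)} - {x}" for k :: nat
    have Am: "A k \<in> sets \<nu>" for k
      unfolding A_def using cd mem_between[OF cd(1,3)] by (auto simp: sets_iff)
    have "(\<lambda>k. LINT t|\<nu>. indicator (A k) t * h t) \<longlonglongrightarrow> 0"
    proof (rule integral_decreasing_sets_tendsto_0[OF h Am])
      show "decseq A"
        unfolding decseq_def A_def
      proof (intro allI impI Diff_mono order_refl)
        fix m n :: nat assume "m \<le> n"
        then have "1 / real (Suc n) \<le> 1 / real (Suc m)" by (simp add: frac_le)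
        then show "{max c (x - 1 / Suc n)..min d (x + 1 / Suc n)} \<subseteq> {max c (x - 1 / Suc m)..min d (x + 1 / Suc m)}"
          by auto
      qed
      show "\<Inter> (range A) = {}"
      proof (rule ccontr)
        assume "\<Inter> (range A) \<noteq> {}"
        then obtain t where t: "\<And>k. t \<in> A k" by auto
        have "t \<noteq> x" using t[of 0] by (simp add: A_def)
        then obtain k where "1 / real (Suc k) < \<bar>t - x\<bar>" using nat_approx_posE[of "\<bar>t - x\<bar>"] by auto
        with t[of k] show False by (auto simp: A_def)
      qed
    qed
    show ?thesis
      unfolding isCont_def tendsto_iff dist_real_def
    proof (intro allI impI)
      fix \<epsilon> :: real assume "\<epsilon> > 0"
      from order_tendstoD(2)[OF \<open>(\<lambda>k. LINT t|\<nu>. indicator (A k) t * h t) \<longlonglongrightarrow> 0\<close> this]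
      obtain k where k: "(LINT t|\<nu>. indicator (A k) t * h t) < \<epsilon>" by (auto simp: eventually_sequentially)
      define L where "L = max c (x - 1 / Suc k)"
      define R where "R = min d (x + 1 / Suc k)"
      have LR: "L < x" "x < R" "c \<le> L" "R \<le> d" using cd by (auto simp: L_def R_def)
      have bnd: "\<bar>u y - u z\<bar> < \<epsilon>" if yz: "z \<le> y" "L \<le> z" "y \<le> R" for y z
      proof -
        have zI: "z \<in> I" "y \<in> I" using mem_between[OF cd(1,3)] LR yz by auto
        have "\<bar>u y - u z\<bar> = \<bar>LINT t|\<nu>. indicator {z..y} t * v t\<bar>"
          using primD[OF assms zI yz(1)] by (simp add: set_lebesgue_integral_def)
        also have "\<dots> \<le> (LINT t|\<nu>. \<bar>indicator {z..y} t * v t\<bar>)"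
          by (rule integral_abs_bound)
        also have "\<dots> \<le> (LINT t|\<nu>. indicator (A k) t * h t)"
        proof (rule integral_mono_AE)
          show "integrable \<nu> (\<lambda>t. \<bar>indicator {z..y} t * v t\<bar>)"
            using primD_integrable[OF assms zI] by (auto simp: set_integrable_def)
          show "integrable \<nu> (\<lambda>t. indicator (A k) t * h t)"
            using integrable_mult_indicator[OF Am h] by simp
          show "AE t in \<nu>. \<bar>indicator {z..y} t * v t\<bar> \<le> indicator (A k) t * h t"
            using AE_not_point[OF x] by eventually_elim
              (use yz LR in \<open>auto simp: indicator_def A_def h_def L_def R_def\<close>)
        qed
        finally show ?thesis using k by simp
      qed
      have "\<forall>\<^sub>F y in at x. y \<in> {L<..<R}"
        using LR by (intro eventually_at_in_open') auto
      then show "\<forall>\<^sub>F y in at x. \<bar>u y - u x\<bar> < \<epsilon>"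
      proof eventually_elim
        fix y assume y: "y \<in> {L<..<R}"
        show "\<bar>u y - u x\<bar> < \<epsilon>"
          using bnd[of x y] bnd[of y x] y LR by (cases "x \<le> y") (auto simp: abs_minus_commute)
      qed
    qed
  qed
  then show ?thesis by (intro continuous_at_imp_continuous_on) auto
qed

text \<open>The difference of two derivatives has integral 0 over all compact intervals; these
  generate the Borel sets and are stable under intersection, so its integral over every measurable
  set is 0.\<close>

lemma prim_deriv_unique:
  assumes u: "prim u v" and w: "prim w v'" and eq: "\<And>x. x \<in> I \<Longrightarrow> u x = w x"
  shows "AE t in \<nu>. v t = v' t"
proof (rule AE_from_Icc)
  fix c d assume cd: "c \<in> I" "d \<in> I" "c < d"
  \<comment> \<open>Truncating to \<open>{c..d}\<close> makes the difference integrable on the whole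
    space.\<close>
  define g where "g t = indicator {c..d} t * (v t - v' t)" for t
  have gi: "integrable \<nu> g"
    using primD_integrable[OF u cd(1,2)] primD_integrable[OF w cd(1,2)]
    unfolding g_def set_integrable_def by (simp add: algebra_simps)
  have gIcc: "integ x y g = 0" for x y
  proof (cases "max c x \<le> min d y")
    case False
    then show ?thesis unfolding g_def set_lebesgue_integral_def
      by (intro integral_eq_zero_AE) (auto simp: indicator_def)
  next
    case True
    define X Y where "X = max c x" and "Y = min d y"
    have XY: "X \<in> I" "Y \<in> I" "X \<le> Y" using True mem_between[OF cd(1,2)] by (auto simp: X_def Y_def)
    have "integ x y g = (LINT t:{X..Y}|\<nu>. v t - v' t)"
      unfolding g_def X_def Y_def set_lebesgue_integral_def
      by (intro Bochner_Integration.integral_cong) (auto simp: indicator_def)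
    also have "\<dots> = integ X Y v - integ X Y v'"
      using primD_integrable[OF u XY(1,2)] primD_integrable[OF w XY(1,2)] by (rule set_integral_diff)
    also have "\<dots> = 0"
      using primD[OF u XY] primD[OF w XY] eq XY by simp
    finally show ?thesis .
  qed
  have "AE t in \<nu>. g t = 0"
  proof (rule sigma_finite_measure.density_zero[OF sigma_finite gi])
    fix A assume A: "A \<in> sets \<nu>"
    have Ab: "A \<in> sets borel" using A sets_iff by blast
    have im: "set_integrable \<nu> (B \<inter> I) g" if "B \<in> sets borel" for B
      unfolding set_integrable_def real_scaleR_def
      using integrable_mult_indicator[OF _ gi, of "B \<inter> I"] that by (simp add: sets_iff)
    let ?P = "\<lambda>B. (LINT t:(B \<inter> I)|\<nu>. g t) = 0"
    have reduce: "(LINT t:(B \<inter> I)|\<nu>. g t) = (LINT t:B|\<nu>. g t)" for B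
      unfolding set_lebesgue_integral_def
      by (intro Bochner_Integration.integral_cong) (auto simp: indicator_def)
    \<comment> \<open>This total is what the complement case of the induction subtracts
      from.\<close>
    have all: "(LINT t:I|\<nu>. g t) = 0"
    proof -
      have "(LINT t:I|\<nu>. g t) = integ c d g"
        unfolding set_lebesgue_integral_def g_def
        by (intro Bochner_Integration.integral_cong) (use Icc_sub[OF cd(1,2)] in \<open>auto simp: indicator_def\<close>)
      then show ?thesis using gIcc by simp
    qed
    have st: "Int_stable (range (\<lambda>(x, y). {x..y::real}))"
      by (auto simp: Int_stable_def)
    have bo: "(borel :: real measure) = sigma UNIV (range (\<lambda>(x, y). {x..y}))"
      using borel_eq_atLeastAtMost by simp
    have A_gen: "A \<in> sigma_sets UNIV (range (\<lambda>(x, y). {x..y::real}))"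
      using Ab unfolding bo by simp
    have "?P A"
      using st subset_UNIV[of "range (\<lambda>(x, y). {x..y::real})", folded Pow_UNIV] A_gen
    proof (induction rule: sigma_sets_induct_disjoint)
      case (basic B) then show ?case using gIcc reduce by auto
    next
      case empty then show ?case by (simp add: set_lebesgue_integral_def)
    next
      case (compl B)
      have Bb: "B \<in> sets borel" using compl(1) unfolding bo by simp
      have "(LINT t:(B \<inter> I) \<union> ((UNIV - B) \<inter> I)|\<nu>. g t) = (LINT t:(B \<inter> I)|\<nu>. g t) + (LINT t:((UNIV - B) \<inter> I)|\<nu>. g t)"
        using Bb by (intro set_integral_Un im) auto
      moreover have "(B \<inter> I) \<union> ((UNIV - B) \<inter> I) = I" by auto
      ultimately show ?case using compl(2) all by simp
    next
      case (union B)
      have Bb: "B i \<in> sets borel" for i using union(2) unfolding bo by auto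
      have "(LINT t:(\<Union>i. B i \<inter> I)|\<nu>. g t) = (\<Sum>i. (LINT t:(B i \<inter> I)|\<nu>. g t))"
      proof (rule lebesgue_integral_countable_add)
        show "B i \<inter> I \<in> sets \<nu>" for i using Bb by (simp add: sets_iff)
        show "(B i \<inter> I) \<inter> (B j \<inter> I) = {}" if "i \<noteq> j" for i j
          using union(1) that by (auto simp: disjoint_family_on_def)
        have "set_integrable \<nu> ((\<Union>i. B i) \<inter> I) g" using Bb by (intro im) auto
        then show "set_integrable \<nu> (\<Union>i. B i \<inter> I) g" by simp
      qed
      then show ?case using union(3) by simp
    qed
    then show "(LINT t:A|\<nu>. g t) = 0" using reduce by simp
  qed
  then show "AE t in \<nu>. t \<in> {c..d} \<longrightarrow> v t = v' t"
    by eventually_elim (auto simp: g_def)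
qed

lemma prim_cong_AE:
  assumes u: "prim u v" and v': "v' \<in> borel_measurable \<nu>" and ae: "AE t in \<nu>. v t = v' t"
  shows "prim u v'"
  unfolding primitive_on_def
proof (intro ballI impI conjI)
  fix x y assume xy: "x \<in> I" "y \<in> I" "x < y"
  have ae': "AE t in \<nu>. indicator {x..y} t *\<^sub>R v t = indicator {x..y} t *\<^sub>R v' t"
    using ae by eventually_elim auto
  have meas: "(\<lambda>t. indicator {x..y} t *\<^sub>R w t) \<in> borel_measurable \<nu>" if "w \<in> borel_measurable \<nu>" for w :: "real \<Rightarrow> real"
    by (intro borel_measurable_scaleR borel_measurable_indicator Icc_sets xy that)
  show "set_integrable \<nu> {x..y} v'"
    using primD_integrable[OF u xy(1,2)] integrable_cong_AE[OF meas[OF prim_measurable[OF u]] meas[OF v'] ae']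
    by (simp only: set_integrable_def)
  show "u y - u x = integ x y v'"
    using primD[OF u xy(1,2)] xy(3) integral_cong_AE[OF meas[OF prim_measurable[OF u]] meas[OF v'] ae']
    by (simp add: set_lebesgue_integral_def)
qed

lemma prim_add:
  assumes u: "prim u v" and w: "prim w v'"
  shows "prim (\<lambda>t. u t + w t) (\<lambda>t. v t + v' t)"
  unfolding primitive_on_def
proof (intro ballI impI conjI)
  fix x y assume xy: "x \<in> I" "y \<in> I" "x < y"
  note i = primD_integrable[OF u xy(1,2)] primD_integrable[OF w xy(1,2)]
  show "set_integrable \<nu> {x..y} (\<lambda>t. v t + v' t)" by (rule set_integral_add[OF i])
  show "u y + w y - (u x + w x) = (LINT t:{x..y}|\<nu>. v t + v' t)"
    using set_integral_add[OF i] primD[OF u xy(1,2)] primD[OF w xy(1,2)] xy by simp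
qed

lemma prim_cmult:
  assumes u: "prim u v" shows "prim (\<lambda>t. c * u t) (\<lambda>t. c * v t)"
  using u unfolding primitive_on_def by (auto simp: right_diff_distrib[symmetric])

section \<open>Stopped primitives and ramps\<close>

lemma prim_stop_right:
  assumes u: "prim u v" and x: "x \<in> I"
  shows "prim (\<lambda>t. u (min t x)) (\<lambda>t. indicator {..x} t * v t)"
  unfolding primitive_on_def
proof (intro ballI impI conjI)
  fix y z assume yz: "y \<in> I" "z \<in> I" "y < z"
  define w where "w = min z x"
  have wI: "w \<in> I" using x yz by (simp add: w_def min_def)
  have eq: "indicator {y..z} t *\<^sub>R (indicator {..x} t * v t) = indicator {y..w} t *\<^sub>R v t" for t
    by (auto simp: indicator_def w_def)
  show "set_integrable \<nu> {y..z} (\<lambda>t. indicator {..x} t * v t)"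
    unfolding set_integrable_def eq using primD_integrable[OF u yz(1) wI] by (simp add: set_integrable_def)
  show "u (min z x) - u (min y x) = (LINT t:{y..z}|\<nu>. indicator {..x} t * v t)"
    unfolding set_lebesgue_integral_def eq using primD[OF u yz(1) wI] yz
    by (cases "y \<le> x") (auto simp: set_lebesgue_integral_def w_def)
qed

lemma prim_stop_left:
  assumes u: "prim u v" and x: "x \<in> I"
  shows "prim (\<lambda>t. u (max t x)) (\<lambda>t. indicator {x..} t * v t)"
  unfolding primitive_on_def
proof (intro ballI impI conjI)
  fix y z assume yz: "y \<in> I" "z \<in> I" "y < z"
  define w where "w = max y x"
  have wI: "w \<in> I" using x yz by (simp add: w_def max_def)
  have eq: "indicator {y..z} t *\<^sub>R (indicator {x..} t * v t) = indicator {w..z} t *\<^sub>R v t" for t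
    by (auto simp: indicator_def w_def)
  show "set_integrable \<nu> {y..z} (\<lambda>t. indicator {x..} t * v t)"
    unfolding set_integrable_def eq using primD_integrable[OF u wI yz(2)] by (simp add: set_integrable_def)
  show "u (max z x) - u (max y x) = (LINT t:{y..z}|\<nu>. indicator {x..} t * v t)"
    unfolding set_lebesgue_integral_def eq using primD[OF u wI yz(2)] yz
    by (cases "x \<le> z") (auto simp: set_lebesgue_integral_def w_def)
qed

lemma prim_Cauchy_Schwarz:
  assumes u: "prim u v" and v: "v \<in> L2_on \<nu>" and xy: "x \<in> I" "y \<in> I" "x \<le> y"
  shows "(u y - u x)\<^sup>2 \<le> measure \<nu> {x..y} * sqnorm \<nu> v"
  unfolding primD[OF u xy] using finite_Icc xy by (intro L2_Cauchy_Schwarz_indicator[OF v]) auto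

text \<open>The ramp is the normalised mass of \<open>{p..t}\<close>. Its derivative has squared
  norm \<open>1 / measure \<nu> {p..q}\<close>, which is why a ramp over a set of large mass is
  cheap.\<close>

lemma ex_ramp:
  assumes pq: "p \<in> I" "q \<in> I" "p < q"
  obtains \<phi> where "prim \<phi> (\<lambda>t. indicator {p..q} t / measure \<nu> {p..q})"
    "ramp p q \<phi>"
proof -
  define N where "N = measure \<nu> {p..q}"
  have N: "N > 0" using measure_Icc_pos[OF pq] by (simp add: N_def)
  have i: "set_integrable \<nu> {x..y} (\<lambda>_. 1::real)" if "x \<in> I" "y \<in> I" for x y
    using finite_Icc[OF that] that by (simp add: set_integrable_def)
  obtain F where F: "prim F (\<lambda>_. 1)" "F p = 0" using ex_prim[OF i pq(1)] by metis
  have Fval: "F t = measure \<nu> {p..t}" if "t \<in> I" "p \<le> t" for t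
    using primD[OF F(1) pq(1) that] F(2) Int_absorb2[OF Icc_sub[OF pq(1) that(1)]]
    by (simp add: set_lebesgue_integral_def)
  \<comment> \<open>Clamping the argument to \<open>{p..q}\<close> also fixes the values outside
    \<open>I\<close>, where a primitive alone says nothing.\<close>
  define \<phi> where "\<phi> t = (1/N) * F (min (max t p) q)" for t
  have pr: "prim \<phi> (\<lambda>t. (1/N) * (indicator {p..} t * (indicator {..q} t * 1)))"
    unfolding \<phi>_def using prim_cmult[OF prim_stop_left[OF prim_stop_right[OF F(1) pq(2)] pq(1)], of "1/N"] .
  also have "(\<lambda>t. (1/N) * (indicator {p..} t * (indicator {..q} t * 1))) = (\<lambda>t. indicator {p..q} t / N)"
    by (auto simp: fun_eq_iff indicator_def)
  finally have 1: "prim \<phi> (\<lambda>t. indicator {p..q} t / measure \<nu> {p..q})" by (simp add: N_def)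
  show thesis
  proof (rule that[OF 1])
    have "\<phi> t = 0" if "t \<le> p" for t using that pq F(2) by (simp add: \<phi>_def)
    moreover have "\<phi> t = 1" if "q \<le> t" for t using that pq N Fval[of q] by (simp add: \<phi>_def N_def)
    moreover have "0 \<le> \<phi> t \<and> \<phi> t \<le> 1" for t
    proof -
      define w where "w = min (max t p) q"
      have w: "w \<in> I" "p \<le> w" "w \<le> q" using mem_between[OF pq(1,2)] pq(3) by (auto simp: w_def)
      have "measure \<nu> {p..w} \<le> measure \<nu> {p..q}"
        using w pq finite_Icc[OF pq(1,2)] by (intro measure_mono_fmeasurable) (auto simp: fmeasurable_def)
      then show ?thesis
        unfolding \<phi>_def w_def[symmetric] Fval[OF w(1,2)] using N by (simp add: N_def)
    qed
    ultimately show "ramp p q \<phi>" by (simp add: ramp_def)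
  qed
qed

end


section \<open>Weak limits of functions of bounded energy\<close>

definition finite_left :: "ereal \<Rightarrow> ereal \<Rightarrow> real measure \<Rightarrow> bool" where
  "finite_left a b \<nu> \<longleftrightarrow> (\<exists>c\<in>einterval a b. emeasure \<nu> (einterval a (ereal c)) < \<infinity>)"

definition finite_right :: "ereal \<Rightarrow> ereal \<Rightarrow> real measure \<Rightarrow> bool" where
  "finite_right a b \<nu> \<longleftrightarrow> (\<exists>c\<in>einterval a b. emeasure \<nu> (einterval (ereal c) b) < \<infinity>)"

text \<open>Limit 0 at the endpoint \<open>a\<close>, stated with real points only so that finite
  and infinite endpoints need no distinction; see \<open>tendsto_left_endpoint_iff\<close>.\<close>

definition vanishes_left :: "ereal \<Rightarrow> ereal \<Rightarrow> (real \<Rightarrow> real) \<Rightarrow> bool" where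
  "vanishes_left a b w \<longleftrightarrow> (\<forall>\<epsilon>>0. \<exists>c\<in>einterval a b. \<forall>x\<in>einterval a b. x < c \<longrightarrow> \<bar>w x\<bar> < \<epsilon>)"

definition vanishes_right :: "ereal \<Rightarrow> ereal \<Rightarrow> (real \<Rightarrow> real) \<Rightarrow> bool" where
  "vanishes_right a b w \<longleftrightarrow> (\<forall>\<epsilon>>0. \<exists>c\<in>einterval a b. \<forall>x\<in>einterval a b. c < x \<longrightarrow> \<bar>w x\<bar> < \<epsilon>)"

text \<open>Replaces the choices inside \<open>ac_version\<close> and \<open>scale_deriv\<close> by
  witnesses: \<open>w\<close> is a version of \<open>u\<close> and \<open>v\<close> its derivative.
  The premises of the boundary conditions are regularity of the endpoints, by
  \<open>regular_iff\<close>.\<close>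

definition form_rep :: "ereal \<Rightarrow> ereal \<Rightarrow> real measure \<Rightarrow> real measure \<Rightarrow>
    (real \<Rightarrow> real) \<Rightarrow> (real \<Rightarrow> real) \<Rightarrow> (real \<Rightarrow> real) \<Rightarrow> bool" where
  "form_rep a b \<nu> m u w v \<longleftrightarrow> (AE x in m. w x = u x) \<and> primitive_on a b \<nu> w v \<and> v \<in> L2_on \<nu> \<and>
     (finite_left a b \<nu> \<and> finite_left a b m \<longrightarrow> vanishes_left a b w) \<and>
     (finite_right a b \<nu> \<and> finite_right a b m \<longrightarrow> vanishes_right a b w)"

context einterval_measure
begin

lemma finite_left_iff: "finite_left a b \<nu> \<longleftrightarrow> (\<exists>c\<in>I. emeasure \<nu> (I \<inter> {..c}) < \<infinity>)"
  unfolding finite_left_def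
proof
  assume "\<exists>c\<in>I. emeasure \<nu> (einterval a (ereal c)) < \<infinity>"
  then obtain c where c: "c \<in> I" "emeasure \<nu> (einterval a (ereal c)) < \<infinity>" by blast
  obtain d where d: "d \<in> I" "d < c" by (rule ex_less[OF c(1)])
  have "einterval a (ereal c) \<subseteq> I" "I \<inter> {..d} \<subseteq> einterval a (ereal c)" using c(1) d by (auto simp: einterval_def intro: less_trans[of _ "ereal c"])
  then have "emeasure \<nu> (I \<inter> {..d}) \<le> emeasure \<nu> (einterval a (ereal c))" by (intro emeasure_mono) (auto simp: sets_iff)
  then show "\<exists>c\<in>I. emeasure \<nu> (I \<inter> {..c}) < \<infinity>" using c(2) d(1) by (meson le_less_trans)
next
  assume "\<exists>c\<in>I. emeasure \<nu> (I \<inter> {..c}) < \<infinity>"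
  then obtain c where c: "c \<in> I" "emeasure \<nu> (I \<inter> {..c}) < \<infinity>" by blast
  have "einterval a (ereal c) \<subseteq> I \<inter> {..c}" using c(1) by (auto simp: einterval_def intro: less_trans[of _ "ereal c"])
  then have "emeasure \<nu> (einterval a (ereal c)) \<le> emeasure \<nu> (I \<inter> {..c})" by (intro emeasure_mono) (auto simp: sets_iff)
  then show "\<exists>c\<in>I. emeasure \<nu> (einterval a (ereal c)) < \<infinity>" using c by (meson le_less_trans)
qed

lemma finite_right_iff: "finite_right a b \<nu> \<longleftrightarrow> (\<exists>c\<in>I. emeasure \<nu> (I \<inter> {c..}) < \<infinity>)"
  unfolding finite_right_def
proof
  assume "\<exists>c\<in>I. emeasure \<nu> (einterval (ereal c) b) < \<infinity>"
  then obtain c where c: "c \<in> I" "emeasure \<nu> (einterval (ereal c) b) < \<infinity>" by blast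
  obtain d where d: "d \<in> I" "c < d" by (rule ex_greater[OF c(1)])
  have "einterval (ereal c) b \<subseteq> I" "I \<inter> {d..} \<subseteq> einterval (ereal c) b" using c(1) d by (auto simp: einterval_def intro: less_trans[of _ "ereal c"])
  then have "emeasure \<nu> (I \<inter> {d..}) \<le> emeasure \<nu> (einterval (ereal c) b)" by (intro emeasure_mono) (auto simp: sets_iff)
  then show "\<exists>c\<in>I. emeasure \<nu> (I \<inter> {c..}) < \<infinity>" using c(2) d(1) by (meson le_less_trans)
next
  assume "\<exists>c\<in>I. emeasure \<nu> (I \<inter> {c..}) < \<infinity>"
  then obtain c where c: "c \<in> I" "emeasure \<nu> (I \<inter> {c..}) < \<infinity>" by blast
  have "einterval (ereal c) b \<subseteq> I \<inter> {c..}" using c(1) by (auto simp: einterval_def intro: less_trans[of _ "ereal c"])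
  then have "emeasure \<nu> (einterval (ereal c) b) \<le> emeasure \<nu> (I \<inter> {c..})" by (intro emeasure_mono) (auto simp: sets_iff)
  then show "\<exists>c\<in>I. emeasure \<nu> (einterval (ereal c) b) < \<infinity>" using c by (meson le_less_trans)
qed

end

section \<open>Stability of boundary values and derivatives under pointwise limits\<close>

context diffuse_interval_measure
begin

text \<open>A primitive of the constant 1 is a distribution function of \<nu>; its continuity gives
  the claim.\<close>

lemma small_neighbourhood:
  assumes x: "x \<in> I" and "\<delta> > 0"
  obtains c d where "c \<in> I" "d \<in> I" "c < x" "x < d" "measure \<nu> {c..d} < \<delta>"
proof -
  have i: "set_integrable \<nu> {x..y} (\<lambda>_. 1::real)" if "x \<in> I" "y \<in> I" for x y
    using finite_Icc[OF that] that by (simp add: set_integrable_def)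
  obtain F where F: "prim F (\<lambda>_. 1)" "F x = 0" using ex_prim[OF i x] by metis
  have cont: "isCont F x"
    using prim_continuous[OF F(1)] x by (simp add: continuous_on_eq_continuous_at)
  obtain r where r: "r > 0" "\<And>y. dist y x < r \<Longrightarrow> dist (F y) (F x) < \<delta> / 2"
    using cont \<open>\<delta> > 0\<close> unfolding continuous_at_eps_delta by (metis half_gt_zero)
  obtain c0 d0 where cd0: "c0 \<in> I" "c0 < x" "d0 \<in> I" "x < d0" using ex_less[OF x] ex_greater[OF x] by metis
  define c d where "c = max c0 (x - r/2)" and "d = min d0 (x + r/2)"
  have cd: "c \<in> I" "d \<in> I" "c < x" "x < d"
    using mem_between[OF cd0(1,3)] cd0 r by (auto simp: c_def d_def)
  have "measure \<nu> {c..d} = F d - F c"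
    using primD[OF F(1) cd(1,2)] cd Int_absorb2[OF Icc_sub[OF cd(1,2)]] by (simp add: set_lebesgue_integral_def)
  also have "\<dots> < \<delta>"
    using r(2)[of c] r(2)[of d] r(1) cd unfolding dist_real_def c_def d_def F(2) by (auto simp: max_def min_def split: if_splits)
  finally show thesis using that cd by blast
qed

lemma measure_Icc_mono:
  assumes "y \<in> I" "z \<in> I" "{c..d} \<subseteq> {y..z}"
  shows "measure \<nu> {c..d} \<le> measure \<nu> {y..z}"
  using assms Icc_sub[OF assms(1,2)] finite_Icc[OF assms(1,2)]
  by (intro measure_mono_fmeasurable) (auto simp: fmeasurable_def sets_iff)

lemma Cauchy_Schwarz_le:
  assumes w: "prim w v" "v \<in> L2_on \<nu>" "sqnorm \<nu> v \<le> K" and xy: "x \<in> I" "y \<in> I" "x \<le> y"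
    and small: "measure \<nu> {x..y} * K \<le> \<epsilon>\<^sup>2" and "\<epsilon> \<ge> 0"
  shows "\<bar>w y - w x\<bar> \<le> \<epsilon>"
proof -
  have "(w y - w x)\<^sup>2 \<le> measure \<nu> {x..y} * sqnorm \<nu> v" by (rule prim_Cauchy_Schwarz[OF w(1,2) xy])
  also have "\<dots> \<le> measure \<nu> {x..y} * K" using w(3) by (intro mult_left_mono) auto
  also note small
  finally show ?thesis using \<open>\<epsilon> \<ge> 0\<close> by (simp add: abs_le_square_iff[symmetric])
qed

text \<open>By Cauchy-Schwarz, \<open>w n x\<close> differs from the values of \<open>w n\<close>
  still closer to the endpoint by at most the root of the remaining mass times \<open>K\<close>.
  Since these values tend to 0, \<open>w n x\<close> is small uniformly in \<open>n\<close>.\<close>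

lemma vanishes_left_limit:
  assumes fin: "finite_left a b \<nu>"
    and w: "\<And>n. prim (w n) (z n)" "\<And>n. z n \<in> L2_on \<nu>" "\<And>n. (LINT t|\<nu>. (z n t)\<^sup>2) \<le> K"
    and van: "\<And>n. vanishes_left a b (w n)" and lim: "\<And>x. x \<in> I \<Longrightarrow> (\<lambda>n. w n x) \<longlonglongrightarrow> wl x"
  shows "vanishes_left a b wl"
  unfolding vanishes_left_def
proof (intro allI impI)
  fix \<epsilon> :: real assume "\<epsilon> > 0"
  have K: "K \<ge> 0" using w(3)[of 0] by (rule order_trans[rotated]) simp
  then have pos: "(\<epsilon>/2)\<^sup>2 / (K + 1) > 0" using \<open>\<epsilon> > 0\<close> by simp
  obtain c0 where c0: "c0 \<in> I" "emeasure \<nu> (I \<inter> {..c0}) < \<infinity>" using fin finite_left_iff by blast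
  have "I \<inter> {..c0} \<in> sets \<nu>" by (simp add: sets_iff)
  then have h: "integrable \<nu> (indicator (I \<inter> {..c0}) :: real \<Rightarrow> real)" using c0 by simp
  \<comment> \<open>The integral is the mass to the left of \<open>c\<close>; dividing by
    \<open>K + 1\<close> covers \<open>K = 0\<close>.\<close>
  obtain c where c: "c \<in> I" "c \<le> c0"
    "(LINT x|\<nu>. indicator (I \<inter> {..<c}) x * (indicator (I \<inter> {..c0}) x :: real)) < (\<epsilon>/2)\<^sup>2 / (K + 1)"
    using left_tail_small[OF h pos c0(1)] by blast
  have ray: "I \<inter> {..<c} \<in> sets \<nu>" by (simp add: sets_iff)
  have "\<bar>wl x\<bar> < \<epsilon>" if x: "x \<in> I" "x < c" for x
  proof -
    have small: "measure \<nu> {y..x} * K \<le> (\<epsilon>/2)\<^sup>2" if y: "y \<in> I" for y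
    proof -
      have "measure \<nu> {y..x} = (LINT t|\<nu>. indicator {y..x} t)"
        using Int_absorb2[OF Icc_sub[OF y x(1)]] by simp
      also have "\<dots> \<le> (LINT x|\<nu>. indicator (I \<inter> {..<c}) x * (indicator (I \<inter> {..c0}) x :: real))"
      proof (rule integral_mono)
        show "integrable \<nu> (indicator {y..x} :: real \<Rightarrow> real)" using finite_Icc[OF y x(1)] x y by simp
        show "integrable \<nu> (\<lambda>x. indicator (I \<inter> {..<c}) x * (indicator (I \<inter> {..c0}) x :: real))"
          using integrable_mult_indicator[OF ray h] by simp
        show "indicator {y..x} t \<le> indicator (I \<inter> {..<c}) t * (indicator (I \<inter> {..c0}) t :: real)" if "t \<in> space \<nu>" for t
          using that x c by (auto simp: indicator_def)
      qed
      also note c(3)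
      finally have "measure \<nu> {y..x} * (K + 1) \<le> (\<epsilon>/2)\<^sup>2" using K by (simp add: field_simps)
      moreover have "measure \<nu> {y..x} * K \<le> measure \<nu> {y..x} * (K + 1)" by (simp add: algebra_simps)
      ultimately show ?thesis by linarith
    qed
    have "\<bar>w n x\<bar> \<le> \<epsilon>/2" for n
    proof (rule field_le_epsilon)
      \<comment> \<open>The auxiliary point \<open>y\<close> depends on \<open>n\<close> and \<eta>,
        whereas \<open>c\<close> does not; letting \<eta> tend to 0 leaves a bound independent of
        \<open>n\<close>.\<close>
      fix \<eta> :: real assume "\<eta> > 0"
      then obtain d where d: "d \<in> I" "\<And>y. y \<in> I \<Longrightarrow> y < d \<Longrightarrow> \<bar>w n y\<bar> < \<eta>"
        using van[of n] unfolding vanishes_left_def by blast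
      have "min d x \<in> I" using d(1) x by (simp add: min_def)
      then obtain y where y: "y \<in> I" "y < min d x" by (rule ex_less)
      have "\<bar>w n x - w n y\<bar> \<le> \<epsilon>/2"
        using Cauchy_Schwarz_le[OF w y(1) x(1) _ small[OF y(1)]] y \<open>\<epsilon> > 0\<close> by (simp add: abs_minus_commute)
      then show "\<bar>w n x\<bar> \<le> \<epsilon>/2 + \<eta>" using d(2)[of y] y by linarith
    qed
    then have "\<bar>wl x\<bar> \<le> \<epsilon>/2"
      using tendsto_rabs[OF lim[OF x(1)]] by (intro LIMSEQ_le_const2[of "\<lambda>n. \<bar>w n x\<bar>"]) auto
    then show ?thesis using \<open>\<epsilon> > 0\<close> by simp
  qed
  then show "\<exists>c\<in>I. \<forall>x\<in>I. x < c \<longrightarrow> \<bar>wl x\<bar> < \<epsilon>" using c(1) by blast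
qed

lemma vanishes_right_limit:
  assumes fin: "finite_right a b \<nu>"
    and w: "\<And>n. prim (w n) (z n)" "\<And>n. z n \<in> L2_on \<nu>" "\<And>n. (LINT t|\<nu>. (z n t)\<^sup>2) \<le> K"
    and van: "\<And>n. vanishes_right a b (w n)" and lim: "\<And>x. x \<in> I \<Longrightarrow> (\<lambda>n. w n x) \<longlonglongrightarrow> wl x"
  shows "vanishes_right a b wl"
  unfolding vanishes_right_def
proof (intro allI impI)
  fix \<epsilon> :: real assume "\<epsilon> > 0"
  have K: "K \<ge> 0" using w(3)[of 0] by (rule order_trans[rotated]) simp
  then have pos: "(\<epsilon>/2)\<^sup>2 / (K + 1) > 0" using \<open>\<epsilon> > 0\<close> by simp
  obtain c0 where c0: "c0 \<in> I" "emeasure \<nu> (I \<inter> {c0..}) < \<infinity>" using fin finite_right_iff by blast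
  have "I \<inter> {c0..} \<in> sets \<nu>" by (simp add: sets_iff)
  then have h: "integrable \<nu> (indicator (I \<inter> {c0..}) :: real \<Rightarrow> real)" using c0 by simp
  obtain c where c: "c \<in> I" "c0 \<le> c"
    "(LINT x|\<nu>. indicator (I \<inter> {c<..}) x * (indicator (I \<inter> {c0..}) x :: real)) < (\<epsilon>/2)\<^sup>2 / (K + 1)"
    using right_tail_small[OF h pos c0(1)] by blast
  have ray: "I \<inter> {c<..} \<in> sets \<nu>" by (simp add: sets_iff)
  have "\<bar>wl x\<bar> < \<epsilon>" if x: "x \<in> I" "c < x" for x
  proof -
    have small: "measure \<nu> {x..y} * K \<le> (\<epsilon>/2)\<^sup>2" if y: "y \<in> I" for y
    proof -
      have "measure \<nu> {x..y} = (LINT t|\<nu>. indicator {x..y} t)"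
        using Int_absorb2[OF Icc_sub[OF x(1) y]] by simp
      also have "\<dots> \<le> (LINT x|\<nu>. indicator (I \<inter> {c<..}) x * (indicator (I \<inter> {c0..}) x :: real))"
      proof (rule integral_mono)
        show "integrable \<nu> (indicator {x..y} :: real \<Rightarrow> real)" using finite_Icc[OF x(1) y] x y by simp
        show "integrable \<nu> (\<lambda>x. indicator (I \<inter> {c<..}) x * (indicator (I \<inter> {c0..}) x :: real))"
          using integrable_mult_indicator[OF ray h] by simp
        show "indicator {x..y} t \<le> indicator (I \<inter> {c<..}) t * (indicator (I \<inter> {c0..}) t :: real)" if "t \<in> space \<nu>" for t
          using that x c by (auto simp: indicator_def)
      qed
      also note c(3)
      finally have "measure \<nu> {x..y} * (K + 1) \<le> (\<epsilon>/2)\<^sup>2" using K by (simp add: field_simps)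
      moreover have "measure \<nu> {x..y} * K \<le> measure \<nu> {x..y} * (K + 1)" by (simp add: algebra_simps)
      ultimately show ?thesis by linarith
    qed
    have "\<bar>w n x\<bar> \<le> \<epsilon>/2" for n
    proof (rule field_le_epsilon)
      fix \<eta> :: real assume "\<eta> > 0"
      then obtain d where d: "d \<in> I" "\<And>y. y \<in> I \<Longrightarrow> d < y \<Longrightarrow> \<bar>w n y\<bar> < \<eta>"
        using van[of n] unfolding vanishes_right_def by blast
      have "max d x \<in> I" using d(1) x by (simp add: max_def)
      then obtain y where y: "y \<in> I" "max d x < y" by (rule ex_greater)
      have "\<bar>w n x - w n y\<bar> \<le> \<epsilon>/2"
        using Cauchy_Schwarz_le[OF w x(1) y(1) _ small[OF y(1)]] y \<open>\<epsilon> > 0\<close> by (simp add: abs_minus_commute)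
      then show "\<bar>w n x\<bar> \<le> \<epsilon>/2 + \<eta>" using d(2)[of y] y by linarith
    qed
    then have "\<bar>wl x\<bar> \<le> \<epsilon>/2"
      using tendsto_rabs[OF lim[OF x(1)]] by (intro LIMSEQ_le_const2[of "\<lambda>n. \<bar>w n x\<bar>"]) auto
    then show ?thesis using \<open>\<epsilon> > 0\<close> by simp
  qed
  then show "\<exists>c\<in>I. \<forall>x\<in>I. c < x \<longrightarrow> \<bar>wl x\<bar> < \<epsilon>" using c(1) by blast
qed

text \<open>The derivatives \<open>z n\<close> need not converge strongly, but near-minimizers over
  nested convex sets do, and membership in these sets pins down the increments of the limit.\<close>

lemma prim_limit:
  assumes w: "\<And>n. prim (w n) (z n)" and z: "\<And>n. z n \<in> L2_on \<nu>" "\<And>n. (LINT t|\<nu>. (z n t)\<^sup>2) \<le> K"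
    and lim: "\<And>x. x \<in> I \<Longrightarrow> (\<lambda>n. w n x) \<longlonglongrightarrow> wl x"
  obtains zl where "prim wl zl" "zl \<in> L2_on \<nu>" "sqnorm \<nu> zl \<le> K"
proof -
  \<comment> \<open>Membership says that the integral of \<open>f\<close> over \<open>{x..y}\<close>
    is as close to the limiting increment as the worst \<open>w n\<close> with
    \<open>n \<ge> j\<close>. Quantifying over all bounds \<open>r\<close> expresses this without a
    supremum. The condition is convex, and its bound tightens to 0 as \<open>j\<close>
    grows.\<close>
  define Z where "Z j = {f \<in> L2_on \<nu>. \<forall>x\<in>I. \<forall>y\<in>I. \<forall>r. x < y \<longrightarrow>
      (\<forall>n\<ge>j. \<bar>w n y - w n x - (wl y - wl x)\<bar> \<le> r) \<longrightarrow> \<bar>integ x y f - (wl y - wl x)\<bar> \<le> r}" for j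
  have ZI: "z j \<in> Z j" for j
    unfolding Z_def using z(1) primD[OF w] by (auto simp: less_imp_le)
  obtain f zl where f: "\<And>j. f j \<in> Z j" and zl: "zl \<in> L2_on \<nu>"
      "(\<lambda>j. LINT t|\<nu>. (f j t - zl t)\<^sup>2) \<longlonglongrightarrow> 0" "sqnorm \<nu> zl \<le> K"
  proof (rule L2_nested_convex_limit[of Z \<nu> K])
    show "Z j \<subseteq> L2_on \<nu>" for j by (auto simp: Z_def)
    show "Z k \<subseteq> Z j" if "j \<le> k" for j k unfolding Z_def using that by (auto dest: order_trans)
    show "\<exists>f\<in>Z j. sqnorm \<nu> f \<le> K" for j using ZI z(2) by blast
    show "(\<lambda>t. (f t + g t) / 2) \<in> Z j" if fg: "f \<in> Z j" "g \<in> Z j" for j f g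
      unfolding Z_def mem_Collect_eq
    proof (intro conjI ballI allI impI)
      have L: "f \<in> L2_on \<nu>" "g \<in> L2_on \<nu>" using fg by (auto simp: Z_def)
      show "(\<lambda>t. (f t + g t) / 2) \<in> L2_on \<nu>"
        using L2_on_cmult[OF L2_on_add[OF L], of "1/2"] by simp
      fix x y r assume xy: "x \<in> I" "y \<in> I" "x < y" and r: "\<forall>n\<ge>j. \<bar>w n y - w n x - (wl y - wl x)\<bar> \<le> r"
      have "(LINT t:{x..y}|\<nu>. (f t + g t) / 2) = (integ x y f + integ x y g) / 2"
        using set_integral_add[OF L2_set_integrable[OF L(1) xy(1,2)] L2_set_integrable[OF L(2) xy(1,2)]] by simp
      moreover have "\<bar>integ x y f - (wl y - wl x)\<bar> \<le> r" "\<bar>integ x y g - (wl y - wl x)\<bar> \<le> r"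
        using fg xy r unfolding Z_def by blast+
      ultimately show "\<bar>(LINT t:{x..y}|\<nu>. (f t + g t) / 2) - (wl y - wl x)\<bar> \<le> r"
        by (auto simp: abs_le_iff field_simps)
    qed
  qed blast
  have fL: "f j \<in> L2_on \<nu>" for j using f by (auto simp: Z_def)
  have "prim wl zl"
    unfolding primitive_on_def
  proof (intro ballI impI conjI)
    fix x y assume xy: "x \<in> I" "y \<in> I" "x < y"
    show "set_integrable \<nu> {x..y} zl" by (rule L2_set_integrable[OF zl(1) xy(1,2)])
    have d: "(\<lambda>n. w n y - w n x) \<longlonglongrightarrow> wl y - wl x" using lim xy by (intro tendsto_intros) auto
    have 1: "(\<lambda>j. LINT t:{x..y}|\<nu>. f j t) \<longlonglongrightarrow> wl y - wl x"
    proof (rule LIMSEQ_I)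
      fix \<epsilon> :: real assume "\<epsilon> > 0"
      then obtain N where "\<forall>n\<ge>N. norm (w n y - w n x - (wl y - wl x)) < \<epsilon>/2"
        using LIMSEQ_D[OF d, of "\<epsilon>/2"] by auto
      then have N: "\<forall>n\<ge>j. \<bar>w n y - w n x - (wl y - wl x)\<bar> \<le> \<epsilon>/2" if "j \<ge> N" for j
        using that by (auto simp: less_imp_le)
      show "\<exists>N. \<forall>j\<ge>N. norm ((LINT t:{x..y}|\<nu>. f j t) - (wl y - wl x)) < \<epsilon>"
      proof (intro exI allI impI)
        fix j assume "N \<le> j"
        then have "\<bar>(LINT t:{x..y}|\<nu>. f j t) - (wl y - wl x)\<bar> \<le> \<epsilon>/2"
          using f[of j] xy N[of j] unfolding Z_def by blast
        then show "norm ((LINT t:{x..y}|\<nu>. f j t) - (wl y - wl x)) < \<epsilon>" using \<open>\<epsilon> > 0\<close> by simp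
      qed
    qed
    \<comment> \<open>Cauchy-Schwarz on \<open>{x..y}\<close>, a set of finite mass, carries
      convergence in the norm over to the integrals.\<close>
    have 2: "(\<lambda>j. LINT t:{x..y}|\<nu>. f j t) \<longlonglongrightarrow> integ x y zl"
    proof -
      let ?d = "\<lambda>j. (LINT t:{x..y}|\<nu>. f j t) - integ x y zl"
      have bnd: "(?d j)\<^sup>2 \<le> measure \<nu> {x..y} * (LINT t|\<nu>. (f j t - zl t)\<^sup>2)" for j
        using L2_Cauchy_Schwarz_indicator[OF L2_on_diff[OF fL[of j] zl(1)], of "{x..y}"] finite_Icc[OF xy(1,2)] xy
          set_integral_diff(2)[OF L2_set_integrable[OF fL[of j] xy(1,2)] L2_set_integrable[OF zl(1) xy(1,2)]]
        by simp
      have up: "(\<lambda>j. measure \<nu> {x..y} * (LINT t|\<nu>. (f j t - zl t)\<^sup>2)) \<longlonglongrightarrow> 0"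
        using tendsto_mult_left[OF zl(2), of "measure \<nu> {x..y}"] by simp
      have "(\<lambda>j. (?d j)\<^sup>2) \<longlonglongrightarrow> 0"
      proof (rule tendsto_sandwich[OF _ _ tendsto_const up])
        show "\<forall>\<^sub>F j in sequentially. 0 \<le> (?d j)\<^sup>2"
          by (rule always_eventually) simp
        show "\<forall>\<^sub>F j in sequentially. (?d j)\<^sup>2
            \<le> measure \<nu> {x..y} * (LINT t|\<nu>. (f j t - zl t)\<^sup>2)"
          using bnd by (intro always_eventually) blast
      qed
      then have "(\<lambda>j. sqrt ((?d j)\<^sup>2)) \<longlonglongrightarrow> sqrt 0"
        by (intro tendsto_intros)
      then have "?d \<longlonglongrightarrow> 0"
        by (simp add: tendsto_rabs_zero_iff)
      then show ?thesis by (simp add: LIM_zero_iff)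
    qed
    from LIMSEQ_unique[OF 1 2] show "wl y - wl x = integ x y zl" .
  qed
  then show thesis using that zl by blast
qed

end

section \<open>From weak convergence to pointwise convergence\<close>

locale interval_form = diffuse_interval_measure a b \<nu> + m: einterval_measure a b m for a b \<nu> m +
  assumes full_support: "\<And>U. open U \<Longrightarrow> U \<noteq> {} \<Longrightarrow> U \<subseteq> einterval a b \<Longrightarrow> 0 < emeasure m U"
begin

lemma m_Icc_pos: assumes "c \<in> I" "d \<in> I" "c < d" shows "0 < measure m {c..d}"
proof -
  have "0 < emeasure m {c<..<d}" 
    using assms Icc_sub[OF assms(1,2)] by (intro full_support) auto
  also have "\<dots> \<le> emeasure m {c..d}" using assms by (intro emeasure_mono) auto
  finally show ?thesis using m.finite_Icc[OF assms(1,2)] by (simp add: measure_def enn2real_positive_iff)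
qed

lemma continuous_on_measurable_m:
  assumes "continuous_on I w" shows "w \<in> borel_measurable m"
  using borel_measurable_continuous_on_restrict[OF assms] m.sets_nu by (simp cong: measurable_cong_sets)

text \<open>The set of disagreement is open and null, hence empty by full support.\<close>

lemma continuous_AE_eq:
  fixes u w :: "real \<Rightarrow> real"
  assumes "continuous_on I u" "continuous_on I w" "AE x in m. u x = w x" "x \<in> I"
  shows "u x = w x"
proof -
  define U where "U = I \<inter> (\<lambda>x. u x - w x) -` (- {0})"
  have "open U" unfolding U_def
    using assms(1,2) by (intro continuous_open_preimage) (auto intro: continuous_on_diff)
  have "U \<in> sets m" using \<open>open U\<close> by (auto simp: m.sets_iff U_def)
  have "AE x in m. x \<notin> U" using assms(3) by eventually_elim (simp add: U_def)
  then have "emeasure m U = 0"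
    using \<open>U \<in> sets m\<close> by (subst (asm) AE_iff_measurable[of U]) (auto simp: U_def)
  then have "U = {}" using full_support[OF \<open>open U\<close>] by (auto simp: U_def)
  then show ?thesis using assms(4) by (auto simp: U_def)
qed

lemma oscillation_bound:
  assumes w: "prim w z" "z \<in> L2_on \<nu>" "sqnorm \<nu> z \<le> K"
    and cd: "c \<in> I" "d \<in> I" and xy: "x \<in> {c..d}" "y \<in> {c..d}"
  shows "\<bar>w y - w x\<bar> \<le> sqrt (measure \<nu> {c..d} * K)"
proof -
  have K: "K \<ge> 0" using w(3) by (rule order_trans[rotated]) simp
  have *: "\<bar>w y - w x\<bar> \<le> sqrt (measure \<nu> {c..d} * K)" if xy: "x \<in> {c..d}" "y \<in> {c..d}" "x \<le> y" for x y
  proof (rule Cauchy_Schwarz_le[OF w])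
    show "measure \<nu> {x..y} * K \<le> (sqrt (measure \<nu> {c..d} * K))\<^sup>2"
      using measure_Icc_mono[OF cd, of x y] xy K by (simp add: mult_right_mono)
  qed (use xy mem_between[OF cd] K in auto)
  show ?thesis using *[OF xy] *[OF xy(2,1)] by (cases "x \<le> y") (auto simp: abs_minus_commute)
qed

text \<open>The link between the two measures: an integral of the class \<open>f\<close> against
  \<open>m\<close> determines the value of its version at a point up to the oscillation, which \<nu>
  controls.\<close>

lemma average_bound:
  assumes w: "prim w z" "z \<in> L2_on \<nu>" "sqnorm \<nu> z \<le> K" and f: "f \<in> L2_on m" "AE x in m. w x = f x"
    and cd: "c \<in> I" "d \<in> I" and x: "x \<in> {c..d}"
  shows "\<bar>measure m {c..d} * w x - (LINT t:{c..d}|m. f t)\<bar> \<le> measure m {c..d} * sqrt (measure \<nu> {c..d} * K)"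
proof -
  let ?s = "sqrt (measure \<nu> {c..d} * K)"
  have i1: "integrable m (indicator {c..d} :: real \<Rightarrow> real)" using m.finite_Icc[OF cd] cd by simp
  have i2: "integrable m (\<lambda>t. indicator {c..d} t * f t)"
    using L2_on_set_integrable[OF f(1), of "{c..d}"] m.finite_Icc[OF cd] cd by (simp add: set_integrable_def)
  have mI: "measure m ({c..d} \<inter> I) = measure m {c..d}" using Int_absorb2[OF Icc_sub[OF cd]] by simp
  have "measure m {c..d} * w x - (LINT t:{c..d}|m. f t) = (LINT t|m. w x * indicator {c..d} t - indicator {c..d} t * f t)"
    using i1 i2 mI by (simp add: set_lebesgue_integral_def)
  also have "\<bar>\<dots>\<bar> \<le> (LINT t|m. ?s * indicator {c..d} t)"
  proof -
    have "\<bar>LINT t|m. w x * indicator {c..d} t - indicator {c..d} t * f t\<bar> \<le> (LINT t|m. \<bar>w x * indicator {c..d} t - indicator {c..d} t * f t\<bar>)"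
      by (rule integral_abs_bound)
    also have "\<dots> \<le> (LINT t|m. ?s * indicator {c..d} t)"
    proof (rule integral_mono_AE)
      show "AE t in m. \<bar>w x * indicator {c..d} t - indicator {c..d} t * f t\<bar> \<le> ?s * indicator {c..d} t"
        using f(2)
      proof eventually_elim
        fix t assume "w t = f t"
        then show "\<bar>w x * indicator {c..d} t - indicator {c..d} t * f t\<bar> \<le> ?s * indicator {c..d} t"
          using oscillation_bound[OF w cd _ x, of t] by (cases "t \<in> {c..d}") auto
      qed
    qed (use i1 i2 in simp_all)
    finally show ?thesis .
  qed
  also have "\<dots> = measure m {c..d} * ?s" using mI by simp
  finally show ?thesis .
qed

text \<open>Averages over \<open>{c..d}\<close> converge because indicators are admissible test
  functions, and equicontinuity transfers this to point values. Thus the whole sequence converges,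
  with no passage to a subsequence.\<close>

lemma weak_limit_pointwise:
  assumes f: "\<And>n. f n \<in> L2_on m" and g: "g \<in> L2_on m" and weak: "weak_conv_L2 m f g"
    and w: "\<And>n. prim (w n) (z n)" "\<And>n. z n \<in> L2_on \<nu>" "\<And>n. (LINT t|\<nu>. (z n t)\<^sup>2) \<le> K"
    and ae: "\<And>n. AE x in m. w n x = f n x"
  obtains wl where "\<And>x. x \<in> I \<Longrightarrow> (\<lambda>n. w n x) \<longlonglongrightarrow> wl x" "AE x in m. wl x = g x"
proof -
  have K: "K \<ge> 0" using w(3)[of 0] by (rule order_trans[rotated]) simp
  have avg: "(\<lambda>n. LINT t:{c..d}|m. f n t) \<longlonglongrightarrow> (LINT t:{c..d}|m. g t)" if "c \<in> I" "d \<in> I" for c d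
  proof -
    have "(indicator {c..d} :: real \<Rightarrow> real) \<in> L2_on m"
      using that m.finite_Icc[OF that] by (intro L2_on_indicator) auto
    from weak[unfolded weak_conv_L2_def, rule_format, OF this] show ?thesis
      by (simp add: set_lebesgue_integral_def mult.commute)
  qed
  have conv: "convergent (\<lambda>n. w n x)" if x: "x \<in> I" for x
  proof (subst Cauchy_convergent_iff[symmetric], rule metric_CauchyI)
    fix \<epsilon> :: real assume "\<epsilon> > 0"
    \<comment> \<open>Oscillation and error of the average cost \<epsilon>/8 each, so every late
      term is within \<epsilon>/4 of \<open>A / M\<close>, and two of them are within \<epsilon>/2
      of each other.\<close>
    then have "(\<epsilon>/8)\<^sup>2 / (K + 1) > 0" using K by (simp add: zero_less_divide_iff)
    then obtain c d where cd: "c \<in> I" "d \<in> I" "c < x" "x < d" "measure \<nu> {c..d} < (\<epsilon>/8)\<^sup>2 / (K + 1)"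
      using small_neighbourhood[OF x] by metis
    have "measure \<nu> {c..d} * K \<le> measure \<nu> {c..d} * (K + 1)" by (simp add: algebra_simps)
    also have "\<dots> \<le> (\<epsilon>/8)\<^sup>2" using cd(5) K by (simp add: field_simps)
    finally have s: "sqrt (measure \<nu> {c..d} * K) \<le> \<epsilon>/8" using \<open>\<epsilon> > 0\<close> by (intro real_le_lsqrt) auto
    define M where "M = measure m {c..d}"
    have M: "M > 0" using m_Icc_pos[OF cd(1,2)] cd by (simp add: M_def)
    define A where "A = (LINT t:{c..d}|m. g t)"
    obtain N where N: "\<And>n. n \<ge> N \<Longrightarrow> \<bar>(LINT t:{c..d}|m. f n t) - A\<bar> < M * (\<epsilon>/8)"
      using LIMSEQ_D[OF avg[OF cd(1,2)], of "M * (\<epsilon>/8)"] M \<open>\<epsilon> > 0\<close> by (auto simp: A_def)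
    have bound: "\<bar>w n x - A / M\<bar> \<le> \<epsilon>/4" if "n \<ge> N" for n
    proof -
      have "\<bar>M * w n x - (LINT t:{c..d}|m. f n t)\<bar> \<le> M * sqrt (measure \<nu> {c..d} * K)"
        using average_bound[OF w f ae cd(1,2), of x n] cd by (simp add: M_def)
      also have "\<dots> \<le> M * (\<epsilon>/8)" using s M by (intro mult_left_mono) auto
      finally have "\<bar>M * w n x - A\<bar> \<le> M * (\<epsilon>/8) + M * (\<epsilon>/8)" using N[OF that] by linarith
      also have "\<dots> = M * (\<epsilon>/4)" by (simp add: field_simps)
      finally have "\<bar>M * w n x - A\<bar> \<le> M * (\<epsilon>/4)" .
      moreover have "M * w n x - A = M * (w n x - A / M)" using M by (simp add: field_simps)
      ultimately have "M * \<bar>w n x - A / M\<bar> \<le> M * (\<epsilon>/4)" using M by (simp add: abs_mult)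
      then show ?thesis using M by simp
    qed
    show "\<exists>N. \<forall>k\<ge>N. \<forall>n\<ge>N. dist (w k x) (w n x) < \<epsilon>"
    proof (intro exI allI impI)
      fix k n assume "N \<le> k" "N \<le> n"
      then show "dist (w k x) (w n x) < \<epsilon>"
        using bound[of k] bound[of n] \<open>\<epsilon> > 0\<close> unfolding dist_real_def by linarith
    qed
  qed
  define wl where "wl x = lim (\<lambda>n. w n x)" for x
  have lim: "(\<lambda>n. w n x) \<longlonglongrightarrow> wl x" if "x \<in> I" for x
    using conv[OF that] by (simp add: wl_def convergent_LIMSEQ_iff)
  have wm: "w n \<in> borel_measurable m" for n
    by (rule continuous_on_measurable_m[OF prim_continuous[OF w(1)]])
  have wlm: "wl \<in> borel_measurable m"
    by (rule borel_measurable_LIMSEQ_real[OF _ wm]) (use lim in simp)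
  have "AE x in m. wl x = g x"
  proof (rule m.AE_from_Icc)
    fix c d assume cd: "c \<in> I" "d \<in> I" "c < d"
    define M where "M = measure m {c..d}"
    have M: "M > 0" using m_Icc_pos[OF cd] by (simp add: M_def)
    have "Bseq (\<lambda>n. LINT t:{c..d}|m. f n t)"
      using avg[OF cd(1,2)] by (intro convergent_imp_Bseq) (auto simp: convergent_def)
    then obtain B0 where B0: "\<And>n. \<bar>LINT t:{c..d}|m. f n t\<bar> \<le> B0" unfolding Bseq_def by auto
    \<comment> \<open>The averages are bounded because they converge; adding the oscillation bounds
      all \<open>w n\<close> on \<open>{c..d}\<close> and provides the majorant for dominated
      convergence.\<close>
    define B where "B = B0 / M + sqrt (measure \<nu> {c..d} * K)"
    have B: "\<bar>w n x\<bar> \<le> B" if "x \<in> {c..d}" for n x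
    proof -
      have "M * \<bar>w n x\<bar> = \<bar>M * w n x\<bar>" using M by (simp add: abs_mult)
      also have "\<dots> \<le> \<bar>LINT t:{c..d}|m. f n t\<bar> + \<bar>M * w n x - (LINT t:{c..d}|m. f n t)\<bar>" by linarith
      also have "\<dots> \<le> B0 + M * sqrt (measure \<nu> {c..d} * K)"
        using average_bound[OF w f ae cd(1,2) that, of n] B0[of n] by (simp add: M_def)
      also have "\<dots> = M * B" using M by (simp add: B_def field_simps)
      finally show ?thesis using M by simp
    qed
    have Bl: "\<bar>wl x\<bar> \<le> B" if "x \<in> {c..d}" for x
      using tendsto_rabs[OF lim, of x] B[OF that] that mem_between[OF cd(1,2)]
      by (intro LIMSEQ_le_const2[of "\<lambda>n. \<bar>w n x\<bar>"]) auto
    have iJ: "integrable m (indicator {c..d} :: real \<Rightarrow> real)" using m.finite_Icc[OF cd(1,2)] cd by simp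
    have JL: "(indicator {c..d} :: real \<Rightarrow> real) \<in> L2_on m"
      using cd m.finite_Icc[OF cd(1,2)] by (intro L2_on_indicator) auto
    have wlL: "(\<lambda>x. indicator {c..d} x * wl x) \<in> L2_on m"
    proof (rule L2_on_bound)
      show "integrable m (\<lambda>x. B\<^sup>2 * indicator {c..d} x)" using iJ by simp
      show "AE x in m. (indicator {c..d} x * wl x)\<^sup>2 \<le> B\<^sup>2 * indicator {c..d} x"
        using Bl by (intro AE_I2) (auto simp: indicator_def abs_le_square_iff[symmetric] intro: order_trans[OF _ abs_ge_self])
      show "(\<lambda>x. indicator {c..d} x * wl x) \<in> borel_measurable m"
        using wlm Icc_sets m.Icc_sets[OF cd(1,2)] by (intro borel_measurable_times borel_measurable_indicator) auto
    qed
    \<comment> \<open>The truncated difference of the two candidate limits is itself the test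
      function: weak convergence and dominated convergence give the same limit against it, so its
      squared norm is 0.\<close>
    define h where "h x = indicator {c..d} x * wl x - indicator {c..d} x * g x" for x
    have hL: "h \<in> L2_on m"
      unfolding h_def using cd by (intro L2_on_diff wlL L2_on_indicator_mult g) auto
    have hJ: "h x = 0" if "x \<notin> {c..d}" for x using that by (simp add: h_def)
    have hi: "integrable m h"
    proof -
      have "integrable m (\<lambda>x. indicator {c..d} x * h x)" by (rule L2_on_mult_integrable[OF JL hL])
      moreover have "(\<lambda>x. indicator {c..d} x * h x) = h" by (auto simp: fun_eq_iff h_def indicator_def)
      ultimately show ?thesis by simp
    qed
    have l1: "(\<lambda>n. LINT x|m. f n x * h x) \<longlonglongrightarrow> (LINT x|m. g x * h x)"
      using weak hL by (simp add: weak_conv_L2_def)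
    have l2: "(\<lambda>n. LINT x|m. w n x * h x) \<longlonglongrightarrow> (LINT x|m. wl x * h x)"
    proof (rule integral_dominated_convergence[where w="\<lambda>x. B * \<bar>h x\<bar>"])
      show "integrable m (\<lambda>x. B * \<bar>h x\<bar>)" using hi by simp
      show "AE x in m. (\<lambda>n. w n x * h x) \<longlonglongrightarrow> wl x * h x"
        using lim by (intro AE_I2 tendsto_intros) auto
      show "AE x in m. norm (w n x * h x) \<le> B * \<bar>h x\<bar>" for n
      proof (rule AE_I2)
        fix x show "norm (w n x * h x) \<le> B * \<bar>h x\<bar>"
          using B[of x n] hJ[of x] by (cases "x \<in> {c..d}") (auto simp: abs_mult intro: mult_right_mono)
      qed
    qed (use wm wlm L2_onD(1)[OF hL] in simp_all)
    have "(LINT x|m. f n x * h x) = (LINT x|m. w n x * h x)" for n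
      using ae[of n] L2_onD(1)[OF hL] wm[of n] L2_onD(1)[OF f[of n]] by (intro integral_cong_AE) (auto elim!: eventually_mono)
    with l1 l2 have eq: "(LINT x|m. wl x * h x) = (LINT x|m. g x * h x)"
      using LIMSEQ_unique by auto
    have sq: "(h x)\<^sup>2 = wl x * h x - g x * h x" for x
      by (auto simp: h_def indicator_def power2_eq_square algebra_simps)
    have i_wl: "integrable m (\<lambda>x. wl x * h x)"
    proof -
      have "integrable m (\<lambda>x. indicator {c..d} x * wl x * h x)" by (rule L2_on_mult_integrable[OF wlL hL])
      moreover have "(\<lambda>x. indicator {c..d} x * wl x * h x) = (\<lambda>x. wl x * h x)" by (auto simp: fun_eq_iff h_def indicator_def)
      ultimately show ?thesis by simp
    qed
    have "sqnorm m h = 0"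
      unfolding sq using eq i_wl L2_on_mult_integrable[OF g hL] by simp
    then have "AE x in m. (h x)\<^sup>2 = 0"
      using integral_nonneg_eq_0_iff_AE[OF L2_onD(2)[OF hL]] by simp
    then show "AE x in m. x \<in> {c..d} \<longrightarrow> wl x = g x"
      by eventually_elim (auto simp: h_def)
  qed
  then show thesis using that lim by blast
qed

lemma form_rep_weak_limit:
  assumes f: "\<And>n. f n \<in> L2_on m" and g: "g \<in> L2_on m" and weak: "weak_conv_L2 m f g"
    and rep: "\<And>n. form_rep a b \<nu> m (f n) (w n) (z n)" and K: "\<And>n. (LINT t|\<nu>. (z n t)\<^sup>2) \<le> K"
  obtains wl zl where "form_rep a b \<nu> m g wl zl" "sqnorm \<nu> zl \<le> K"
proof -
  have w: "\<And>n. prim (w n) (z n)" "\<And>n. z n \<in> L2_on \<nu>" and ae: "\<And>n. AE x in m. w n x = f n x"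
    using rep by (auto simp: form_rep_def)
  obtain wl where wl: "\<And>x. x \<in> I \<Longrightarrow> (\<lambda>n. w n x) \<longlonglongrightarrow> wl x" "AE x in m. wl x = g x"
    using weak_limit_pointwise[OF f g weak w K ae] by blast
  obtain zl where zl: "prim wl zl" "zl \<in> L2_on \<nu>" "sqnorm \<nu> zl \<le> K"
    using prim_limit[OF w K wl(1)] by blast
  have "vanishes_left a b wl" if "finite_left a b \<nu>" "finite_left a b m"
    by (rule vanishes_left_limit[OF that(1) w K _ wl(1)]) (use rep that in \<open>auto simp: form_rep_def\<close>)
  moreover have "vanishes_right a b wl" if "finite_right a b \<nu>" "finite_right a b m"
    by (rule vanishes_right_limit[OF that(1) w K _ wl(1)]) (use rep that in \<open>auto simp: form_rep_def\<close>)
  ultimately have "form_rep a b \<nu> m g wl zl" using wl zl by (simp add: form_rep_def)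
  then show thesis using that zl by blast
qed

end


section \<open>Approximation by compactly supported functions\<close>

text \<open>\<open>N p q\<close> stands for the mass of \<open>{p..q}\<close>; it is kept abstract so that the version for the left
  endpoint follows by the reflection \<open>x \<mapsto> -x\<close> without reflecting measures.\<close>

lemma right_cut_selection:
  fixes u :: "real \<Rightarrow> real" and N :: "real \<Rightarrow> real \<Rightarrow> real"
  assumes cont: "continuous_on (einterval a b) u" and c: "c \<in> einterval a b"
    and nonmax: "\<And>c. c \<in> einterval a b \<Longrightarrow> \<exists>d\<in>einterval a b. c < d"
    and N: "\<And>p q. p \<in> einterval a b \<Longrightarrow> q \<in> einterval a b \<Longrightarrow> p < q \<Longrightarrow> N p q > 0"
    and alt: "(\<forall>\<delta>>0. \<forall>c\<in>einterval a b. \<exists>t\<in>einterval a b. c < t \<and> \<bar>u t\<bar> < \<delta>) \<or>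
       (\<forall>c\<in>einterval a b. \<forall>C. \<exists>q\<in>einterval a b. c < q \<and> C < N c q)"
    and \<delta>: "\<delta> > 0"
  shows "\<exists>x p q. x \<in> einterval a b \<and> p \<in> einterval a b \<and> q \<in> einterval a b \<and> p < q \<and> (u x)\<^sup>2 \<le> \<delta> * N p q \<and>
    (\<forall>\<phi> t. ramp p q \<phi> \<longrightarrow> t \<in> einterval a b \<longrightarrow>
      \<bar>u (min t x) - u x * \<phi> t - u t\<bar> \<le> (if c < t then 3 * \<bar>u t\<bar> else 0))"
proof -
  let ?I = "einterval a b"
  have between: "x \<in> ?I" if "y \<in> ?I" "z \<in> ?I" "y \<le> x" "x \<le> z" for x y z
    using Icc_subset_einterval[OF that(1,2)] that by auto
  obtain d where d: "d \<in> ?I" "c < d" using nonmax[OF c] by blast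
  define Small where "Small \<longleftrightarrow> (\<forall>\<delta>>0. \<forall>c\<in>?I. \<exists>t\<in>?I. c < t \<and> \<bar>u t\<bar> < \<delta>)"
  have not_small: "\<exists>\<delta>0>0. \<exists>c1\<in>?I. \<forall>t\<in>?I. c1 < t \<longrightarrow> \<delta>0 \<le> \<bar>u t\<bar>" if "\<not> Small"
  proof (rule ccontr)
    assume *: "\<not> ?thesis"
    have "\<exists>t\<in>?I. c < t \<and> \<bar>u t\<bar> < \<delta>" if "\<delta> > 0" "c \<in> ?I" for \<delta> c
    proof -
      have "\<not> (\<forall>t\<in>?I. c < t \<longrightarrow> \<delta> \<le> \<bar>u t\<bar>)" using * that by blast
      then show ?thesis by (auto simp: not_le)
    qed
    then show False using that unfolding Small_def by blast
  qed
  have N_large: "\<forall>c\<in>?I. \<forall>C. \<exists>q\<in>?I. c < q \<and> C < N c q" if "\<not> Small"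
    using alt that unfolding Small_def by (elim disjE) (erule notE, assumption, assumption)
  \<comment> \<open>At a zero the function can simply be stopped. With small values but no zero, it
    is stopped at a small value, which a ramp lying before the stopping point has subtracted.
    Otherwise a ramp behind the stopping point leads down to 0. In all cases the subtracted term is
    \<open>u x * \<phi>\<close>, of energy \<open>(u x)\<^sup>2 / N p q\<close>.\<close>
  consider (zero) "\<exists>x\<in>?I. c \<le> x \<and> u x = 0" | (small) "\<not> (\<exists>x\<in>?I. c \<le> x \<and> u x = 0)" "Small"
    | (large) "\<not> Small"
    by argo
  then show ?thesis
  proof cases
    case zero
    then obtain x where zero: "x \<in> ?I" "c \<le> x" "u x = 0" by blast
    have "\<bar>u (min t x) - u x * \<phi> t - u t\<bar> \<le> (if c < t then 3 * \<bar>u t\<bar> else 0)" for \<phi> :: "real \<Rightarrow> real" and t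
      using zero by (cases "t \<le> x") auto
    moreover have "(u x)\<^sup>2 \<le> \<delta> * N c d" using zero N[OF c d] \<delta> by (simp add: less_imp_le)
    ultimately show ?thesis using zero c d by blast
  next
    case small
    note small = small(1) small(2)[unfolded Small_def]
    have "\<exists>x\<in>{c..d}. \<forall>t\<in>{c..d}. \<bar>u x\<bar> \<le> \<bar>u t\<bar>"
      using d by (intro continuous_attains_inf continuous_on_rabs continuous_on_subset[OF cont] Icc_subset_einterval c) auto
    then obtain x0 where x0: "x0 \<in> {c..d}" "\<And>t. t \<in> {c..d} \<Longrightarrow> \<bar>u x0\<bar> \<le> \<bar>u t\<bar>" by blast
    have "u x0 \<noteq> 0" using small(1) between[OF c d(1), of x0] x0(1) by auto
    then have "min \<bar>u x0\<bar> (sqrt (\<delta> * N c d)) > 0" using N[OF c d] \<delta> by simp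
    \<comment> \<open>The first bound forces the minimizer of \<open>\<bar>u\<bar>\<close> on
      \<open>{c..y}\<close> to lie beyond \<open>d\<close>, behind the ramp; the second makes the
      ramp cheap. Minimality then bounds the subtracted part by \<open>\<bar>u t\<bar>\<close> on
      the way to \<open>x\<close>.\<close>
    then obtain y where y: "y \<in> ?I" "d < y" "\<bar>u y\<bar> < min \<bar>u x0\<bar> (sqrt (\<delta> * N c d))"
      using small(2) d(1) by blast
    have "\<exists>x\<in>{c..y}. \<forall>t\<in>{c..y}. \<bar>u x\<bar> \<le> \<bar>u t\<bar>"
      using d y by (intro continuous_attains_inf continuous_on_rabs continuous_on_subset[OF cont] Icc_subset_einterval c) auto
    then obtain x where x: "x \<in> {c..y}" "\<And>t. t \<in> {c..y} \<Longrightarrow> \<bar>u x\<bar> \<le> \<bar>u t\<bar>" by blast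
    have uxy: "\<bar>u x\<bar> \<le> \<bar>u y\<bar>" using x(2)[of y] d y by simp
    have xI: "x \<in> ?I" using between[OF c y(1)] x(1) by simp
    have xd: "d < x" using x0(2)[of x] uxy y x(1) by fastforce
    have "\<bar>u x\<bar> \<le> sqrt (\<delta> * N c d)" using uxy y(3) by linarith
    then have "\<bar>u x\<bar>\<^sup>2 \<le> (sqrt (\<delta> * N c d))\<^sup>2" by (intro power_mono) auto
    then have e: "(u x)\<^sup>2 \<le> \<delta> * N c d" using N[OF c d] \<delta> by simp
    have "\<bar>u (min t x) - u x * \<phi> t - u t\<bar> \<le> (if c < t then 3 * \<bar>u t\<bar> else 0)"
      if ramp: "ramp c d \<phi>" for \<phi> :: "real \<Rightarrow> real" and t
    proof -
      consider "t \<le> c" | "c < t" "t \<le> x" | "x < t" by linarith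
      then show ?thesis
      proof cases
        case 1 then show ?thesis using rampD(1)[OF ramp] xd d by simp
      next
        case 2
        have "\<bar>u x * \<phi> t\<bar> \<le> \<bar>u x\<bar> * 1" unfolding abs_mult using rampD(3,4)[OF ramp, of t] by (intro mult_left_mono) auto
        also have "\<dots> \<le> \<bar>u t\<bar>" using x(2)[of t] x(1) 2 by simp
        finally show ?thesis using 2 by simp
      next
        case 3 then show ?thesis using rampD(2)[OF ramp] xd d by simp
      qed
    qed
    then show ?thesis using xI c d e by blast
  next
    case large
    note N_large = N_large[OF large]
    obtain \<delta>0 c1 where large: "\<delta>0 > 0" "c1 \<in> ?I" "\<forall>t\<in>?I. c1 < t \<longrightarrow> \<delta>0 \<le> \<bar>u t\<bar>"
      using not_small[OF large] by blast
    define c2 where "c2 = max c c1"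
    have c2: "c2 \<in> ?I" using c large by (simp add: c2_def max_def)
    \<comment> \<open>The infimum is positive, so some \<open>x\<close> has a value below twice the
      infimum and therefore at most \<open>2 * \<bar>u t\<bar>\<close> for all \<open>t\<close>
      beyond \<open>c2\<close>. Together with \<open>\<bar>u t\<bar>\<close> itself this is the
      origin of the constant 3.\<close>
    define S where "S = (\<lambda>t. \<bar>u t\<bar>) ` {t \<in> ?I. c2 < t}"
    have S0: "\<delta>0 \<le> s" if "s \<in> S" for s using that large(3) by (auto simp: S_def c2_def)
    have ne: "S \<noteq> {}" using nonmax[OF c2] by (auto simp: S_def)
    have bb: "bdd_below S" using S0 by (rule bdd_belowI)
    have "\<delta>0 \<le> Inf S" using ne S0 by (rule cInf_greatest)
    then have "Inf S < 2 * Inf S" using large(1) by simp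
    then obtain r where r: "r \<in> S" "r < 2 * Inf S"
      using cInf_lessD[OF ne] by blast
    obtain x where x: "x \<in> ?I" "c2 < x" "\<bar>u x\<bar> < 2 * Inf S"
      using r(2) r(1)[unfolded S_def] by blast
    have ux: "\<bar>u x\<bar> \<le> 2 * \<bar>u t\<bar>" if "t \<in> ?I" "c2 < t" for t
    proof -
      have "\<bar>u t\<bar> \<in> S" using that by (auto simp: S_def)
      from cInf_lower[OF this bb] show ?thesis using x(3) by linarith
    qed
    \<comment> \<open>The ramp is made so long that its energy drops below \<delta>; this is where
      infinite mass near the endpoint enters.\<close>
    obtain q where q: "q \<in> ?I" "x < q" "(u x)\<^sup>2 / \<delta> < N x q" using N_large x(1) by blast
    have e: "(u x)\<^sup>2 \<le> \<delta> * N x q" using q(3) \<delta> by (simp add: field_simps)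
    have "\<bar>u (min t x) - u x * \<phi> t - u t\<bar> \<le> (if c < t then 3 * \<bar>u t\<bar> else 0)"
      if ramp: "ramp x q \<phi>" and t: "t \<in> ?I" for \<phi> :: "real \<Rightarrow> real" and t
    proof (cases "t \<le> x")
      case True then show ?thesis using rampD(1)[OF ramp] by simp
    next
      case False
      have "\<bar>u x * (1 - \<phi> t)\<bar> \<le> \<bar>u x\<bar> * 1" unfolding abs_mult using rampD(3,4)[OF ramp, of t] by (intro mult_left_mono) auto
      also have "\<dots> \<le> 2 * \<bar>u t\<bar>" using ux[OF t] False x by simp
      finally have "\<bar>u x - u x * \<phi> t - u t\<bar> \<le> 3 * \<bar>u t\<bar>" by (simp add: algebra_simps)
      then show ?thesis using False x by (simp add: c2_def)
    qed
    then show ?thesis using x(1) q(1,2) e by blast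
  qed
qed

lemma uminus_mem_einterval: "x \<in> einterval (-b) (-a) \<longleftrightarrow> -x \<in> einterval a b" for x :: real
  unfolding einterval_iff by (metis ereal_minus_less_minus ereal_uminus_uminus uminus_ereal.simps(1))

lemma left_cut_selection:
  fixes u :: "real \<Rightarrow> real" and N :: "real \<Rightarrow> real \<Rightarrow> real"
  assumes cont: "continuous_on (einterval a b) u" and c: "c \<in> einterval a b"
    and nonmin: "\<And>c. c \<in> einterval a b \<Longrightarrow> \<exists>d\<in>einterval a b. d < c"
    and N: "\<And>p q. p \<in> einterval a b \<Longrightarrow> q \<in> einterval a b \<Longrightarrow> p < q \<Longrightarrow> N p q > 0"
    and alt: "(\<forall>\<delta>>0. \<forall>c\<in>einterval a b. \<exists>t\<in>einterval a b. t < c \<and> \<bar>u t\<bar> < \<delta>) \<or>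
       (\<forall>c\<in>einterval a b. \<forall>C. \<exists>p\<in>einterval a b. p < c \<and> C < N p c)"
    and \<delta>: "\<delta> > 0"
  shows "\<exists>x p q. x \<in> einterval a b \<and> p \<in> einterval a b \<and> q \<in> einterval a b \<and> p < q \<and> (u x)\<^sup>2 \<le> \<delta> * N p q \<and>
    (\<forall>\<phi> t. ramp p q \<phi> \<longrightarrow> t \<in> einterval a b \<longrightarrow>
      \<bar>u (max t x) - u x * (1 - \<phi> t) - u t\<bar> \<le> (if t < c then 3 * \<bar>u t\<bar> else 0))"
proof -
  let ?I = "einterval a b" and ?J = "einterval (-b) (-a)"
  have mem: "x \<in> ?J \<longleftrightarrow> -x \<in> ?I" for x by (rule uminus_mem_einterval)
  define u' N' where "u' t = u (-t)" and "N' p q = N (-q) (-p)" for t p q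
  have "\<exists>x p q. x \<in> ?J \<and> p \<in> ?J \<and> q \<in> ?J \<and> p < q \<and> (u' x)\<^sup>2 \<le> \<delta> * N' p q \<and>
    (\<forall>\<phi> t. ramp p q \<phi> \<longrightarrow> t \<in> ?J \<longrightarrow>
      \<bar>u' (min t x) - u' x * \<phi> t - u' t\<bar> \<le> (if - c < t then 3 * \<bar>u' t\<bar> else 0))"
  proof (rule right_cut_selection)
    show "continuous_on ?J u'"
      unfolding u'_def by (intro continuous_on_compose2[OF cont]) (auto simp: mem intro: continuous_intros)
    show "- c \<in> ?J" using c by (simp add: mem)
    show "\<exists>d\<in>?J. x < d" if "x \<in> ?J" for x
    proof -
      obtain d where "d \<in> ?I" "d < -x" using nonmin \<open>x \<in> ?J\<close> mem by blast
      then show ?thesis by (intro bexI[of _ "-d"]) (auto simp: mem)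
    qed
    show "N' p q > 0" if "p \<in> ?J" "q \<in> ?J" "p < q" for p q
      unfolding N'_def using that mem by (intro N) auto
    show "(\<forall>\<delta>>0. \<forall>c\<in>?J. \<exists>t\<in>?J. c < t \<and> \<bar>u' t\<bar> < \<delta>) \<or> (\<forall>c\<in>?J. \<forall>C. \<exists>q\<in>?J. c < q \<and> C < N' c q)"
      using alt
    proof (elim disjE, goal_cases)
      case 1
      have "\<exists>t\<in>?J. c < t \<and> \<bar>u' t\<bar> < \<delta>" if "\<delta> > 0" "c \<in> ?J" for \<delta> c
      proof -
        obtain t where "t \<in> ?I" "t < -c" "\<bar>u t\<bar> < \<delta>" using 1 \<open>\<delta> > 0\<close> \<open>c \<in> ?J\<close> mem by blast
        then show ?thesis by (intro bexI[of _ "-t"]) (auto simp: mem u'_def)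
      qed
      then show ?case by blast
    next
      case 2
      have "\<exists>q\<in>?J. c < q \<and> C < N' c q" if "c \<in> ?J" for C c
      proof -
        obtain t where "t \<in> ?I" "t < -c" "C < N t (-c)" using 2 \<open>c \<in> ?J\<close> mem by blast
        then show ?thesis by (intro bexI[of _ "-t"]) (auto simp: mem N'_def)
      qed
      then show ?case by blast
    qed
  qed (rule \<delta>)
  then obtain x p q where xpq: "x \<in> ?J" "p \<in> ?J" "q \<in> ?J" "p < q" "(u' x)\<^sup>2 \<le> \<delta> * N' p q"
    and H: "\<And>\<phi> t. ramp p q \<phi> \<Longrightarrow> t \<in> ?J \<Longrightarrow>
      \<bar>u' (min t x) - u' x * \<phi> t - u' t\<bar> \<le> (if - c < t then 3 * \<bar>u' t\<bar> else 0)"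
    by blast
  have "\<bar>u (max t (-x)) - u (-x) * (1 - \<phi> t) - u t\<bar> \<le> (if t < c then 3 * \<bar>u t\<bar> else 0)"
    if ramp: "ramp (-q) (-p) \<phi>" "t \<in> ?I" for \<phi> t
  proof -
    \<comment> \<open>Reflection turns an increasing ramp into a decreasing one, and
      \<open>1 - \<phi> (-t)\<close> restores the orientation. Hence the factor
      \<open>1 - \<phi> t\<close> in the conclusion.\<close>
    have "- min (-t) x = max t (-x)" by (simp add: min_def max_def)
    then show ?thesis
      using H[of "\<lambda>t. 1 - \<phi> (-t)" "-t", unfolded u'_def minus_minus] ramp by (simp add: mem ramp_def)
  qed
  moreover have "-x \<in> ?I" "-q \<in> ?I" "-p \<in> ?I" "-q < -p" "(u (-x))\<^sup>2 \<le> \<delta> * N (-q) (-p)"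
    using xpq by (auto simp: mem u'_def N'_def)
  ultimately show ?thesis by blast
qed

section \<open>Cutting off near an endpoint\<close>

context interval_form
begin

definition cut_right_ok :: "(real \<Rightarrow> real) \<Rightarrow> bool" where
  "cut_right_ok u \<longleftrightarrow> (\<forall>\<delta>>0. \<forall>c\<in>I. \<exists>t\<in>I. c < t \<and> \<bar>u t\<bar> < \<delta>) \<or>
       (\<forall>c\<in>I. \<forall>C. \<exists>q\<in>I. c < q \<and> C < measure \<nu> {c..q})"

definition cut_left_ok :: "(real \<Rightarrow> real) \<Rightarrow> bool" where
  "cut_left_ok u \<longleftrightarrow> (\<forall>\<delta>>0. \<forall>c\<in>I. \<exists>t\<in>I. t < c \<and> \<bar>u t\<bar> < \<delta>) \<or>
       (\<forall>c\<in>I. \<forall>C. \<exists>p\<in>I. p < c \<and> C < measure \<nu> {p..c})"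

lemma finite_where_bounded_below:
  assumes w: "w \<in> L2_on m" and A: "A \<in> sets m" and "\<delta> > 0" "\<And>t. t \<in> A \<Longrightarrow> \<delta> \<le> \<bar>w t\<bar>"
  shows "emeasure m A < \<infinity>"
proof -
  have "integrable m (indicator A :: real \<Rightarrow> real)"
  proof (rule Bochner_Integration.integrable_bound)
    show "integrable m (\<lambda>t. (w t)\<^sup>2 / \<delta>\<^sup>2)" using L2_onD(2)[OF w] by simp
    show "AE t in m. norm (indicator A t :: real) \<le> norm ((w t)\<^sup>2 / \<delta>\<^sup>2)"
    proof (rule AE_I2)
      fix t
      have "\<delta>\<^sup>2 \<le> (w t)\<^sup>2" if "t \<in> A"
        using assms(3) assms(4)[OF that] by (metis abs_le_square_iff abs_of_pos)
      then show "norm (indicator A t :: real) \<le> norm ((w t)\<^sup>2 / \<delta>\<^sup>2)"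
        using assms(3) by (auto simp: indicator_def)
    qed
    show "(indicator A :: real \<Rightarrow> real) \<in> borel_measurable m" using A by (rule borel_measurable_indicator)
  qed
  then show ?thesis using A m.space_nu sets.sets_into_space[OF A] by (simp add: integrable_indicator_iff Int_absorb2)
qed

text \<open>If both alternatives fail, \<open>w\<close> stays away from 0 near the endpoint, so
  square integrability makes \<open>m\<close> finite there, and the mass of \<nu> is finite there
  too. Then the boundary condition applies and contradicts the lower bound on
  \<open>w\<close>.\<close>

lemma cut_right_ok:
  assumes w: "w \<in> L2_on m" and bc: "finite_right a b \<nu> \<and> finite_right a b m \<longrightarrow> vanishes_right a b w"
  shows "cut_right_ok w"
proof (rule ccontr)
  assume "\<not> cut_right_ok w"
  then obtain \<delta> c c2 C where *: "\<delta> > 0" "c \<in> I" "\<And>t. t \<in> I \<Longrightarrow> c < t \<Longrightarrow> \<delta> \<le> \<bar>w t\<bar>"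
    "c2 \<in> I" "\<And>q. q \<in> I \<Longrightarrow> c2 < q \<Longrightarrow> measure \<nu> {c2..q} \<le> C"
    unfolding cut_right_ok_def by (meson not_less)
  obtain d where d: "d \<in> I" "c < d" by (rule ex_greater[OF *(2)])
  have "emeasure m (I \<inter> {d..}) < \<infinity>"
    by (rule finite_where_bounded_below[OF w _ *(1)]) (use *(3) d in \<open>auto simp: m.sets_iff\<close>)
  then have "finite_right a b m" using d(1) m.finite_right_iff by blast
  moreover have "emeasure \<nu> (I \<inter> {c2..}) \<noteq> \<infinity>"
    using right_emeasure_approx[OF *(4), of C thesis for thesis] *(5) by (metis not_less)
  then have "finite_right a b \<nu>" using *(4) finite_right_iff by (auto simp: less_top)
  ultimately have "vanishes_right a b w" using bc by blast
  then obtain d where d: "d \<in> I" "\<And>x. x \<in> I \<Longrightarrow> d < x \<Longrightarrow> \<bar>w x\<bar> < \<delta>" using *(1) unfolding vanishes_right_def by blast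
  have "max c d \<in> I" using d *(2) by (simp add: max_def)
  then obtain x where "x \<in> I" "max c d < x" by (rule ex_greater)
  then show False using d(2)[of x] *(3)[of x] by simp
qed

lemma cut_left_ok:
  assumes w: "w \<in> L2_on m" and bc: "finite_left a b \<nu> \<and> finite_left a b m \<longrightarrow> vanishes_left a b w"
  shows "cut_left_ok w"
proof (rule ccontr)
  assume "\<not> cut_left_ok w"
  then obtain \<delta> c c2 C where *: "\<delta> > 0" "c \<in> I" "\<And>t. t \<in> I \<Longrightarrow> t < c \<Longrightarrow> \<delta> \<le> \<bar>w t\<bar>"
    "c2 \<in> I" "\<And>q. q \<in> I \<Longrightarrow> q < c2 \<Longrightarrow> measure \<nu> {q..c2} \<le> C"
    unfolding cut_left_ok_def by (meson not_less)
  obtain d where d: "d \<in> I" "d < c" by (rule ex_less[OF *(2)])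
  have "emeasure m (I \<inter> {..d}) < \<infinity>"
    by (rule finite_where_bounded_below[OF w _ *(1)]) (use *(3) d in \<open>auto simp: m.sets_iff\<close>)
  then have "finite_left a b m" using d(1) m.finite_left_iff by blast
  moreover have "emeasure \<nu> (I \<inter> {..c2}) \<noteq> \<infinity>"
    using left_emeasure_approx[OF *(4), of C thesis for thesis] *(5) by (metis not_less)
  then have "finite_left a b \<nu>" using *(4) finite_left_iff by (auto simp: less_top)
  ultimately have "vanishes_left a b w" using bc by blast
  then obtain d where d: "d \<in> I" "\<And>x. x \<in> I \<Longrightarrow> x < d \<Longrightarrow> \<bar>w x\<bar> < \<delta>" using *(1) unfolding vanishes_left_def by blast
  have "min c d \<in> I" using d *(2) by (simp add: min_def)
  then obtain x where "x \<in> I" "x < min c d" by (rule ex_less)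
  then show False using d(2)[of x] *(3)[of x] by simp
qed

text \<open>Serves both constructions of the limsup part: \<open>A\<close> restricts the derivative,
  and the multiple of \<open>indicator B\<close> is the slope of a ramp or the correction of an
  integral.\<close>

lemma perturbed_energy:
  assumes v: "v \<in> L2_on \<nu>" and A: "A \<in> sets \<nu>" and B: "B \<in> sets \<nu>" "emeasure \<nu> B < \<infinity>" and "\<theta> > 0"
  shows "(\<lambda>t. indicator A t * v t - k * indicator B t) \<in> L2_on \<nu>"
    "(LINT t|\<nu>. (indicator A t * v t - k * indicator B t)\<^sup>2) \<le>
      (1 + \<theta>) * sqnorm \<nu> v + (1 + 1/\<theta>) * (k\<^sup>2 * measure \<nu> B)"
proof -
  have f: "(\<lambda>t. indicator A t * v t) \<in> L2_on \<nu>" by (rule L2_on_indicator_mult[OF v A])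
  have g: "(\<lambda>t. - k * indicator B t) \<in> L2_on \<nu>" by (rule L2_on_cmult[OF L2_on_indicator[OF B]])
  show "(\<lambda>t. indicator A t * v t - k * indicator B t) \<in> L2_on \<nu>" using L2_on_add[OF f g] by simp
  have "(LINT t|\<nu>. (indicator A t * v t + - k * indicator B t)\<^sup>2) \<le>
      (1 + \<theta>) * (LINT t|\<nu>. (indicator A t * v t)\<^sup>2) + (1 + 1/\<theta>) * (LINT t|\<nu>. (- k * indicator B t)\<^sup>2)"
    by (rule L2_norm_add_le[OF f g \<open>\<theta> > 0\<close>])
  also have "(LINT t|\<nu>. (- k * indicator B t)\<^sup>2) = (LINT t|\<nu>. k\<^sup>2 * indicator B t)"
    by (intro Bochner_Integration.integral_cong) (auto simp: indicator_def)
  also have "\<dots> = k\<^sup>2 * measure \<nu> B"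
    using sets.sets_into_space[OF B(1)] by (simp add: Int_absorb2)
  also have "(LINT t|\<nu>. (indicator A t * v t)\<^sup>2) \<le> sqnorm \<nu> v"
    by (intro integral_mono L2_onD(2)[OF f] L2_onD(2)[OF v]) (auto simp: indicator_def)
  finally show "(LINT t|\<nu>. (indicator A t * v t - k * indicator B t)\<^sup>2) \<le>
      (1 + \<theta>) * sqnorm \<nu> v + (1 + 1/\<theta>) * (k\<^sup>2 * measure \<nu> B)"
    using \<open>\<theta> > 0\<close> by simp
qed

text \<open>First \<theta> is chosen with \<open>\<theta> * E \<le> \<epsilon> / 2\<close>, then
  \<delta> so that the large weight \<open>1 + 1/\<theta>\<close> costs the other half.\<close>

lemma ex_young_constant:
  fixes E \<epsilon> :: real assumes "E \<ge> 0" "\<epsilon> > 0"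
  obtains \<theta> \<delta> where "\<theta> > 0" "\<delta> > 0" "\<And>r. r \<le> \<delta> \<Longrightarrow> (1 + \<theta>) * E + (1 + 1/\<theta>) * r \<le> E + \<epsilon>"
proof -
  define \<theta> where "\<theta> = \<epsilon> / 2 / (E + 1)"
  define \<delta> where "\<delta> = \<epsilon> / 2 / (1 + 1/\<theta>)"
  have \<theta>: "\<theta> > 0" using assms by (simp add: \<theta>_def)
  then have p: "1 + 1/\<theta> > 0" by (simp add: add_pos_pos)
  have "\<theta> * E \<le> \<theta> * (E + 1)" using \<theta> by simp
  also have "\<dots> = \<epsilon> / 2" using eq_divide_eq[of \<theta> "\<epsilon> / 2" "E + 1"] assms \<theta>_def by simp
  finally have 1: "\<theta> * E \<le> \<epsilon> / 2" .
  show thesis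
  proof (rule that[of \<theta> \<delta>])
    show "\<delta> > 0" using p assms by (simp add: \<delta>_def)
    fix r assume "r \<le> \<delta>"
    then have "(1 + 1/\<theta>) * r \<le> (1 + 1/\<theta>) * \<delta>" using p by (intro mult_left_mono) auto
    also have "\<dots> = \<epsilon> / 2" using eq_divide_eq[of \<delta> "\<epsilon> / 2" "1 + 1/\<theta>"] p \<delta>_def by (simp add: mult.commute)
    finally have "(1 + 1/\<theta>) * r \<le> \<epsilon> / 2" .
    moreover have "(1 + \<theta>) * E = E + \<theta> * E" by (simp add: distrib_right)
    ultimately show "(1 + \<theta>) * E + (1 + 1/\<theta>) * r \<le> E + \<epsilon>" using 1 by linarith
  qed (rule \<theta>)
qed

text \<open>Common to both endpoints: \<open>st\<close> is the stopped function, and the constant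
  \<open>d\<close> is 0 on the right and \<open>- w x\<close> on the left. The 9 is the square of
  the factor 3 in the pointwise bound.\<close>

lemma ramp_cut:
  assumes w: "w \<in> L2_on m" "v \<in> L2_on \<nu>"
    and st: "prim st (\<lambda>t. indicator A t * v t)" "I \<inter> A \<in> sets \<nu>"
    and pq: "p \<in> I" "q \<in> I" "p < q" and \<phi>: "prim \<phi> (\<lambda>t. indicator {p..q} t / measure \<nu> {p..q})"
    and w': "\<And>t. w' t = st t - k * \<phi> t + d"
    and k: "k\<^sup>2 \<le> \<delta> * measure \<nu> {p..q}" and "\<theta> > 0"
    and young: "\<And>r. r \<le> \<delta> \<Longrightarrow> (1 + \<theta>) * sqnorm \<nu> v + (1 + 1/\<theta>) * r \<le> sqnorm \<nu> v + \<epsilon>"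
    and bound: "\<And>t. t \<in> I \<Longrightarrow> \<bar>w' t - w t\<bar> \<le> 3 * \<bar>w t\<bar> * indicator R t" and R: "R \<in> sets m"
    and tail: "(LINT t|m. indicator R t * (9 * (w t)\<^sup>2)) < \<epsilon>"
  obtains v' where "w' \<in> L2_on m" "prim w' v'" "v' \<in> L2_on \<nu>" "sqnorm \<nu> v' \<le> sqnorm \<nu> v + \<epsilon>"
    "sqnorm m (\<lambda>t. w' t - w t) \<le> \<epsilon>"
proof -
  define N where "N = measure \<nu> {p..q}"
  have N: "N > 0" using measure_Icc_pos[OF pq] by (simp add: N_def)
  \<comment> \<open>Intersecting with \<open>I\<close> turns a half-line into a measurable set of
    \<nu> and changes nothing on the space.\<close>
  define v' where "v' t = indicator (I \<inter> A) t * v t - (k / N) * indicator {p..q} t" for t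
  note pe = perturbed_energy[OF w(2) st(2) Icc_sets[OF pq(1,2)] finite_Icc[OF pq(1,2)] \<open>\<theta> > 0\<close>, of "k / N"]
  have v'L: "v' \<in> L2_on \<nu>" unfolding v'_def by (rule pe(1))
  have "prim (\<lambda>t. st t + - k * \<phi> t) (\<lambda>t. indicator A t * v t + - k * (indicator {p..q} t / N))"
    unfolding N_def by (intro prim_add prim_cmult st \<phi>)
  then have "prim w' (\<lambda>t. indicator A t * v t + - k * (indicator {p..q} t / N))"
    by (simp add: primitive_on_def w')
  then have w'v': "prim w' v'"
    by (rule prim_cong_AE[OF _ L2_onD(1)[OF v'L]]) (auto intro!: AE_I2 simp: v'_def indicator_def)
  \<comment> \<open>This is the energy \<open>k\<^sup>2 / N\<close> of the subtracted ramp.\<close>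
  have "(k / N)\<^sup>2 * N \<le> \<delta>" using k N by (simp add: N_def[symmetric] power2_eq_square field_simps)
  then have energy: "sqnorm \<nu> v' \<le> sqnorm \<nu> v + \<epsilon>"
    using pe(2) young unfolding v'_def N_def by (meson order_trans)
  have w'm: "w' \<in> borel_measurable m" by (rule continuous_on_measurable_m[OF prim_continuous[OF w'v']])
  have "integrable m (\<lambda>t. 9 * (w t)\<^sup>2)" using L2_onD(2)[OF w(1)] by simp
  from integrable_mult_indicator[OF R this] have i: "integrable m (\<lambda>t. indicator R t * (9 * (w t)\<^sup>2))" by simp
  have sq: "(w' t - w t)\<^sup>2 \<le> indicator R t * (9 * (w t)\<^sup>2)" if "t \<in> I" for t
    using power_mono[OF bound[OF that] abs_ge_zero, of 2] by (cases "t \<in> R") (auto simp: power_mult_distrib)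
  have dL: "(\<lambda>t. w' t - w t) \<in> L2_on m"
    by (rule L2_on_bound[OF _ i]) (use w'm L2_onD(1)[OF w(1)] sq in auto)
  from L2_on_add[OF w(1) this] have "w' \<in> L2_on m" by simp
  moreover have "sqnorm m (\<lambda>t. w' t - w t) \<le> (LINT t|m. indicator R t * (9 * (w t)\<^sup>2))"
    using sq by (intro integral_mono L2_onD(2)[OF dL] i) auto
  ultimately show thesis using that w'v' v'L energy tail by (meson less_imp_le order_trans)
qed

lemma right_cut:
  assumes w: "w \<in> L2_on m" "prim w v" "v \<in> L2_on \<nu>" and ok: "cut_right_ok w" and "\<epsilon> > 0"
  obtains w' v' c d where "w' \<in> L2_on m" "prim w' v'" "v' \<in> L2_on \<nu>"
    "sqnorm \<nu> v' \<le> sqnorm \<nu> v + \<epsilon>" "sqnorm m (\<lambda>t. w' t - w t) \<le> \<epsilon>"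
    "c \<in> I" "\<And>t. t \<in> I \<Longrightarrow> t \<le> c \<Longrightarrow> w' t = w t" "d \<in> I" "\<And>t. d \<le> t \<Longrightarrow> w' t = 0"
proof -
  obtain \<theta> \<delta> where \<theta>: "\<theta> > 0" "\<delta> > 0"
    "\<And>r. r \<le> \<delta> \<Longrightarrow> (1 + \<theta>) * sqnorm \<nu> v + (1 + 1/\<theta>) * r \<le> sqnorm \<nu> v + \<epsilon>"
    using ex_young_constant[OF _ \<open>\<epsilon> > 0\<close>, of "sqnorm \<nu> v"] by auto
  obtain c0 where c0: "c0 \<in> I" using ex_exhausts exhausts_def by blast
  have i9: "integrable m (\<lambda>t. 9 * (w t)\<^sup>2)" using L2_onD(2)[OF w(1)] by simp
  \<comment> \<open>The selected cut changes \<open>w\<close> only beyond \<open>c\<close>, by at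
    most \<open>3 * \<bar>w t\<bar>\<close>, so this tail dominates the squared distance.\<close>
  obtain c where c: "c \<in> I" "(LINT t|m. indicator (I \<inter> {c<..}) t * (9 * (w t)\<^sup>2)) < \<epsilon>"
    using m.right_tail_small[OF i9 \<open>\<epsilon> > 0\<close> c0] by blast
  have nonextremal: "\<exists>d\<in>I. c < d" if "c \<in> I" for c using that by (meson ex_greater)
  obtain x p q where xpq: "x \<in> I" "p \<in> I" "q \<in> I" "p < q" "(w x)\<^sup>2 \<le> \<delta> * measure \<nu> {p..q}"
    and H: "\<And>\<phi> t. ramp p q \<phi> \<Longrightarrow> t \<in> I \<Longrightarrow>
      \<bar>w (min t x) - w x * \<phi> t - w t\<bar> \<le> (if c < t then 3 * \<bar>w t\<bar> else 0)"
    using right_cut_selection[OF prim_continuous[OF w(2)] c(1) nonextremal measure_Icc_pos ok[unfolded cut_right_ok_def] \<open>\<delta> > 0\<close>]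
    by blast
  obtain \<phi> where \<phi>: "prim \<phi> (\<lambda>t. indicator {p..q} t / measure \<nu> {p..q})" "ramp p q \<phi>"
    using ex_ramp[OF xpq(2,3,4)] by blast
  define w' where "w' t = w (min t x) - w x * \<phi> t" for t
  have bound: "\<bar>w' t - w t\<bar> \<le> 3 * \<bar>w t\<bar> * indicator (I \<inter> {c<..}) t" if "t \<in> I" for t
    using H[OF \<phi>(2) that] that unfolding w'_def by (auto simp: indicator_def split: if_splits)
  have sets: "I \<inter> {..x} \<in> sets \<nu>" "I \<inter> {c<..} \<in> sets m" by (simp_all add: sets_iff m.sets_iff)
  have "w' t = w (min t x) - w x * \<phi> t + 0" for t by (simp add: w'_def algebra_simps)
  from ramp_cut[OF w(1,3) prim_stop_right[OF w(2) xpq(1)] sets(1) xpq(2,3,4) \<phi>(1) this _ \<theta>(1,3) bound sets(2) c(2)] xpq(5)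
  obtain v' where v': "w' \<in> L2_on m" "prim w' v'" "v' \<in> L2_on \<nu>" "sqnorm \<nu> v' \<le> sqnorm \<nu> v + \<epsilon>"
    "sqnorm m (\<lambda>t. w' t - w t) \<le> \<epsilon>" by auto
  show thesis
  proof (rule that[OF v' c(1)])
    show "w' t = w t" if "t \<in> I" "t \<le> c" for t using bound[OF that(1)] that(2) by simp
    \<comment> \<open>The ramp may lie before or after the stopping point, so the function is
      certainly 0 only beyond both.\<close>
    show "max x q \<in> I" using xpq by (simp add: max_def)
    show "w' t = 0" if "max x q \<le> t" for t using that rampD(2)[OF \<phi>(2)] by (simp add: w'_def min_absorb2)
  qed
qed

text \<open>The change is confined to the left of a prescribed \<open>c0\<close>, so that a cut
  already made at the right endpoint survives.\<close>

lemma left_cut: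
  assumes w: "w \<in> L2_on m" "prim w v" "v \<in> L2_on \<nu>" and ok: "cut_left_ok w" and "\<epsilon> > 0" and c0: "c0 \<in> I"
  obtains w' v' d where "w' \<in> L2_on m" "prim w' v'" "v' \<in> L2_on \<nu>"
    "sqnorm \<nu> v' \<le> sqnorm \<nu> v + \<epsilon>" "sqnorm m (\<lambda>t. w' t - w t) \<le> \<epsilon>"
    "\<And>t. t \<in> I \<Longrightarrow> c0 \<le> t \<Longrightarrow> w' t = w t" "d \<in> I" "\<And>t. t \<le> d \<Longrightarrow> w' t = 0"
proof -
  obtain \<theta> \<delta> where \<theta>: "\<theta> > 0" "\<delta> > 0"
    "\<And>r. r \<le> \<delta> \<Longrightarrow> (1 + \<theta>) * sqnorm \<nu> v + (1 + 1/\<theta>) * r \<le> sqnorm \<nu> v + \<epsilon>"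
    using ex_young_constant[OF _ \<open>\<epsilon> > 0\<close>, of "sqnorm \<nu> v"] by auto
  have i9: "integrable m (\<lambda>t. 9 * (w t)\<^sup>2)" using L2_onD(2)[OF w(1)] by simp
  obtain c where c: "c \<in> I" "c \<le> c0" "(LINT t|m. indicator (I \<inter> {..<c}) t * (9 * (w t)\<^sup>2)) < \<epsilon>"
    using m.left_tail_small[OF i9 \<open>\<epsilon> > 0\<close> c0] by blast
  have nonextremal: "\<exists>d\<in>I. d < c" if "c \<in> I" for c using that by (meson ex_less)
  obtain x p q where xpq: "x \<in> I" "p \<in> I" "q \<in> I" "p < q" "(w x)\<^sup>2 \<le> \<delta> * measure \<nu> {p..q}"
    and H: "\<And>\<phi> t. ramp p q \<phi> \<Longrightarrow> t \<in> I \<Longrightarrow>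
      \<bar>w (max t x) - w x * (1 - \<phi> t) - w t\<bar> \<le> (if t < c then 3 * \<bar>w t\<bar> else 0)"
    using left_cut_selection[OF prim_continuous[OF w(2)] c(1) nonextremal measure_Icc_pos ok[unfolded cut_left_ok_def] \<open>\<delta> > 0\<close>]
    by blast
  obtain \<phi> where \<phi>: "prim \<phi> (\<lambda>t. indicator {p..q} t / measure \<nu> {p..q})" "ramp p q \<phi>"
    using ex_ramp[OF xpq(2,3,4)] by blast
  define w' where "w' t = w (max t x) - w x * (1 - \<phi> t)" for t
  have bound: "\<bar>w' t - w t\<bar> \<le> 3 * \<bar>w t\<bar> * indicator (I \<inter> {..<c}) t" if "t \<in> I" for t
    using H[OF \<phi>(2) that] that unfolding w'_def by (auto simp: indicator_def split: if_splits)
  have sets: "I \<inter> {x..} \<in> sets \<nu>" "I \<inter> {..<c} \<in> sets m" by (simp_all add: sets_iff m.sets_iff)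
  \<comment> \<open>Here \<open>1 - \<phi>\<close> is a decreasing ramp; writing it through \<phi>
    gives slope and constant both equal to \<open>- w x\<close>.\<close>
  have "w' t = w (max t x) - (- w x) * \<phi> t + (- w x)" for t by (simp add: w'_def algebra_simps)
  from ramp_cut[OF w(1,3) prim_stop_left[OF w(2) xpq(1)] sets(1) xpq(2,3,4) \<phi>(1) this _ \<theta>(1,3) bound sets(2) c(3)] xpq(5)
  obtain v' where v': "w' \<in> L2_on m" "prim w' v'" "v' \<in> L2_on \<nu>" "sqnorm \<nu> v' \<le> sqnorm \<nu> v + \<epsilon>"
    "sqnorm m (\<lambda>t. w' t - w t) \<le> \<epsilon>" by auto
  show thesis
  proof (rule that[OF v'])
    show "w' t = w t" if "t \<in> I" "c0 \<le> t" for t using bound[OF that(1)] that(2) c(2) by simp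
    show "min x p \<in> I" using xpq by (simp add: min_def)
    show "w' t = 0" if "t \<le> min x p" for t using that rampD(1)[OF \<phi>(2)] by (simp add: w'_def max_absorb2)
  qed
qed

lemma compact_support_approx:
  assumes u: "u \<in> L2_on m" and rep: "form_rep a b \<nu> m u w v" and "\<epsilon> > 0"
  obtains w' v' p q where "w' \<in> L2_on m" "prim w' v'" "v' \<in> L2_on \<nu>"
    "sqnorm \<nu> v' \<le> sqnorm \<nu> v + \<epsilon>" "sqnorm m (\<lambda>t. w' t - u t) \<le> \<epsilon>"
    "p \<in> I" "q \<in> I" "p < q" "\<And>t. t \<le> p \<Longrightarrow> w' t = 0" "\<And>t. t \<in> I \<Longrightarrow> q \<le> t \<Longrightarrow> w' t = 0"
proof -
  have w: "prim w v" "v \<in> L2_on \<nu>" "AE t in m. w t = u t" using rep by (auto simp: form_rep_def)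
  have wm: "w \<in> borel_measurable m" by (rule continuous_on_measurable_m[OF prim_continuous[OF w(1)]])
  have wL: "w \<in> L2_on m"
    by (rule L2_on_bound[OF wm L2_onD(2)[OF u]]) (use w(3) in eventually_elim, simp)
  \<comment> \<open>Two cuts add 2 \<eta> to the energy and, by the weights 2 and 2 below, at most 4
    \<eta> to the squared distance.\<close>
  define \<eta> where "\<eta> = \<epsilon> / 4"
  have \<eta>: "\<eta> > 0" using \<open>\<epsilon> > 0\<close> by (simp add: \<eta>_def)
  obtain w1 v1 c d where 1: "w1 \<in> L2_on m" "prim w1 v1" "v1 \<in> L2_on \<nu>"
    "sqnorm \<nu> v1 \<le> sqnorm \<nu> v + \<eta>" "sqnorm m (\<lambda>t. w1 t - w t) \<le> \<eta>"
    "c \<in> I" "\<And>t. t \<in> I \<Longrightarrow> t \<le> c \<Longrightarrow> w1 t = w t" "d \<in> I" "\<And>t. d \<le> t \<Longrightarrow> w1 t = 0"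
    using right_cut[OF wL w(1,2) cut_right_ok \<eta>] wL rep unfolding form_rep_def by blast
  have "cut_left_ok w" using cut_left_ok[OF wL] rep by (simp add: form_rep_def)
  \<comment> \<open>Either alternative passes from \<open>w\<close> to \<open>w1\<close>: the first
    because they agree to the left of \<open>c\<close>, the second because it does not involve the
    function.\<close>
  then have ok: "cut_left_ok w1"
    unfolding cut_left_ok_def
  proof (elim disjE, goal_cases)
    case 1
    have "\<exists>t\<in>I. t < c' \<and> \<bar>w1 t\<bar> < \<delta>" if "\<delta> > 0" "c' \<in> I" for \<delta> c'
    proof -
      have "min c c' \<in> I" using that \<open>c \<in> I\<close> by (simp add: min_def)
      then obtain t where "t \<in> I" "t < min c c'" "\<bar>w t\<bar> < \<delta>" using 1 \<open>\<delta> > 0\<close> by blast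
      then show ?thesis using \<open>\<And>t. t \<in> I \<Longrightarrow> t \<le> c \<Longrightarrow> w1 t = w t\<close> by (intro bexI[of _ t]) auto
    qed
    then show ?case by blast
  qed blast
  obtain w2 v2 e where 2: "w2 \<in> L2_on m" "prim w2 v2" "v2 \<in> L2_on \<nu>"
    "sqnorm \<nu> v2 \<le> sqnorm \<nu> v1 + \<eta>" "sqnorm m (\<lambda>t. w2 t - w1 t) \<le> \<eta>"
    "\<And>t. t \<in> I \<Longrightarrow> d \<le> t \<Longrightarrow> w2 t = w1 t" "e \<in> I" "\<And>t. t \<le> e \<Longrightarrow> w2 t = 0"
    using left_cut[OF 1(1,2,3) ok \<eta> 1(8)] by blast
  have "sqnorm m (\<lambda>t. w2 t - u t) = (LINT t|m. ((w2 t - w1 t) + (w1 t - w t))\<^sup>2)"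
    using L2_onD(1)[OF 2(1)] L2_onD(1)[OF 1(1)] wm L2_onD(1)[OF u] w(3)
    by (intro integral_cong_AE) (auto elim!: eventually_mono)
  also have "\<dots> \<le> (1 + 1) * sqnorm m (\<lambda>t. w2 t - w1 t) + (1 + 1/1) * sqnorm m (\<lambda>t. w1 t - w t)"
    by (intro L2_norm_add_le L2_on_diff 1 2 wL) simp
  also have "\<dots> \<le> \<epsilon>" using 1(5) 2(5) by (simp add: \<eta>_def)
  finally have dist: "sqnorm m (\<lambda>t. w2 t - u t) \<le> \<epsilon>" .
  obtain q where q: "q \<in> I" "max d e < q" using ex_greater[of "max d e"] 1(8) 2(7) by (metis max_def)
  show thesis
  proof (rule that[OF 2(1,2,3) _ dist 2(7) q(1)])
    show "sqnorm \<nu> v2 \<le> sqnorm \<nu> v + \<epsilon>" using 1(4) 2(4) \<eta> by (simp add: \<eta>_def)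
    show "e < q" using q by simp
    show "w2 t = 0" if "t \<le> e" for t using 2(8) that .
    show "w2 t = 0" if "t \<in> I" "q \<le> t" for t using 2(6)[of t] 1(9)[of t] that q by simp
  qed
qed

end


section \<open>Approximation inside the characteristic sets\<close>

context interval_form
begin

text \<open>The integral of \<open>v\<close> over the support is 0, which restriction to
  \<open>G n\<close> destroys by a quantity tending to 0. Spreading a correction evenly over the
  part of the support inside \<open>G n\<close> repairs this while the derivative stays 0 off
  \<open>G n\<close>.\<close>

lemma char_set_approx:
  fixes G :: "nat \<Rightarrow> real set"
  assumes w: "w \<in> L2_on m" "prim w v" "v \<in> L2_on \<nu>" and pq: "p \<in> I" "q \<in> I" "p < q"
    and w0: "\<And>t. t \<le> p \<Longrightarrow> w t = 0" "\<And>t. t \<in> I \<Longrightarrow> q \<le> t \<Longrightarrow> w t = 0"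
    and G: "\<And>n. G n \<in> sets \<nu>" "AE t in \<nu>. (\<lambda>n. indicator (G n) t :: real) \<longlonglongrightarrow> 1" and "\<epsilon> > 0"
  shows "\<forall>\<^sub>F n in sequentially. \<exists>w' v'. w' \<in> L2_on m \<and> prim w' v' \<and> v' \<in> L2_on \<nu> \<and> (\<forall>t. t \<notin> G n \<longrightarrow> v' t = 0) \<and>
    (\<forall>t\<in>I. t < p \<or> q < t \<longrightarrow> w' t = 0) \<and> sqnorm m (\<lambda>t. w' t - w t) \<le> \<epsilon> \<and>
    sqnorm \<nu> v' \<le> sqnorm \<nu> v + \<epsilon>" (is "eventually ?P sequentially")
proof -
  define E where "E = sqnorm \<nu> v"
  have E: "E \<ge> 0" by (simp add: E_def)
  obtain \<theta> \<delta> where \<theta>: "\<theta> > 0" "\<delta> > 0" "\<And>r. r \<le> \<delta> \<Longrightarrow> (1 + \<theta>) * E + (1 + 1/\<theta>) * r \<le> E + \<epsilon>"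
    using ex_young_constant[OF E \<open>\<epsilon> > 0\<close>] by blast
  define J where "J = {p..q}"
  have J: "J \<in> sets \<nu>" "emeasure \<nu> J < \<infinity>" using pq finite_Icc[OF pq(1,2)] by (auto simp: J_def)
  have JI: "J \<subseteq> I" using Icc_sub[OF pq(1,2)] by (simp add: J_def)
  have iJ: "integrable \<nu> (indicator J :: real \<Rightarrow> real)" using J by simp
  have iv: "integrable \<nu> (\<lambda>t. indicator J t * v t)"
    using L2_on_set_integrable[OF w(3) J] by (simp add: set_integrable_def)
  have gm: "(\<lambda>t. indicator (G n) t :: real) \<in> borel_measurable \<nu>" for n
    using G(1) by (rule borel_measurable_indicator)
  \<comment> \<open>\<open>A n\<close> is the integral to be corrected, \<open>N n\<close> the mass
    available for the correction, and \<open>D n\<close> the integral of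
    \<open>\<bar>v\<bar>\<close> over the part of \<open>J\<close> lost by the restriction.\<close>
  define A where "A n = (LINT t|\<nu>. indicator (G n) t * (indicator J t * v t))" for n
  define N where "N n = (LINT t|\<nu>. indicator (G n) t * (indicator J t :: real))" for n
  define D where "D n = (LINT t|\<nu>. (1 - indicator (G n) t) * \<bar>indicator J t * v t\<bar>)" for n
  have conv: "(\<lambda>n. LINT t|\<nu>. indicator (G n) t * h t) \<longlonglongrightarrow> (LINT t|\<nu>. h t)"
    if h: "integrable \<nu> h" for h :: "real \<Rightarrow> real"
  proof (rule integral_dominated_convergence[where w="\<lambda>t. \<bar>h t\<bar>"])
    show "AE t in \<nu>. (\<lambda>n. indicator (G n) t * h t) \<longlonglongrightarrow> h t"
      using G(2) by eventually_elim (use tendsto_mult_right in fastforce)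
  qed (use h gm in \<open>auto simp: indicator_def\<close>)
  have Gi: "integrable \<nu> (\<lambda>t. indicator (G n) t * h t)" if "integrable \<nu> h" for h :: "real \<Rightarrow> real" and n
    using integrable_mult_indicator[OF G(1) that] by simp
  have "(LINT t|\<nu>. indicator J t * v t) = 0"
    using primD[OF w(2) pq(1,2)] pq(3) w0(1)[of p] w0(2)[OF pq(2)] by (simp add: set_lebesgue_integral_def J_def)
  with conv[OF iv] have A0: "A \<longlonglongrightarrow> 0" by (simp add: A_def[abs_def])
  have N0: "N \<longlonglongrightarrow> measure \<nu> J" using conv[OF iJ] JI by (simp add: N_def[abs_def] Int_absorb2)
  have Jpos: "measure \<nu> J > 0" using measure_Icc_pos[OF pq] by (simp add: J_def)
  have D_eq: "D n = (LINT t|\<nu>. \<bar>indicator J t * v t\<bar>) - (LINT t|\<nu>. indicator (G n) t * \<bar>indicator J t * v t\<bar>)" for n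
    unfolding D_def using iv Gi[OF integrable_abs[OF iv]] by (simp add: left_diff_distrib)
  have D0: "D \<longlonglongrightarrow> 0"
    unfolding D_eq using tendsto_diff[OF tendsto_const conv[OF integrable_abs[OF iv]], of "LINT t|\<nu>. \<bar>indicator J t * v t\<bar>"]
    by simp
  have lim1: "(\<lambda>n. (A n)\<^sup>2 / N n) \<longlonglongrightarrow> 0\<^sup>2 / measure \<nu> J"
    using Jpos by (intro tendsto_intros A0 N0) simp
  have lim2: "(\<lambda>n. (D n + \<bar>A n\<bar>)\<^sup>2 * measure m J) \<longlonglongrightarrow> (0 + \<bar>0\<bar>)\<^sup>2 * measure m J"
    by (intro tendsto_intros A0 D0)
  have "\<forall>\<^sub>F n in sequentially. N n > 0 \<and> (A n)\<^sup>2 / N n < \<delta> \<and> (D n + \<bar>A n\<bar>)\<^sup>2 * measure m J < \<epsilon>"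
    using order_tendstoD(1)[OF N0 Jpos] order_tendstoD(2)[OF lim1, of \<delta>] order_tendstoD(2)[OF lim2, of \<epsilon>] \<theta>(2) \<open>\<epsilon> > 0\<close>
    by (simp add: eventually_conj_iff)
  then show ?thesis
  proof eventually_elim
    fix n assume n: "N n > 0 \<and> (A n)\<^sup>2 / N n < \<delta> \<and> (D n + \<bar>A n\<bar>)\<^sup>2 * measure m J < \<epsilon>"
    \<comment> \<open>The unique multiple for which the integral over \<open>J\<close> vanishes; its
      energy is \<open>(A n)\<^sup>2 / N n\<close>.\<close>
    define k where "k = A n / N n"
    define B where "B = G n \<inter> J"
    have B: "B \<in> sets \<nu>" "emeasure \<nu> B < \<infinity>"
      using G(1) J emeasure_mono[of B J \<nu>] by (auto simp: B_def intro: le_less_trans)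
    have BN: "measure \<nu> B = N n"
    proof -
      have "N n = (LINT t|\<nu>. indicator B t)"
        unfolding N_def B_def by (intro Bochner_Integration.integral_cong) (auto simp: indicator_def)
      then show ?thesis using JI by (simp add: B_def Int_absorb2 le_infI2)
    qed
    define v' where "v' t = indicator B t * v t - k * indicator B t" for t
    note pe = perturbed_energy[OF w(3) B(1) B \<theta>(1), of k]
    have v'L: "v' \<in> L2_on \<nu>" unfolding v'_def by (rule pe(1))
    have "k\<^sup>2 * measure \<nu> B \<le> \<delta>" using n by (simp add: BN k_def power2_eq_square)
    then have energy: "sqnorm \<nu> v' \<le> E + \<epsilon>"
      using pe(2) \<theta>(3) unfolding v'_def E_def by (meson order_trans)
    obtain w' where w': "prim w' v'" "w' p = 0"
      using ex_prim[OF L2_set_integrable[OF v'L] pq(1)] by metis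
    have iD: "integrable \<nu> (\<lambda>t. (1 - indicator (G n) t) * \<bar>indicator J t * v t\<bar>)"
      using iv Gi[OF integrable_abs[OF iv]] by (simp add: left_diff_distrib)
    have int0: "(LINT t:{x..y}|\<nu>. v' t) = 0" if "{x..y} \<inter> {p<..<q} = {}" "x \<in> I" "y \<in> I" for x y
    proof -
      have "AE t in \<nu>. t \<noteq> p" "AE t in \<nu>. t \<noteq> q" using AE_not_point pq by blast+
      then have "AE t in \<nu>. indicator {x..y} t *\<^sub>R v' t = 0"
      proof eventually_elim
        fix t assume "t \<noteq> p" "t \<noteq> q"
        then show "indicator {x..y} t *\<^sub>R v' t = 0"
          using that(1) by (cases "t \<in> {p<..<q}") (auto simp: v'_def B_def J_def indicator_def)
      qed
      then show ?thesis unfolding set_lebesgue_integral_def by (rule integral_eq_zero_AE)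
    qed
    have int_pq: "(LINT t:{p..q}|\<nu>. v' t) = 0"
    proof -
      have "(LINT t:{p..q}|\<nu>. v' t) = (LINT t|\<nu>. indicator (G n) t * (indicator J t * v t) - k * (indicator (G n) t * indicator J t))"
        unfolding set_lebesgue_integral_def v'_def B_def J_def
        by (intro Bochner_Integration.integral_cong) (auto simp: indicator_def)
      also have "\<dots> = A n - k * N n" using Gi[OF iv] Gi[OF iJ] by (simp add: A_def N_def)
      also have "\<dots> = 0" using n by (simp add: k_def)
      finally show ?thesis .
    qed
    have wp: "w' t = 0" if "t \<in> I" "t \<le> p" for t
    proof -
      have "{t..p} \<inter> {p<..<q} = {}" by auto
      then show ?thesis using primD[OF w'(1) that(1) pq(1) that(2)] w'(2) int0 that(1) pq(1) by simp
    qed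
    have wq: "w' t = 0" if "t \<in> I" "q \<le> t" for t
    proof -
      have "w' q = 0" using primD[OF w'(1) pq(1,2)] pq(3) w'(2) int_pq by simp
      moreover have "{q..t} \<inter> {p<..<q} = {}" by auto
      ultimately show ?thesis using primD[OF w'(1) pq(2) that] int0 that(1) pq(2) by simp
    qed
    \<comment> \<open>On \<open>J\<close> the two derivatives differ by \<open>v\<close> outside
      \<open>G n\<close> and by \<open>k\<close> inside; as both primitives start from 0 at
      \<open>p\<close>, integrating gives this uniform bound.\<close>
    define \<tau> where "\<tau> = D n + \<bar>A n\<bar>"
    have close: "\<bar>w' t - w t\<bar> \<le> \<tau>" if t: "t \<in> J" for t
    proof -
      have tI: "t \<in> I" "p \<le> t" "t \<le> q" using t JI by (auto simp: J_def)
      have pm: "{p..t} \<in> sets \<nu>" using pq(1) tI(1) by simp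
      have i1: "integrable \<nu> (\<lambda>s. indicator {p..t} s * v' s)" "integrable \<nu> (\<lambda>s. indicator {p..t} s * v s)"
        using L2_set_integrable[OF v'L pq(1) tI(1)] L2_set_integrable[OF w(3) pq(1) tI(1)] by (auto simp: set_integrable_def)
      have "w' t - w t = (LINT s|\<nu>. indicator {p..t} s * v' s - indicator {p..t} s * v s)"
        using primD[OF w'(1) pq(1) tI(1,2)] primD[OF w(2) pq(1) tI(1,2)] w'(2) w0(1)[of p] i1
        by (simp add: set_lebesgue_integral_def)
      also have "\<bar>\<dots>\<bar> \<le> (LINT s|\<nu>. \<bar>indicator {p..t} s * v' s - indicator {p..t} s * v s\<bar>)"
        by (rule integral_abs_bound)
      also have "\<dots> \<le> (LINT s|\<nu>. (1 - indicator (G n) s) * \<bar>indicator J s * v s\<bar> + \<bar>k\<bar> * (indicator (G n) s * indicator J s))"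
      proof (rule integral_mono)
        show "integrable \<nu> (\<lambda>s. \<bar>indicator {p..t} s * v' s - indicator {p..t} s * v s\<bar>)" using i1 by simp
        show "integrable \<nu> (\<lambda>s. (1 - indicator (G n) s) * \<bar>indicator J s * v s\<bar> + \<bar>k\<bar> * (indicator (G n) s * indicator J s))"
          using iD Gi[OF iJ] by simp
        fix s
        show "\<bar>indicator {p..t} s * v' s - indicator {p..t} s * v s\<bar> \<le> (1 - indicator (G n) s) * \<bar>indicator J s * v s\<bar> + \<bar>k\<bar> * (indicator (G n) s * indicator J s)"
          using tI(3) by (cases "s \<in> {p..t}"; cases "s \<in> G n") (auto simp: v'_def B_def J_def indicator_def)
      qed
      also have "\<dots> = D n + \<bar>k\<bar> * N n" using iD Gi[OF iJ] by (simp add: D_def N_def)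
      also have "\<dots> = \<tau>" using n by (simp add: \<tau>_def k_def)
      finally show ?thesis .
    qed
    have sq: "(w' t - w t)\<^sup>2 \<le> \<tau>\<^sup>2 * indicator J t" if "t \<in> I" for t
    proof (cases "t \<in> J")
      case True
      then have "\<bar>w' t - w t\<bar>\<^sup>2 \<le> \<tau>\<^sup>2" using close by (intro power_mono) auto
      then show ?thesis using True by simp
    next
      case False
      then show ?thesis using wp[OF that] wq[OF that] w0(1)[of t] w0(2)[OF that] by (auto simp: J_def)
    qed
    have w'm: "w' \<in> borel_measurable m" by (rule continuous_on_measurable_m[OF prim_continuous[OF w'(1)]])
    have iJm: "integrable m (\<lambda>t. \<tau>\<^sup>2 * indicator J t)"
      using m.finite_Icc[OF pq(1,2)] pq by (simp add: J_def)
    have dL: "(\<lambda>t. w' t - w t) \<in> L2_on m"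
      by (rule L2_on_bound[OF _ iJm]) (use w'm L2_onD(1)[OF w(1)] sq in auto)
    have "sqnorm m (\<lambda>t. w' t - w t) \<le> (LINT t|m. \<tau>\<^sup>2 * indicator J t)"
      using sq by (intro integral_mono L2_onD(2)[OF dL] iJm) auto
    also have "\<dots> = \<tau>\<^sup>2 * measure m J" using JI by (simp add: Int_absorb2)
    finally have dist: "sqnorm m (\<lambda>t. w' t - w t) \<le> \<epsilon>" using n by (simp add: \<tau>_def)
    have "(\<lambda>t. w t + (w' t - w t)) \<in> L2_on m" by (rule L2_on_add[OF w(1) dL])
    then have w'L: "w' \<in> L2_on m" by simp
    have "\<forall>t. t \<notin> G n \<longrightarrow> v' t = 0" by (simp add: v'_def B_def)
    moreover have "\<forall>t\<in>I. t < p \<or> q < t \<longrightarrow> w' t = 0" using wp wq by auto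
    ultimately show "?P n"
      using w'L w'(1) v'L dist energy unfolding E_def by blast
  qed
qed

end

section \<open>Measures and forms of a scaling function\<close>

lemma scaling_less:
  assumes "scaling_function a b s" "x \<in> einterval a b" "y \<in> einterval a b" "x < y" shows "s x < s y"
  using assms by (auto simp: scaling_function_def strict_mono_on_def)

lemma Ioc_sets_stieltjes_measure:
  assumes "scaling_function a b s" "c \<in> einterval a b" "d \<in> einterval a b" "c \<le> d"
  shows "{c<..d} \<in> sets (stieltjes_measure a b s)"
  using Ioc_subset_einterval[OF assms(2,3)] by (simp add: sets_einterval_eq)

text \<open>Continuity of \<open>s\<close> excludes atoms, and strict monotonicity gives every
  nondegenerate interval positive mass.\<close>

lemma diffuse_stieltjes_measure:
  assumes ab: "a < b" and s: "scaling_function a b s"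
  shows "diffuse_interval_measure a b (stieltjes_measure a b s)"
    and "\<And>c d. c \<in> einterval a b \<Longrightarrow> d \<in> einterval a b \<Longrightarrow> c \<le> d \<Longrightarrow> measure (stieltjes_measure a b s) {c..d} = s d - s c"
proof -
  let ?I = "einterval a b" and ?\<nu> = "stieltjes_measure a b s"
  have cont: "isCont s x" if "x \<in> ?I" for x
    using s that by (simp add: scaling_function_def continuous_on_eq_continuous_at)
  have le: "s x \<le> s y" if "x \<in> ?I" "y \<in> ?I" "x \<le> y" for x y
    using scaling_less[OF s that(1,2)] that(3) by (cases "x = y") auto
  have sing: "{c} \<in> sets ?\<nu>" if "c \<in> ?I" for c using that by (simp add: sets_einterval_eq)
  have atom: "emeasure ?\<nu> {c} = 0" if c: "c \<in> ?I" for c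
  proof -
    have "emeasure ?\<nu> {c} \<le> ennreal \<epsilon>" if "\<epsilon> > 0" for \<epsilon>
    proof -
      obtain r where r: "r > 0" "\<And>y. dist y c < r \<Longrightarrow> dist (s y) (s c) < \<epsilon>"
        using cont[OF c] \<open>\<epsilon> > 0\<close> unfolding continuous_at_eps_delta by metis
      obtain r' where r': "r' > 0" "ball c r' \<subseteq> ?I" using openE[OF open_einterval c] by blast
      define d where "d = c - min r r' / 2"
      have "d \<in> ?I" "d < c" "dist d c < r" using r(1) r' by (auto simp: d_def dist_real_def subset_eq)
      have "emeasure ?\<nu> {c} \<le> emeasure ?\<nu> {d<..c}"
        using \<open>d < c\<close> Ioc_sets_stieltjes_measure[OF s \<open>d \<in> ?I\<close> c] by (intro emeasure_mono) auto
      also have "\<dots> = ennreal (s c - s d)"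
        using \<open>d < c\<close> by (intro emeasure_stieltjes_measure_Ioc[OF s \<open>d \<in> ?I\<close> c]) simp
      also have "\<dots> \<le> ennreal \<epsilon>" using r(2)[OF \<open>dist d c < r\<close>] by (intro ennreal_leI) (simp add: dist_real_def)
      finally show ?thesis .
    qed
    then have "emeasure ?\<nu> {c} \<le> 0" by - (rule ennreal_le_epsilon, simp)
    then show ?thesis by simp
  qed
  have em: "emeasure ?\<nu> {c..d} = ennreal (s d - s c)" if cd: "c \<in> ?I" "d \<in> ?I" "c \<le> d" for c d
  proof -
    have "emeasure ?\<nu> ({c} \<union> {c<..d}) = emeasure ?\<nu> {c} + emeasure ?\<nu> {c<..d}"
      using sing[OF cd(1)] Ioc_sets_stieltjes_measure[OF s cd] by (intro plus_emeasure[symmetric]) auto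
    moreover have "{c} \<union> {c<..d} = {c..d}" using cd(3) by auto
    ultimately show ?thesis using atom[OF cd(1)] emeasure_stieltjes_measure_Ioc[OF s cd] by simp
  qed
  show "diffuse_interval_measure a b ?\<nu>"
  proof
    show "emeasure ?\<nu> {c..d} < \<infinity>" if "c \<in> ?I" "d \<in> ?I" for c d
      using em[OF that] by (cases "c \<le> d") auto
    show "0 < emeasure ?\<nu> {c..d}" if "c \<in> ?I" "d \<in> ?I" "c < d" for c d
      using em[OF that(1,2)] scaling_less[OF s that] that(3) by simp
  qed (use ab atom in auto)
  show "measure ?\<nu> {c..d} = s d - s c" if "c \<in> ?I" "d \<in> ?I" "c \<le> d" for c d
    using em[OF that] le[OF that] by (simp add: measure_def)
qed

lemma interval_form_stieltjes:
  assumes "a < b" "radon_measure_on a b m" "fully_supported_on a b m" "scaling_function a b s"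
  shows "interval_form a b (stieltjes_measure a b s) m"
proof -
  interpret diffuse_interval_measure a b "stieltjes_measure a b s"
    by (rule diffuse_stieltjes_measure(1)[OF assms(1,4)])
  show ?thesis
  proof
    show "emeasure m {c..d} < \<infinity>" if "c \<in> einterval a b" "d \<in> einterval a b" for c d
      using assms(2) Icc_subset_einterval[OF that] by (simp add: radon_measure_on_def)
  qed (use assms in \<open>auto simp: radon_measure_on_def fully_supported_on_def\<close>)
qed

section \<open>Limits and regularity at the endpoints\<close>

lemma eventually_at_left_endpoint:
  assumes ab: "a < b"
  shows "(\<forall>\<^sub>F x in at_right a. P (real_of_ereal x)) \<longleftrightarrow> (\<exists>c\<in>einterval a b. \<forall>x\<in>einterval a b. x < c \<longrightarrow> P x)"
  unfolding eventually_at_right[OF ab]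
proof
  assume "\<exists>d>a. \<forall>y>a. y < d \<longrightarrow> P (real_of_ereal y)"
  then obtain d where d: "a < d" "\<And>y. a < y \<Longrightarrow> y < d \<Longrightarrow> P (real_of_ereal y)" by blast
  obtain c where c: "a < ereal c" "ereal c < min d b" using ereal_dense2[of a "min d b"] d(1) ab by auto
  have "P x" if "x \<in> einterval a b" "x < c" for x
  proof -
    have "ereal x < d" using less_trans[of "ereal x" "ereal c" d] that c by simp
    then show ?thesis using d(2)[of "ereal x"] that by (simp add: einterval_def)
  qed
  then show "\<exists>c\<in>einterval a b. \<forall>x\<in>einterval a b. x < c \<longrightarrow> P x"
    using c by (intro bexI[of _ c]) (auto simp: einterval_def)
next
  assume "\<exists>c\<in>einterval a b. \<forall>x\<in>einterval a b. x < c \<longrightarrow> P x"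
  then obtain c where c: "c \<in> einterval a b" "\<And>x. x \<in> einterval a b \<Longrightarrow> x < c \<Longrightarrow> P x" by blast
  have "P (real_of_ereal y)" if y: "a < y" "y < ereal c" for y
  proof -
    \<comment> \<open>A point strictly between \<open>a\<close> and \<open>ereal c\<close> is finite
      even if \<open>a = -\<infinity>\<close>, so \<open>real_of_ereal\<close> is faithful
      there.\<close>
    obtain x where x: "y = ereal x" using y by (cases y) auto
    have "y < b" using y c(1) by (auto simp: einterval_def intro: less_trans)
    then show ?thesis using c(2)[of x] y x by (simp add: einterval_def)
  qed
  then show "\<exists>d>a. \<forall>y>a. y < d \<longrightarrow> P (real_of_ereal y)"
    using c(1) by (intro exI[of _ "ereal c"]) (auto simp: einterval_def)
qed

lemma tendsto_left_endpoint_iff: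
  assumes "a < b"
  shows "((\<lambda>x. w (real_of_ereal x)) \<longlongrightarrow> 0) (at_right a) \<longleftrightarrow> vanishes_left a b w"
  unfolding tendsto_iff vanishes_left_def dist_real_def diff_0_right
    eventually_at_left_endpoint[OF assms, of "\<lambda>x. \<bar>w x\<bar> < _"] ..

lemma eventually_at_right_endpoint:
  assumes ab: "a < b"
  shows "(\<forall>\<^sub>F x in at_left b. P (real_of_ereal x)) \<longleftrightarrow> (\<exists>c\<in>einterval a b. \<forall>x\<in>einterval a b. c < x \<longrightarrow> P x)"
  unfolding eventually_at_left[OF ab]
proof
  assume "\<exists>d<b. \<forall>y>d. y < b \<longrightarrow> P (real_of_ereal y)"
  then obtain d where d: "d < b" "\<And>y. d < y \<Longrightarrow> y < b \<Longrightarrow> P (real_of_ereal y)" by blast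
  obtain c where c: "max a d < ereal c" "ereal c < b" using ereal_dense2[of "max a d" b] d(1) ab by auto
  have "P x" if "x \<in> einterval a b" "c < x" for x
  proof -
    have "d < ereal x" using less_trans[of d "ereal c" "ereal x"] that c by simp
    then show ?thesis using d(2)[of "ereal x"] that by (simp add: einterval_def)
  qed
  then show "\<exists>c\<in>einterval a b. \<forall>x\<in>einterval a b. c < x \<longrightarrow> P x"
    using c by (intro bexI[of _ c]) (auto simp: einterval_def)
next
  assume "\<exists>c\<in>einterval a b. \<forall>x\<in>einterval a b. c < x \<longrightarrow> P x"
  then obtain c where c: "c \<in> einterval a b" "\<And>x. x \<in> einterval a b \<Longrightarrow> c < x \<Longrightarrow> P x" by blast
  have "P (real_of_ereal y)" if y: "ereal c < y" "y < b" for y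
  proof -
    obtain x where x: "y = ereal x" using y by (cases y) auto
    have "a < y" using y c(1) by (auto simp: einterval_def intro: less_trans)
    then show ?thesis using c(2)[of x] y x by (simp add: einterval_def)
  qed
  then show "\<exists>d<b. \<forall>y>d. y < b \<longrightarrow> P (real_of_ereal y)"
    using c(1) by (intro exI[of _ "ereal c"]) (auto simp: einterval_def)
qed

lemma tendsto_right_endpoint_iff:
  assumes "a < b"
  shows "((\<lambda>x. w (real_of_ereal x)) \<longlongrightarrow> 0) (at_left b) \<longleftrightarrow> vanishes_right a b w"
  unfolding tendsto_iff vanishes_right_def dist_real_def diff_0_right
    eventually_at_right_endpoint[OF assms, of "\<lambda>x. \<bar>w x\<bar> < _"] ..

text \<open>By monotonicity the limit exists and equals the infimum over \<open>I\<close>. Since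
  \<open>{x..c}\<close> has mass \<open>s c - s x\<close>, this infimum is above
  \<open>-\<infinity>\<close> exactly when the mass near \<open>a\<close> is finite.\<close>

lemma scaling_limit_left:
  assumes ab: "a < b" and s: "scaling_function a b s"
  shows "Lim (at_right a) (\<lambda>x. ereal (s (real_of_ereal x))) > -\<infinity> \<longleftrightarrow> finite_left a b (stieltjes_measure a b s)"
proof -
  let ?I = "einterval a b" and ?\<nu> = "stieltjes_measure a b s" and ?F = "\<lambda>x. ereal (s (real_of_ereal x))"
  interpret diffuse_interval_measure a b ?\<nu> by (rule diffuse_stieltjes_measure(1)[OF ab s])
  note meas = diffuse_stieltjes_measure(2)[OF ab s]
  define L where "L = (INF x\<in>?I. ereal (s x))"
  have "(?F \<longlongrightarrow> L) (at_right a)"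
  proof (rule order_tendstoI)
    fix y assume "y < L"
    then have "\<forall>x\<in>?I. y < ereal (s x)" unfolding L_def by (metis INF_lower less_le_trans)
    then show "\<forall>\<^sub>F x in at_right a. y < ?F x"
      using ex_exhausts exhausts_def unfolding eventually_at_left_endpoint[OF ab, of "\<lambda>x. y < ereal (s x)"] by blast
  next
    fix y assume "L < y"
    then obtain c where c: "c \<in> ?I" "ereal (s c) < y" unfolding L_def INF_less_iff by blast
    then have "\<forall>x\<in>?I. x < c \<longrightarrow> ereal (s x) < y" using scaling_less[OF s] by (metis less_ereal.simps(1) less_trans)
    then show "\<forall>\<^sub>F x in at_right a. ?F x < y"
      using c(1) unfolding eventually_at_left_endpoint[OF ab, of "\<lambda>x. ereal (s x) < y"] by blast
  qed
  moreover have "at_right a \<noteq> bot"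
    unfolding trivial_limit_def eventually_at_right[OF ab] using dense by blast
  ultimately have Lim: "Lim (at_right a) ?F = L" by (intro tendsto_Lim)
  show ?thesis
    unfolding Lim
  proof
    assume "L > -\<infinity>"
    then obtain C where C: "ereal C < L" using ereal_dense2 by blast
    have Cs: "C < s x" if "x \<in> ?I" for x
      using INF_lower[OF that, of "\<lambda>x. ereal (s x)"] C unfolding L_def[symmetric] by (metis less_ereal.simps(1) less_le_trans)
    obtain c where c: "c \<in> ?I" using ex_exhausts exhausts_def by blast
    have "emeasure ?\<nu> (I \<inter> {..c}) \<noteq> \<infinity>"
    proof
      assume "emeasure ?\<nu> (I \<inter> {..c}) = \<infinity>"
      then obtain d where d: "d \<in> I" "d < c" "measure ?\<nu> {d..c} > s c - C" by (rule left_emeasure_approx[OF c])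
      then show False using meas[OF d(1) c] Cs[OF d(1)] by simp
    qed
    then show "finite_left a b ?\<nu>" using c finite_left_iff by (auto simp: less_top)
  next
    assume "finite_left a b ?\<nu>"
    then obtain c where c: "c \<in> ?I" "emeasure ?\<nu> (I \<inter> {..c}) < \<infinity>" using finite_left_iff by blast
    define B where "B = I \<inter> {..c}"
    have B: "B \<in> sets ?\<nu>" unfolding B_def sets_iff by simp
    have "s c - measure ?\<nu> B \<le> s x" if x: "x \<in> ?I" for x
    proof (cases "x \<le> c")
      case True
      have "measure ?\<nu> {x..c} \<le> measure ?\<nu> B"
        using c B Icc_sub[OF x c(1)] Icc_sets[OF x c(1)] by (intro measure_mono_fmeasurable) (auto simp: fmeasurable_def B_def)
      then show ?thesis using meas[OF x c(1) True] by simp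
    next
      case False
      then show ?thesis using scaling_less[OF s c(1) x] measure_nonneg[of ?\<nu> B] by linarith
    qed
    then have "ereal (s c - measure ?\<nu> B) \<le> L" unfolding L_def by (intro INF_greatest) simp
    then show "L > -\<infinity>" by (rule less_le_trans[rotated]) simp
  qed
qed

lemma scaling_limit_right:
  assumes ab: "a < b" and s: "scaling_function a b s"
  shows "Lim (at_left b) (\<lambda>x. ereal (s (real_of_ereal x))) < \<infinity> \<longleftrightarrow> finite_right a b (stieltjes_measure a b s)"
proof -
  let ?I = "einterval a b" and ?\<nu> = "stieltjes_measure a b s" and ?F = "\<lambda>x. ereal (s (real_of_ereal x))"
  interpret diffuse_interval_measure a b ?\<nu> by (rule diffuse_stieltjes_measure(1)[OF ab s])
  note meas = diffuse_stieltjes_measure(2)[OF ab s]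
  define L where "L = (SUP x\<in>?I. ereal (s x))"
  have "(?F \<longlongrightarrow> L) (at_left b)"
  proof (rule order_tendstoI)
    fix y assume "L < y"
    then have "\<forall>x\<in>?I. ereal (s x) < y" unfolding L_def by (metis SUP_upper le_less_trans)
    then show "\<forall>\<^sub>F x in at_left b. ?F x < y"
      using ex_exhausts exhausts_def unfolding eventually_at_right_endpoint[OF ab, of "\<lambda>x. ereal (s x) < y"] by blast
  next
    fix y assume "y < L"
    then obtain c where c: "c \<in> ?I" "y < ereal (s c)" unfolding L_def less_SUP_iff by blast
    then have "\<forall>x\<in>?I. c < x \<longrightarrow> y < ereal (s x)" using scaling_less[OF s] by (metis less_ereal.simps(1) less_trans)
    then show "\<forall>\<^sub>F x in at_left b. y < ?F x"
      using c(1) unfolding eventually_at_right_endpoint[OF ab, of "\<lambda>x. y < ereal (s x)"] by blast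
  qed
  moreover have "at_left b \<noteq> bot"
    unfolding trivial_limit_def eventually_at_left[OF ab] using dense by blast
  ultimately have Lim: "Lim (at_left b) ?F = L" by (intro tendsto_Lim)
  show ?thesis
    unfolding Lim
  proof
    assume "L < \<infinity>"
    then obtain C where C: "L < ereal C" using ereal_dense2 by blast
    have Cs: "s x < C" if "x \<in> ?I" for x
      using SUP_upper[OF that, of "\<lambda>x. ereal (s x)"] C unfolding L_def[symmetric] by (metis less_ereal.simps(1) le_less_trans)
    obtain c where c: "c \<in> ?I" using ex_exhausts exhausts_def by blast
    have "emeasure ?\<nu> (I \<inter> {c..}) \<noteq> \<infinity>"
    proof
      assume "emeasure ?\<nu> (I \<inter> {c..}) = \<infinity>"
      then obtain d where d: "d \<in> I" "c < d" "measure ?\<nu> {c..d} > C - s c" by (rule right_emeasure_approx[OF c])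
      then show False using meas[OF c d(1)] Cs[OF d(1)] by simp
    qed
    then show "finite_right a b ?\<nu>" using c finite_right_iff by (auto simp: less_top)
  next
    assume "finite_right a b ?\<nu>"
    then obtain c where c: "c \<in> ?I" "emeasure ?\<nu> (I \<inter> {c..}) < \<infinity>" using finite_right_iff by blast
    define B where "B = I \<inter> {c..}"
    have B: "B \<in> sets ?\<nu>" unfolding B_def sets_iff by simp
    have "s x \<le> s c + measure ?\<nu> B" if x: "x \<in> ?I" for x
    proof (cases "c \<le> x")
      case True
      have "measure ?\<nu> {c..x} \<le> measure ?\<nu> B"
        using c B Icc_sub[OF c(1) x] Icc_sets[OF c(1) x] by (intro measure_mono_fmeasurable) (auto simp: fmeasurable_def B_def)
      then show ?thesis using meas[OF c(1) x True] by simp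
    next
      case False
      then show ?thesis using scaling_less[OF s x c(1)] measure_nonneg[of ?\<nu> B] by linarith
    qed
    then have "L \<le> ereal (s c + measure ?\<nu> B)" unfolding L_def by (intro SUP_least) simp
    then show "L < \<infinity>" by (rule le_less_trans) simp
  qed
qed

lemma regular_iff:
  assumes "a < b" "scaling_function a b s"
  shows "left_regular a b s m \<longleftrightarrow> finite_left a b (stieltjes_measure a b s) \<and> finite_left a b m"
    and "right_regular a b s m \<longleftrightarrow> finite_right a b (stieltjes_measure a b s) \<and> finite_right a b m"
  unfolding left_regular_def right_regular_def scaling_limit_left[OF assms] scaling_limit_right[OF assms]
  by (auto simp: finite_left_def finite_right_def)

lemma is_scale_deriv_eq: "is_scale_deriv a b s = primitive_on a b (stieltjes_measure a b s)"
  by (auto simp: is_scale_deriv_def primitive_on_def fun_eq_iff)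

text \<open>The bridge between the definitions and \<open>form_rep\<close>. The chosen version
  agrees with any other on \<open>I\<close> by full support, and then their derivatives agree almost
  everywhere, so energy and boundary conditions may be read off from any witnesses.\<close>

lemma form_dom0_rep:
  assumes hyps: "a < b" "radon_measure_on a b m" "fully_supported_on a b m" "scaling_function a b s"
  shows "form_rep a b (stieltjes_measure a b s) m u w v \<Longrightarrow> u \<in> L2_on m \<Longrightarrow>
      u \<in> form_dom0 a b s m \<and> form_energy a b s m u u = (1/2) * sqnorm (stieltjes_measure a b s) v"
    and "u \<in> form_dom0 a b s m \<Longrightarrow> u \<in> L2_on m \<and> (\<exists>w v. form_rep a b (stieltjes_measure a b s) m u w v)"
proof -
  let ?\<nu> = "stieltjes_measure a b s"
  interpret interval_form a b ?\<nu> m by (rule interval_form_stieltjes[OF hyps])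
  define W where "W = ac_version a b s m u"
  define V where "V = scale_deriv a b s W"
  have WV: "is_ac_version a b s m u W" "prim W V" if "is_ac_version a b s m u w" for w
  proof -
    show W: "is_ac_version a b s m u W" unfolding W_def ac_version_def by (rule someI[of "is_ac_version a b s m u", OF that])
    then obtain v where "is_scale_deriv a b s W v" unfolding is_ac_version_def scale_ac_def by blast
    then have "is_scale_deriv a b s W V"
      unfolding V_def scale_deriv_def by (rule someI[of "is_scale_deriv a b s W"])
    then show "prim W V" by (simp add: is_scale_deriv_eq)
  qed
  note reg = regular_iff[OF hyps(1,4), of m]
  show "u \<in> form_dom0 a b s m \<and> form_energy a b s m u u = (1/2) * sqnorm ?\<nu> v"
    if rep: "form_rep a b ?\<nu> m u w v" and u: "u \<in> L2_on m"
  proof -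
    have w: "AE x in m. w x = u x" "prim w v" "v \<in> L2_on ?\<nu>" using rep by (auto simp: form_rep_def)
    have ver: "is_ac_version a b s m u w"
      using w unfolding is_ac_version_def scale_ac_def is_scale_deriv_eq by blast
    note WV = WV[OF ver]
    have "AE x in m. W x = u x" using WV(1) by (simp add: is_ac_version_def)
    with w(1) have ae: "AE x in m. W x = w x" by eventually_elim simp
    have eq: "W x = w x" if "x \<in> I" for x
      by (rule continuous_AE_eq[OF prim_continuous[OF WV(2)] prim_continuous[OF w(2)] ae that])
    have Vv: "AE t in ?\<nu>. V t = v t" by (rule prim_deriv_unique[OF WV(2) w(2) eq])
    have VL: "V \<in> L2_on ?\<nu>"
      by (rule L2_on_bound[OF prim_measurable[OF WV(2)] L2_onD(2)[OF w(3)]]) (use Vv in eventually_elim, simp)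
    have "(LINT t|?\<nu>. V t * V t) = sqnorm ?\<nu> v"
      using Vv L2_onD(1)[OF VL] L2_onD(1)[OF w(3)]
      by (intro integral_cong_AE) (auto elim!: eventually_mono simp: power2_eq_square)
    then have "form_energy a b s m u u = (1/2) * sqnorm ?\<nu> v"
      unfolding form_energy_def W_def[symmetric] V_def[symmetric] by simp
    moreover have "vanishes_left a b W = vanishes_left a b w" "vanishes_right a b W = vanishes_right a b w"
      using eq by (auto simp: vanishes_left_def vanishes_right_def)
    then have "u \<in> form_dom0 a b s m"
      using u ver VL rep
      unfolding form_dom0_def form_dom_def mem_Collect_eq W_def[symmetric] V_def[symmetric] reg
        tendsto_left_endpoint_iff[OF hyps(1)] tendsto_right_endpoint_iff[OF hyps(1)] form_rep_def
      by blast
    ultimately show ?thesis by blast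
  qed
  show "u \<in> L2_on m \<and> (\<exists>w v. form_rep a b ?\<nu> m u w v)" if u: "u \<in> form_dom0 a b s m"
  proof -
    have "u \<in> L2_on m" and ver: "\<exists>w. is_ac_version a b s m u w" and VL: "V \<in> L2_on ?\<nu>"
      and bc: "finite_left a b ?\<nu> \<and> finite_left a b m \<longrightarrow> vanishes_left a b W"
        "finite_right a b ?\<nu> \<and> finite_right a b m \<longrightarrow> vanishes_right a b W"
      using u unfolding form_dom0_def form_dom_def mem_Collect_eq W_def[symmetric] V_def[symmetric] reg
        tendsto_left_endpoint_iff[OF hyps(1)] tendsto_right_endpoint_iff[OF hyps(1)] by blast+
    moreover have "form_rep a b ?\<nu> m u W V"
      unfolding form_rep_def using WV VL bc ver unfolding is_ac_version_def by blast
    ultimately show ?thesis by blast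
  qed
qed


section \<open>Restricting the measure to a characteristic set\<close>

lemma primitive_on_density:
  assumes G: "G \<in> sets \<nu>" and v: "v \<in> borel_measurable \<nu>" and sets: "sets \<nu> = sets (restrict_space borel (einterval a b))"
  shows "primitive_on a b (density \<nu> (indicator G)) w v \<longleftrightarrow> primitive_on a b \<nu> w (\<lambda>t. indicator G t * v t)"
proof -
  have d: "density \<nu> (indicator G) = density \<nu> (\<lambda>t. ennreal (indicator G t))"
    by (simp add: ennreal_indicator)
  have gm: "(indicator G :: real \<Rightarrow> real) \<in> borel_measurable \<nu>" using G by (rule borel_measurable_indicator)
  have Im: "(\<lambda>t. indicator {x..y} t *\<^sub>R v t) \<in> borel_measurable \<nu>" if "x \<in> einterval a b" "y \<in> einterval a b" for x y
    using v Icc_subset_einterval[OF that]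
    by (intro borel_measurable_scaleR borel_measurable_indicator) (auto simp: sets sets_einterval_eq)
  have "set_integrable (density \<nu> (indicator G)) {x..y} v \<longleftrightarrow> set_integrable \<nu> {x..y} (\<lambda>t. indicator G t * v t)"
    "(LINT t:{x..y}|density \<nu> (indicator G). v t) = (LINT t:{x..y}|\<nu>. indicator G t * v t)"
    if "x \<in> einterval a b" "y \<in> einterval a b" for x y
    using integrable_real_density[OF gm _ Im[OF that]] integral_real_density[OF gm _ Im[OF that]]
    unfolding d set_integrable_def set_lebesgue_integral_def by (simp_all add: mult_ac)
  then show ?thesis unfolding primitive_on_def by auto
qed

lemma L2_on_density:
  assumes G: "G \<in> sets M" and v: "v \<in> borel_measurable M"
  shows "v \<in> L2_on (density M (indicator G)) \<longleftrightarrow> (\<lambda>t. indicator G t * v t) \<in> L2_on M"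
    and "(LINT t|density M (indicator G). (v t)\<^sup>2) = (LINT t|M. (indicator G t * v t)\<^sup>2)"
proof -
  have d: "density M (indicator G) = density M (\<lambda>t. ennreal (indicator G t))"
    by (simp add: ennreal_indicator)
  have gm: "(indicator G :: real \<Rightarrow> real) \<in> borel_measurable M" using G by (rule borel_measurable_indicator)
  have sq: "(indicator G t * v t)\<^sup>2 = indicator G t * (v t)\<^sup>2" for t by (simp add: indicator_def)
  have v2: "(\<lambda>t. (v t)\<^sup>2) \<in> borel_measurable M" using v by simp
  show "v \<in> L2_on (density M (indicator G)) \<longleftrightarrow> (\<lambda>t. indicator G t * v t) \<in> L2_on M"
    unfolding L2_on_def mem_Collect_eq sq d using integrable_real_density[OF gm _ v2] v gm by simp
  show "(LINT t|density M (indicator G). (v t)\<^sup>2) = (LINT t|M. (indicator G t * v t)\<^sup>2)"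
    unfolding sq d using integral_real_density[OF gm _ v2] by simp
qed

lemma emeasure_density_indicator_le:
  assumes "G \<in> sets M" shows "emeasure (density M (indicator G)) A \<le> emeasure M A"
proof (cases "A \<in> sets M")
  case True
  then show ?thesis using assms by (simp add: emeasure_restricted emeasure_mono)
next
  case False
  then show ?thesis by (simp add: emeasure_notin_sets)
qed

text \<open>Finite mass of \<nu> near an endpoint remains finite after restriction, so a boundary
  condition demanded by \<nu> is already demanded by the smaller measure.\<close>

lemma form_rep_density:
  assumes G: "G \<in> sets \<nu>" and sets: "sets \<nu> = sets (restrict_space borel (einterval a b))"
    and v: "v \<in> borel_measurable \<nu>"
    and rep: "form_rep a b (density \<nu> (indicator G)) m u w v"
  shows "form_rep a b \<nu> m u w (\<lambda>t. indicator G t * v t)"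
proof -
  have "finite_left a b (density \<nu> (indicator G))" if "finite_left a b \<nu>"
    using that emeasure_density_indicator_le[OF G] unfolding finite_left_def by (meson le_less_trans)
  moreover have "finite_right a b (density \<nu> (indicator G))" if "finite_right a b \<nu>"
    using that emeasure_density_indicator_le[OF G] unfolding finite_right_def by (meson le_less_trans)
  ultimately show ?thesis
    using rep unfolding form_rep_def primitive_on_density[OF G v sets] L2_on_density(1)[OF G v] by blast
qed

lemma assoc_scale_primitive:
  assumes ab: "a < b" and s: "scaling_function a b s" and e: "e \<in> einterval a b" and G: "G \<in> char_sets a b s"
  shows "primitive_on a b (stieltjes_measure a b s) (assoc_scale a b s e G) (indicator G)"
proof -
  let ?\<nu> = "stieltjes_measure a b s"
  interpret diffuse_interval_measure a b ?\<nu> by (rule diffuse_stieltjes_measure(1)[OF ab s])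
  have Gm: "G \<in> sets ?\<nu>" using G by (simp add: char_sets_def)
  have i: "set_integrable ?\<nu> {x..y} (indicator G :: real \<Rightarrow> real)" if "x \<in> I" "y \<in> I" for x y
  proof -
    have "integrable ?\<nu> (indicator {x..y} :: real \<Rightarrow> real)" using finite_Icc[OF that] Icc_sets[OF that] by simp
    from integrable_mult_indicator[OF Gm this] show ?thesis by (simp add: set_integrable_def mult.commute)
  qed
  \<comment> \<open>Interval integrals run over open intervals and primitives over closed ones; the
    endpoints are null.\<close>
  have oc: "(LINT t:einterval (ereal x) (ereal y)|?\<nu>. indicator G t) = (LINT t:{x..y}|?\<nu>. (indicator G t :: real))"
    if "x \<in> I" "y \<in> I" for x y
    unfolding set_lebesgue_integral_def
  proof (rule integral_cong_AE)
    have "einterval (ereal x) (ereal y) \<in> sets ?\<nu>"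
      unfolding sets_iff using Icc_sub[OF that] by (auto simp: einterval_eq)
    then show "(\<lambda>t. indicator (einterval (ereal x) (ereal y)) t *\<^sub>R (indicator G t :: real)) \<in> borel_measurable ?\<nu>"
      using Gm by (intro borel_measurable_scaleR borel_measurable_indicator)
    show "(\<lambda>t. indicator {x..y} t *\<^sub>R (indicator G t :: real)) \<in> borel_measurable ?\<nu>"
      using Gm Icc_sets[OF that] by (intro borel_measurable_scaleR borel_measurable_indicator)
    show "AE t in ?\<nu>. indicator (einterval (ereal x) (ereal y)) t *\<^sub>R (indicator G t :: real) = indicator {x..y} t *\<^sub>R indicator G t"
      using AE_not_point[OF that(1)] AE_not_point[OF that(2)]
      by eventually_elim (auto simp: einterval_eq indicator_def)
  qed
  show ?thesis
  proof (rule primI_base[OF i e, of _ 0])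
    show "assoc_scale a b s e G t = 0 + (LINT s:{e..t}|?\<nu>. indicator G s)" if "t \<in> I" "e \<le> t" for t
      using oc[OF e that(1)] that(2) by (simp add: assoc_scale_def interval_lebesgue_integral_def)
    show "assoc_scale a b s e G t = 0 - (LINT s:{t..e}|?\<nu>. indicator G s)" if "t \<in> I" "t < e" for t
      using oc[OF that(1) e] that(2) by (simp add: assoc_scale_def interval_lebesgue_integral_def)
  qed
qed

lemma assoc_scale_increment:
  assumes ab: "a < b" and s: "scaling_function a b s" and e: "e \<in> einterval a b" and G: "G \<in> char_sets a b s"
    and xy: "x \<in> einterval a b" "y \<in> einterval a b" "x \<le> y"
  shows "ennreal (assoc_scale a b s e G y - assoc_scale a b s e G x) = emeasure (stieltjes_measure a b s) (G \<inter> {x..y})"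
proof -
  let ?\<nu> = "stieltjes_measure a b s"
  interpret diffuse_interval_measure a b ?\<nu> by (rule diffuse_stieltjes_measure(1)[OF ab s])
  have Gm: "G \<in> sets ?\<nu>" using G by (simp add: char_sets_def)
  have Bm: "G \<inter> {x..y} \<in> sets ?\<nu>" using Gm Icc_sets[OF xy(1,2)] by (rule sets.Int)
  have "emeasure ?\<nu> (G \<inter> {x..y}) \<le> emeasure ?\<nu> {x..y}" using Icc_sets[OF xy(1,2)] by (intro emeasure_mono) auto
  then have fin: "emeasure ?\<nu> (G \<inter> {x..y}) < \<infinity>" using finite_Icc[OF xy(1,2)] by (rule le_less_trans)
  have "assoc_scale a b s e G y - assoc_scale a b s e G x = (LINT t:{x..y}|?\<nu>. indicator G t)"
    by (rule primD[OF assoc_scale_primitive[OF ab s e G] xy])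
  also have "\<dots> = (LINT t|?\<nu>. indicator (G \<inter> {x..y}) t)"
    unfolding set_lebesgue_integral_def by (intro Bochner_Integration.integral_cong) (auto simp: indicator_def)
  also have "\<dots> = measure ?\<nu> (G \<inter> {x..y})"
    using sets.sets_into_space[OF Bm] by (simp add: Int_absorb2)
  finally show ?thesis using fin by (simp add: emeasure_eq_ennreal_measure less_top[symmetric])
qed

lemma assoc_scale_scaling_function:
  assumes ab: "a < b" and s: "scaling_function a b s" and e: "e \<in> einterval a b" and G: "G \<in> char_sets a b s"
  shows "scaling_function a b (assoc_scale a b s e G)"
  unfolding scaling_function_def
proof
  let ?\<nu> = "stieltjes_measure a b s"
  interpret diffuse_interval_measure a b ?\<nu> by (rule diffuse_stieltjes_measure(1)[OF ab s])
  show "continuous_on (einterval a b) (assoc_scale a b s e G)"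
    by (rule prim_continuous[OF assoc_scale_primitive[OF assms]])
  show "strict_mono_on (einterval a b) (assoc_scale a b s e G)"
  proof (rule strict_mono_onI)
    fix x y assume xy: "x \<in> I" "y \<in> I" "x < y"
    have "0 < emeasure ?\<nu> (G \<inter> {x<..<y})" using G xy by (simp add: char_sets_def)
    also have "\<dots> \<le> emeasure ?\<nu> (G \<inter> {x..y})"
      using G Icc_sets[OF xy(1,2)] by (intro emeasure_mono sets.Int) (auto simp: char_sets_def)
    also have "\<dots> = ennreal (assoc_scale a b s e G y - assoc_scale a b s e G x)"
      using xy by (intro assoc_scale_increment[OF assms, symmetric]) auto
    finally show "assoc_scale a b s e G x < assoc_scale a b s e G y" by simp
  qed
qed

text \<open>Both measures give a half-open interval the mass of its intersection with
  \<open>G\<close>. These intervals generate the sigma-algebra, are stable under intersection and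
  exhaust \<open>I\<close> with finite masses.\<close>

lemma stieltjes_measure_assoc_scale:
  assumes ab: "a < b" and s: "scaling_function a b s" and e: "e \<in> einterval a b" and G: "G \<in> char_sets a b s"
  shows "stieltjes_measure a b (assoc_scale a b s e G) = density (stieltjes_measure a b s) (indicator G)"
proof -
  let ?I = "einterval a b" and ?\<nu> = "stieltjes_measure a b s" and ?t = "assoc_scale a b s e G"
  let ?E = "(\<lambda>(c, d). {c<..d}) ` {(c, d). c \<in> ?I \<and> d \<in> ?I \<and> c \<le> d}"
  interpret diffuse_interval_measure a b ?\<nu> by (rule diffuse_stieltjes_measure(1)[OF ab s])
  have t: "scaling_function a b ?t" by (rule assoc_scale_scaling_function[OF assms])
  have Gm: "G \<in> sets ?\<nu>" using G by (simp add: char_sets_def)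
  have EP: "?E \<subseteq> Pow ?I" using Ioc_subset_einterval by fast
  have gen: "sets (stieltjes_measure a b r) = sigma_sets ?I ?E" for r
    unfolding stieltjes_measure_def by (subst sets_extend_measure) (use EP in auto)
  obtain l u where "exhausts l u" using ex_exhausts by blast
  note lu = exhaustsD[OF this]
  show ?thesis
  proof (rule measure_eqI_generator_eq[of ?E ?I _ _ "\<lambda>i. {l i<..u i}"])
    show "Int_stable ?E"
    proof (rule Int_stableI)
      fix A B assume "A \<in> ?E" "B \<in> ?E"
      then obtain c d c' d' where A: "A = {c<..d}" "c \<in> ?I" "d \<in> ?I" "c \<le> d"
        and B: "B = {c'<..d'}" "c' \<in> ?I" "d' \<in> ?I" "c' \<le> d'" by auto
      \<comment> \<open>The outer maximum keeps the endpoints ordered when the intersection is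
        empty.\<close>
      have "A \<inter> B = {max c c'<..max (max c c') (min d d')}" unfolding A B by auto
      moreover have "max c c' \<in> ?I" "max (max c c') (min d d') \<in> ?I"
        using A B by (auto simp: max_def min_def)
      ultimately show "A \<inter> B \<in> ?E"
        by (intro image_eqI[of _ _ "(max c c', max (max c c') (min d d'))"]) auto
    qed
    show "?E \<subseteq> Pow ?I" by (rule EP)
    show "sets (stieltjes_measure a b ?t) = sigma_sets ?I ?E" by (rule gen)
    show "sets (density ?\<nu> (indicator G)) = sigma_sets ?I ?E" unfolding sets_density by (rule gen)
    show "range (\<lambda>i. {l i<..u i}) \<subseteq> ?E" using lu(1-3) by (force intro: less_imp_le)
    show "(\<Union>i. {l i<..u i}) = ?I"
    proof (intro set_eqI iffI)
      fix x assume "x \<in> (\<Union>i. {l i<..u i})"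
      then show "x \<in> ?I" using mem_between[OF lu(1,2)] by (auto intro: less_imp_le)
    next
      fix x assume "x \<in> ?I"
      from eventually_conj[OF lu(7)[OF this] lu(8)[OF this]]
      obtain i where "l i < x" "x < u i" by (auto simp: eventually_sequentially)
      then show "x \<in> (\<Union>i. {l i<..u i})" by (intro UN_I[of i]) auto
    qed
    show "emeasure (stieltjes_measure a b ?t) {l i<..u i} \<noteq> \<infinity>" for i
      using emeasure_stieltjes_measure_Ioc[OF t lu(1,2), of i i] lu(3)[of i] by simp
    fix X assume "X \<in> ?E"
    then obtain c d where X: "X = {c<..d}" "c \<in> ?I" "d \<in> ?I" "c \<le> d" by auto
    have Xm: "{c<..d} \<in> sets ?\<nu>" by (rule Ioc_sets_stieltjes_measure[OF s X(2,3,4)])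
    have "emeasure (stieltjes_measure a b ?t) X = emeasure ?\<nu> (G \<inter> {c..d})"
      using emeasure_stieltjes_measure_Ioc[OF t X(2,3,4)] assoc_scale_increment[OF assms X(2,3,4)] X(1) by simp
    also have "\<dots> = emeasure ?\<nu> (G \<inter> {c<..d})"
    proof (rule emeasure_eq_AE)
      show "AE x in ?\<nu>. x \<in> G \<inter> {c..d} \<longleftrightarrow> x \<in> G \<inter> {c<..d}"
        using AE_not_point[OF X(2)] by eventually_elim auto
    qed (use Gm Xm Icc_sets[OF X(2,3)] in \<open>auto intro: sets.Int\<close>)
    also have "\<dots> = emeasure (density ?\<nu> (indicator G)) X"
      unfolding X(1) by (rule emeasure_restricted[OF Gm Xm, symmetric])
    finally show "emeasure (stieltjes_measure a b ?t) X = emeasure (density ?\<nu> (indicator G)) X" .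
  qed
qed

section \<open>Mosco convergence\<close>

text \<open>At index \<open>n\<close> the tolerance is the smallest \<open>1 / Suc k\<close> among
  those \<open>k \<le> n\<close> whose threshold \<open>N k\<close> has been reached.\<close>

lemma diagonal_selection:
  fixes P :: "nat \<Rightarrow> real \<Rightarrow> 'f \<Rightarrow> bool"
  assumes ex: "\<And>\<epsilon>. \<epsilon> > 0 \<Longrightarrow> \<forall>\<^sub>F n in sequentially. \<exists>f. P n \<epsilon> f"
    and mono: "\<And>n \<epsilon> \<epsilon>' f. P n \<epsilon> f \<Longrightarrow> \<epsilon> \<le> \<epsilon>' \<Longrightarrow> P n \<epsilon>' f"
  obtains f where "\<And>\<epsilon>. \<epsilon> > 0 \<Longrightarrow> \<forall>\<^sub>F n in sequentially. P n \<epsilon> (f n)"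
proof -
  have "\<forall>k. \<exists>N. \<forall>n\<ge>N. \<exists>f. P n (1 / real (Suc k)) f"
    using ex unfolding eventually_sequentially by simp
  then obtain N where N: "\<And>k n. n \<ge> N k \<Longrightarrow> \<exists>f. P n (1 / real (Suc k)) f" by metis
  \<comment> \<open>The clause \<open>k \<le> n\<close> makes the set finite, so a maximum exists
    once the set is nonempty; the finitely many earlier values do not matter.\<close>
  define S where "S n = {k. k \<le> n \<and> N k \<le> n}" for n
  define f where "f n = (SOME f. P n (1 / real (Suc (Max (S n)))) f)" for n
  have fin: "finite (S n)" for n by (rule finite_subset[of _ "{..n}"]) (auto simp: S_def)
  have "\<forall>\<^sub>F n in sequentially. P n \<epsilon> (f n)" if "\<epsilon> > 0" for \<epsilon>
  proof -
    obtain k where k: "1 / real (Suc k) < \<epsilon>" using nat_approx_posE[OF \<open>\<epsilon> > 0\<close>] by blast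
    show ?thesis
    proof (rule eventually_sequentiallyI[of "max k (N k)"])
      fix n assume "max k (N k) \<le> n"
      then have kS: "k \<in> S n" by (simp add: S_def)
      then have "Max (S n) \<in> S n" using fin by (intro Max_in) auto
      then have "\<exists>f. P n (1 / real (Suc (Max (S n)))) f" by (intro N) (simp add: S_def)
      then have "P n (1 / real (Suc (Max (S n)))) (f n)" unfolding f_def by (rule someI_ex)
      moreover have "1 / real (Suc (Max (S n))) \<le> 1 / real (Suc k)"
        using Max_ge[OF fin kS] by (simp add: frac_le)
      ultimately show "P n \<epsilon> (f n)" using mono k by (meson less_imp_le order_trans)
    qed
  qed
  then show thesis by (rule that)
qed

section \<open>All scales expressed through the limit measure\<close>

locale increasing_char_sets =
  fixes a b :: ereal and m :: "real measure" and s :: "real \<Rightarrow> real" and e :: real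
    and G :: "nat \<Rightarrow> real set" and Ginf :: "real set"
  assumes ab: "a < b" and m: "radon_measure_on a b m" "fully_supported_on a b m"
    and s: "scaling_function a b s" and e: "e \<in> einterval a b"
    and G: "\<And>n. n \<ge> 1 \<Longrightarrow> G n \<in> char_sets a b s"
    and inc: "\<And>n. n \<ge> 1 \<Longrightarrow> AE x in stieltjes_measure a b s. x \<in> G n \<longrightarrow> x \<in> G (Suc n)"
    and Ginf_sets: "Ginf \<in> sets (stieltjes_measure a b s)"
    and Ginf_eq: "AE x in stieltjes_measure a b s. x \<in> Ginf \<longleftrightarrow> x \<in> (\<Union>n\<in>{1..}. G n)"
begin

abbreviation "\<mu> \<equiv> stieltjes_measure a b s"
abbreviation "sn n \<equiv> assoc_scale a b s e (G n)"
abbreviation "sinf \<equiv> assoc_scale a b s e Ginf"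
definition "\<nu> = stieltjes_measure a b sinf"

lemma G_sets: "n \<ge> 1 \<Longrightarrow> G n \<in> sets \<mu>"
  using G by (auto simp: char_sets_def)

lemma AE_G_sub: "n \<ge> 1 \<Longrightarrow> AE x in \<mu>. x \<in> G n \<longrightarrow> x \<in> Ginf"
  using Ginf_eq by eventually_elim auto

lemma Ginf_char: "Ginf \<in> char_sets a b s"
  unfolding char_sets_def mem_Collect_eq
proof (intro conjI ballI impI Ginf_sets)
  fix c d assume cd: "c \<in> einterval a b" "d \<in> einterval a b" "c < d"
  have "0 < emeasure \<mu> (G 1 \<inter> {c<..<d})" using G[of 1] cd by (simp add: char_sets_def)
  also have "\<dots> \<le> emeasure \<mu> (Ginf \<inter> {c<..<d})"
  proof (rule emeasure_mono_AE)
    show "AE x in \<mu>. x \<in> G 1 \<inter> {c<..<d} \<longrightarrow> x \<in> Ginf \<inter> {c<..<d}"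
      using AE_G_sub[of 1] by (auto elim: eventually_mono)
    have "{c<..<d} \<subseteq> einterval a b" using Icc_subset_einterval[OF cd(1,2)] by auto
    then have "{c<..<d} \<in> sets \<mu>" by (simp add: sets_einterval_eq)
    with Ginf_sets show "Ginf \<inter> {c<..<d} \<in> sets \<mu>" by (rule sets.Int)
  qed
  finally show "0 < emeasure \<mu> (Ginf \<inter> {c<..<d})" .
qed

lemma \<nu>_density: "\<nu> = density \<mu> (indicator Ginf)"
  unfolding \<nu>_def by (rule stieltjes_measure_assoc_scale[OF ab s e Ginf_char])

lemma sinf: "scaling_function a b sinf"
  by (rule assoc_scale_scaling_function[OF ab s e Ginf_char])

lemma sn: "n \<ge> 1 \<Longrightarrow> scaling_function a b (sn n)"
  by (rule assoc_scale_scaling_function[OF ab s e G])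

lemma sets_\<nu>: "sets \<nu> = sets (restrict_space borel (einterval a b))"
  by (simp add: \<nu>_def)

lemma G_sets_\<nu>: "n \<ge> 1 \<Longrightarrow> G n \<in> sets \<nu>"
  using G_sets sets_\<nu> by simp

text \<open>\<open>G n\<close> is contained in \<open>Ginf\<close> up to a null set, so restricting
  first to \<open>Ginf\<close> and then to \<open>G n\<close> amounts to restricting to
  \<open>G n\<close>. This places all the forms on the single measure \<nu>.\<close>

lemma stieltjes_sn:
  assumes n: "n \<ge> 1" shows "stieltjes_measure a b (sn n) = density \<nu> (indicator (G n))"
proof -
  have im: "(indicator A :: real \<Rightarrow> ennreal) \<in> borel_measurable \<mu>" if "A \<in> sets \<mu>" for A
    using that by (rule borel_measurable_indicator)
  have "density \<nu> (indicator (G n)) = density \<mu> (\<lambda>x. indicator Ginf x * indicator (G n) x)"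
    unfolding \<nu>_density by (rule density_density_eq) (use G_sets[OF n] Ginf_sets im in auto)
  also have "\<dots> = density \<mu> (indicator (G n))"
  proof (rule density_cong)
    show "AE x in \<mu>. indicator Ginf x * indicator (G n) x = (indicator (G n) x :: ennreal)"
      using AE_G_sub[OF n] by eventually_elim (auto simp: indicator_def)
  qed (use G_sets[OF n] Ginf_sets im in \<open>auto intro: borel_measurable_times\<close>)
  finally show ?thesis using stieltjes_measure_assoc_scale[OF ab s e G[OF n]] by simp
qed

text \<open>Almost every point of \<nu> lies in some \<open>G k\<close> and from then on in all
  later sets. The shift by one is there because inclusions and union start at index 1.\<close>

lemma AE_G_tendsto: "AE t in \<nu>. (\<lambda>n. indicator (G (Suc n)) t :: real) \<longlonglongrightarrow> 1"
proof -
  have "AE t in \<mu>. \<forall>n. t \<in> G (Suc n) \<longrightarrow> t \<in> G (Suc (Suc n))"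
    unfolding AE_all_countable using inc by simp
  then have "AE t in \<mu>. t \<in> Ginf \<longrightarrow> (\<lambda>n. indicator (G (Suc n)) t :: real) \<longlonglongrightarrow> 1"
    using Ginf_eq
  proof (eventually_elim, intro impI)
    fix t assume step: "\<forall>n. t \<in> G (Suc n) \<longrightarrow> t \<in> G (Suc (Suc n))"
      and eq: "t \<in> Ginf \<longleftrightarrow> t \<in> (\<Union>n\<in>{1..}. G n)" and "t \<in> Ginf"
    then obtain k where k: "k \<ge> 1" "t \<in> G k" by auto
    then obtain j where j: "t \<in> G (Suc j)" by (cases k) auto
    have "t \<in> G (Suc n)" if "j \<le> n" for n using that by (induction rule: dec_induct) (use j step in auto)
    then have "\<forall>\<^sub>F n in sequentially. (indicator (G (Suc n)) t :: real) = 1"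
      by (intro eventually_sequentiallyI[of j]) simp
    then show "(\<lambda>n. indicator (G (Suc n)) t :: real) \<longlonglongrightarrow> 1" by (rule tendsto_eventually)
  qed
  then show ?thesis
    unfolding \<nu>_density using borel_measurable_indicator[OF Ginf_sets]
    by (subst AE_density) (auto elim!: eventually_mono simp: indicator_def split: if_splits)
qed

sublocale interval_form a b \<nu> m
  unfolding \<nu>_def by (rule interval_form_stieltjes[OF ab m sinf])

abbreviation "domn n \<equiv> form_dom0 a b (sn n) m"
abbreviation "En n u \<equiv> form_energy a b (sn n) m u u"
abbreviation "Einf u \<equiv> form_energy a b sinf m u u"

text \<open>The inclusion of the n-th domain in the limit domain with unchanged energy: the
  derivative with respect to \<nu> is that of the n-th scale, set to 0 off
  \<open>G n\<close>.\<close>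

lemma sn_rep:
  assumes n: "n \<ge> 1" and u: "u \<in> domn n"
  obtains w v where "form_rep a b \<nu> m u w v"
    "En n u = (1/2) * sqnorm \<nu> v"
proof -
  obtain w v where rep: "form_rep a b (stieltjes_measure a b (sn n)) m u w v" and uL: "u \<in> L2_on m"
    using form_dom0_rep(2)[OF ab m sn[OF n] u] by blast
  have en: "En n u = (1/2) * (LINT t|stieltjes_measure a b (sn n). (v t)\<^sup>2)"
    using form_dom0_rep(1)[OF ab m sn[OF n] rep uL] by simp
  have vm: "v \<in> borel_measurable \<nu>"
    using rep L2_onD(1)[of v "stieltjes_measure a b (sn n)"] unfolding form_rep_def
    by (auto simp: stieltjes_sn[OF n])
  show thesis
  proof (rule that)
    show "form_rep a b \<nu> m u w (\<lambda>t. indicator (G n) t * v t)"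
      by (rule form_rep_density[OF G_sets_\<nu>[OF n] sets_\<nu> vm rep[unfolded stieltjes_sn[OF n]]])
    show "En n u = (1/2) * (LINT t|\<nu>. (indicator (G n) t * v t)\<^sup>2)"
      unfolding en stieltjes_sn[OF n] L2_on_density(2)[OF G_sets_\<nu>[OF n] vm] ..
  qed
qed

text \<open>A failure provides infinitely many indices with energy at most some \<open>y\<close>
  below the energy of \<open>g\<close>. Along them the functions still converge weakly to
  \<open>g\<close>, so \<open>form_rep_weak_limit\<close> bounds the energy of \<open>g\<close> by
  \<open>y\<close>.\<close>

lemma liminf_condition:
  assumes f: "\<And>n. f n \<in> L2_on m" and g: "g \<in> L2_on m" and weak: "weak_conv_L2 m f g"
  shows "extended_energy (scale_form0 a b sinf m) g \<le> liminf (\<lambda>n. extended_energy (scale_form0 a b (sn n) m) (f n))"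
  unfolding le_Liminf_iff
proof (intro allI impI)
  let ?X = "\<lambda>n. extended_energy (scale_form0 a b (sn n) m) (f n)"
  fix y :: ereal
  \<comment> \<open>The first clause keeps to indices at which \<open>G n\<close> is known to be a
    characteristic set.\<close>
  let ?Q = "\<lambda>n. n \<ge> 1 \<and> f n \<in> domn n \<and> ereal (En n (f n)) \<le> y"
  assume y: "y < extended_energy (scale_form0 a b sinf m) g"
  show "\<forall>\<^sub>F n in sequentially. y < ?X n"
  proof (rule ccontr)
    assume "\<not> ?thesis"
    then have "\<exists>\<^sub>F n in sequentially. ?X n \<le> y" by (simp add: frequently_def not_le)
    then have inf: "\<forall>N. \<exists>n\<ge>N. ?X n \<le> y" by (simp add: frequently_sequentially)
    have "y < \<infinity>" using y by (rule less_le_trans) simp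
    have "\<exists>n\<ge>Suc N. f n \<in> domn n \<and> ereal (En n (f n)) \<le> y" for N
    proof -
      obtain n where n: "n \<ge> Suc N" "?X n \<le> y" using inf by blast
      then have "?X n \<noteq> \<infinity>" using \<open>y < \<infinity>\<close> by auto
      then show ?thesis using n by (intro exI[of _ n]) (auto simp: extended_energy_def scale_form0_def split: if_splits)
    qed
    then have Q: "\<exists>n>N. ?Q n" for N
      by (metis Suc_le_eq Suc_leI le_zero_eq less_one not_le zero_less_Suc less_le_trans)
    then have "infinite {n. ?Q n}"
      unfolding infinite_nat_iff_unbounded by blast
    then obtain r :: "nat \<Rightarrow> nat" where r: "strict_mono r"
      "\<And>k. ?Q (r k)"
      using infinite_enumerate by blast
    \<comment> \<open>A real energy below \<open>y\<close> excludes
      \<open>y = -\<infinity>\<close>.\<close>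
    have "ereal (En (r 0) (f (r 0))) \<le> y" using r(2) by blast
    then obtain C where C: "y = ereal C" using \<open>y < \<infinity>\<close> by (cases y) auto
    \<comment> \<open>The 2 undoes the factor 1/2 in the energy.\<close>
    have "\<forall>k. \<exists>w v. form_rep a b \<nu> m (f (r k)) w v \<and> sqnorm \<nu> v \<le> 2 * C"
    proof
      fix k
      obtain w v where "form_rep a b \<nu> m (f (r k)) w v"
          "En (r k) (f (r k)) = (1/2) * sqnorm \<nu> v"
        using sn_rep r(2)[of k] by blast
      then show "\<exists>w v. form_rep a b \<nu> m (f (r k)) w v \<and> sqnorm \<nu> v \<le> 2 * C"
        using r(2)[of k] C by (intro exI[of _ w] exI[of _ v]) auto
    qed
    then obtain w v where wv: "\<And>k. form_rep a b \<nu> m (f (r k)) (w k) (v k)" "\<And>k. (LINT t|\<nu>. (v k t)\<^sup>2) \<le> 2 * C"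
      by metis
    have weak': "weak_conv_L2 m (\<lambda>k. f (r k)) g"
      unfolding weak_conv_L2_def
    proof
      fix h assume "h \<in> L2_on m"
      then have "(\<lambda>n. LINT x|m. f n x * h x) \<longlonglongrightarrow> (LINT x|m. g x * h x)" using weak by (simp add: weak_conv_L2_def)
      from LIMSEQ_subseq_LIMSEQ[OF this r(1)] show "(\<lambda>k. LINT x|m. f (r k) x * h x) \<longlonglongrightarrow> (LINT x|m. g x * h x)"
        by (simp add: o_def)
    qed
    obtain wl zl where lim: "form_rep a b \<nu> m g wl zl" "sqnorm \<nu> zl \<le> 2 * C"
      using form_rep_weak_limit[OF f g weak' wv] by blast
    have "g \<in> form_dom0 a b sinf m \<and> Einf g = (1/2) * sqnorm \<nu> zl"
      using form_dom0_rep(1)[OF ab m sinf _ g] lim(1) unfolding \<nu>_def by blast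
    then have "extended_energy (scale_form0 a b sinf m) g \<le> y"
      using lim(2) C by (simp add: extended_energy_def scale_form0_def)
    then show False using y by simp
  qed
qed

lemma recovery_near:
  assumes g: "g \<in> form_dom0 a b sinf m" and "\<epsilon> > 0"
  shows "\<forall>\<^sub>F n in sequentially. \<exists>f. f \<in> L2_on m \<and> f \<in> domn n \<and> sqnorm m (\<lambda>t. f t - g t) \<le> \<epsilon> \<and>
    En n f \<le> Einf g + \<epsilon>" (is "eventually ?P sequentially")
proof -
  obtain w v where gL: "g \<in> L2_on m" and rep: "form_rep a b \<nu> m g w v"
    using form_dom0_rep(2)[OF ab m sinf g] unfolding \<nu>_def by blast
  have en: "Einf g = (1/2) * sqnorm \<nu> v"
    using form_dom0_rep(1)[OF ab m sinf rep[unfolded \<nu>_def] gL] by (simp add: \<nu>_def)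
  \<comment> \<open>The two squared distances of size \<epsilon>/4 enter with weight 2 each and add
    up to \<epsilon>; the energies need even less.\<close>
  have \<eta>: "\<epsilon>/4 > 0" using \<open>\<epsilon> > 0\<close> by simp
  obtain w1 v1 p q where 1: "w1 \<in> L2_on m" "prim w1 v1" "v1 \<in> L2_on \<nu>"
    "sqnorm \<nu> v1 \<le> sqnorm \<nu> v + \<epsilon>/4" "sqnorm m (\<lambda>t. w1 t - g t) \<le> \<epsilon>/4"
    "p \<in> I" "q \<in> I" "p < q" "\<And>t. t \<le> p \<Longrightarrow> w1 t = 0" "\<And>t. t \<in> I \<Longrightarrow> q \<le> t \<Longrightarrow> w1 t = 0"
    using compact_support_approx[OF gL rep \<eta>] by blast
  have "\<forall>\<^sub>F n in sequentially. \<exists>w' v'. w' \<in> L2_on m \<and> prim w' v' \<and> v' \<in> L2_on \<nu> \<and> (\<forall>t. t \<notin> G (Suc n) \<longrightarrow> v' t = 0) \<and>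
    (\<forall>t\<in>I. t < p \<or> q < t \<longrightarrow> w' t = 0) \<and> sqnorm m (\<lambda>t. w' t - w1 t) \<le> \<epsilon>/4 \<and>
    sqnorm \<nu> v' \<le> sqnorm \<nu> v1 + \<epsilon>/4"
    by (rule char_set_approx[OF 1(1-3,6-10)]) (use G_sets_\<nu> AE_G_tendsto \<eta> in auto)
  then have "\<forall>\<^sub>F n in sequentially. ?P (Suc n)"
  proof eventually_elim
    fix n assume "\<exists>w' v'. w' \<in> L2_on m \<and> prim w' v' \<and> v' \<in> L2_on \<nu> \<and> (\<forall>t. t \<notin> G (Suc n) \<longrightarrow> v' t = 0) \<and>
      (\<forall>t\<in>I. t < p \<or> q < t \<longrightarrow> w' t = 0) \<and> sqnorm m (\<lambda>t. w' t - w1 t) \<le> \<epsilon>/4 \<and>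
      sqnorm \<nu> v' \<le> sqnorm \<nu> v1 + \<epsilon>/4"
    then obtain w' v' where 2: "w' \<in> L2_on m" "prim w' v'" "v' \<in> L2_on \<nu>" "\<And>t. t \<notin> G (Suc n) \<Longrightarrow> v' t = 0"
      "\<And>t. t \<in> I \<Longrightarrow> t < p \<or> q < t \<Longrightarrow> w' t = 0" "sqnorm m (\<lambda>t. w' t - w1 t) \<le> \<epsilon>/4"
      "sqnorm \<nu> v' \<le> sqnorm \<nu> v1 + \<epsilon>/4" by blast
    have n: "Suc n \<ge> 1" by simp
    note Gn = G_sets_\<nu>[OF n]
    have v'm: "v' \<in> borel_measurable \<nu>" using L2_onD(1)[OF 2(3)] .
    have v'G: "indicator (G (Suc n)) t * v' t = v' t" for t using 2(4)[of t] by (auto simp: indicator_def)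
    have "form_rep a b (stieltjes_measure a b (sn (Suc n))) m w' w' v'"
      unfolding form_rep_def stieltjes_sn[OF n] primitive_on_density[OF Gn v'm sets_\<nu>] L2_on_density(1)[OF Gn v'm] v'G
    proof (intro conjI impI 2(2,3))
      \<comment> \<open>Compact support meets the boundary conditions of the n-th form even at
        endpoints that are regular for it but not for the limit.\<close>
      show "vanishes_left a b w'" unfolding vanishes_left_def
        using 1(6) 2(5) by (intro allI impI bexI[of _ p]) auto
      show "vanishes_right a b w'" unfolding vanishes_right_def
        using 1(7) 2(5) by (intro allI impI bexI[of _ q]) auto
    qed simp
    then have dom: "w' \<in> domn (Suc n)"
      and en': "En (Suc n) w' = (1/2) * sqnorm \<nu> v'"
      using form_dom0_rep(1)[OF ab m sn[OF n] _ 2(1)] L2_on_density(2)[OF Gn v'm, unfolded v'G]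
      unfolding stieltjes_sn[OF n] by auto
    have "sqnorm m (\<lambda>t. w' t - g t) = (LINT t|m. ((w' t - w1 t) + (w1 t - g t))\<^sup>2)" by simp
    also have "\<dots> \<le> (1 + 1) * sqnorm m (\<lambda>t. w' t - w1 t) + (1 + 1/1) * sqnorm m (\<lambda>t. w1 t - g t)"
      by (intro L2_norm_add_le L2_on_diff 1 2 gL) simp
    also have "\<dots> \<le> \<epsilon>" using 1(5) 2(6) by simp
    finally have "sqnorm m (\<lambda>t. w' t - g t) \<le> \<epsilon>" .
    moreover have "En (Suc n) w' \<le> Einf g + \<epsilon>"
      unfolding en en' using 1(4) 2(7) \<open>\<epsilon> > 0\<close> by simp
    ultimately show "?P (Suc n)"
      using 2(1) dom by blast
  qed
  then show ?thesis
    using eventually_sequentially_Suc[of ?P] by simp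
qed

lemma limsup_condition:
  assumes g: "g \<in> L2_on m"
  shows "\<exists>f. (\<forall>n. f n \<in> L2_on m) \<and> strong_conv_L2 m f g \<and>
    limsup (\<lambda>n. extended_energy (scale_form0 a b (sn n) m) (f n)) \<le> extended_energy (scale_form0 a b sinf m) g"
proof (cases "g \<in> form_dom0 a b sinf m")
  \<comment> \<open>The target energy is infinite, so the constant sequence serves.\<close>
  case False
  then show ?thesis
    using g by (intro exI[of _ "\<lambda>_. g"]) (simp add: strong_conv_L2_def extended_energy_def scale_form0_def)
next
  case True
  define P where "P n \<epsilon> f \<longleftrightarrow> f \<in> L2_on m \<and> f \<in> domn n \<and> sqnorm m (\<lambda>t. f t - g t) \<le> \<epsilon> \<and>
    En n f \<le> Einf g + \<epsilon>" for n \<epsilon> f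
  obtain f0 where f0: "\<And>\<epsilon>. \<epsilon> > 0 \<Longrightarrow> \<forall>\<^sub>F n in sequentially. P n \<epsilon> (f0 n)"
    using diagonal_selection[of P] recovery_near[OF True] unfolding P_def by (smt (verit) eventually_mono)
  \<comment> \<open>The selection controls only late indices; the remaining ones are filled with
    \<open>g\<close> to stay square-integrable.\<close>
  define f where "f n = (if f0 n \<in> L2_on m then f0 n else g)" for n
  have fL: "f n \<in> L2_on m" for n using g by (simp add: f_def)
  have f: "\<forall>\<^sub>F n in sequentially. P n \<epsilon> (f n)" if "\<epsilon> > 0" for \<epsilon>
    using f0[OF that] by eventually_elim (auto simp: P_def f_def)
  have "strong_conv_L2 m f g"
    unfolding strong_conv_L2_def
  proof (rule order_tendstoI)
    fix y :: real assume "y < 0"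
    then show "\<forall>\<^sub>F n in sequentially. y < (LINT x|m. (f n x - g x)\<^sup>2)"
      by (intro always_eventually allI) (rule less_le_trans[of _ 0], simp_all)
  next
    fix y :: real assume "0 < y"
    then have "y/2 > 0" by simp
    from f[OF this] show "\<forall>\<^sub>F n in sequentially. (LINT x|m. (f n x - g x)\<^sup>2) < y"
      by eventually_elim (use \<open>0 < y\<close> in \<open>auto simp: P_def\<close>)
  qed
  moreover have "limsup (\<lambda>n. extended_energy (scale_form0 a b (sn n) m) (f n)) \<le> extended_energy (scale_form0 a b sinf m) g"
  proof (rule ereal_le_epsilon2)
    fix \<epsilon> :: real assume "\<epsilon> > 0"
    show "limsup (\<lambda>n. extended_energy (scale_form0 a b (sn n) m) (f n)) \<le> extended_energy (scale_form0 a b sinf m) g + ereal \<epsilon>"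
      by (rule Limsup_bounded, use f[OF \<open>\<epsilon> > 0\<close>] in eventually_elim)
        (use True in \<open>simp add: P_def extended_energy_def scale_form0_def\<close>)
  qed
  ultimately show ?thesis using fL by blast
qed

end

theorem theorem3p11:
  fixes a b :: ereal and m :: "real measure" and s :: "real \<Rightarrow> real" and e :: real
    and G :: "nat \<Rightarrow> real set" and Ginf :: "real set"
  assumes "a < b"
    and "radon_measure_on a b m" and "fully_supported_on a b m"
    and "scaling_function a b s"
    and "e \<in> einterval a b"
    and "\<And>n. n \<ge> 1 \<Longrightarrow> G n \<in> char_sets a b s"
    and "\<And>n. n \<ge> 1 \<Longrightarrow> AE x in stieltjes_measure a b s. x \<in> G n \<longrightarrow> x \<in> G (Suc n)"
    and "Ginf \<in> sets (stieltjes_measure a b s)"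
    and "AE x in stieltjes_measure a b s. x \<in> Ginf \<longleftrightarrow> x \<in> (\<Union>n\<in>{1..}. G n)"
  shows "Ginf \<in> char_sets a b s \<and>
    mosco_converges m
      (\<lambda>n. scale_form0 a b (assoc_scale a b s e (G n)) m)
      (scale_form0 a b (assoc_scale a b s e Ginf) m)"
proof -
  interpret increasing_char_sets a b m s e G Ginf
    using assms by unfold_locales
  show ?thesis
    unfolding mosco_converges_def using Ginf_char liminf_condition limsup_condition by blast
qed

end
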